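(* Let $n\ge 2$, let $f\in\mathcal S_r(\mathbb R^{n-1}\times\mathbb R^{n-1})$, and let $\mathbf f$ be the function on $\mathbb R^{n-1}\times[0,\infty)$ with $f(\mathbf x,\mathbf y)=\mathbf f(\mathbf x,|\mathbf y|)$. For every real $k<n-1$, $$f=(2\pi)^{1-n}I_1^{-k}\,C\,I_1^{k+1-n}F,\qquad F=Cf,$$ and $$\mathbf f=(2\pi)^{1-n}I_1^{-k}\,\mathcal C\,I_1^{k+1-n}\mathbf F,\qquad \mathbf F=\mathcal C\mathbf f.$$
   Context: $\mathcal S_r(\mathbb R^{n-1}\times\mathbb R^{n-1})$ is the set of Schwartz functions $f\in\mathcal S(\mathbb R^{2(n-1)})$ with $f(\mathbf x,\mathbf y)=f(\mathbf x,U\mathbf y)$ for all $(\mathbf x,\mathbf y)$ and all orthogonal transformations $U$ of $\mathbb R^{n-1}$. The cone transform of a function $f$ on $\mathbb R^{n-1}\times\mathbb R^{n-1}$ is $$Cf(\mathbf u,\mathbf v)=\int_{\mathbb R^{n-1}}f(\mathbf u+|\mathbf v|\mathbf y,\mathbf y)\,d\mathbf y.$$ For a function $\mathbf f$ on $\mathbb R^{n-1}\times[0,\infty)$ and $(\mathbf u,s)\in\mathbb R^{n-1}\times[0,\infty)$, $$\mathcal C\mathbf f(\mathbf u,s)=\int_{S^{n-2}}\int_0^\infty\mathbf f(\mathbf u+zs\boldsymbol\theta,z)z^{n-2}\,dz\,dS(\boldsymbol\theta)\ (n\ge3),\qquad \mathcal C\mathbf f(u,s)=\int_0^\infty\big(\mathbf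 f(u+zs,z)+\mathbf f(u-zs,z)\big)dz\ (n=2),$$ where $dS$ is the standard measure on the unit sphere $S^{n-2}$; thus $Cf(\mathbf u,\mathbf v)=\mathcal C\mathbf f(\mathbf u,|\mathbf v|)$ when $f(\mathbf x,\mathbf y)=\mathbf f(\mathbf x,|\mathbf y|)$. $I_1^k$ is the Riesz potential acting on the first $(n-1)$-dimensional variable ($\mathbf u$ or $\mathbf x$), with the second variable fixed: $\mathcal F_1(I_1^kg)(\boldsymbol\xi,\cdot)=|\boldsymbol\xi|^{-k}\mathcal F_1g(\boldsymbol\xi,\cdot)$, where $\mathcal F_1$ is the $(n-1)$-dimensional Fourier transform in the first variable (convention $\int e^{-i\mathbf x\cdot\boldsymbol\xi}g\,d\mathbf x$), so that $I_1^{-k}I_1^kf=f$. *)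

theory Defs
  imports "HOL-Analysis.Analysis"
begin

primrec partials :: "'a::euclidean_space list \<Rightarrow> ('a \<Rightarrow> complex) \<Rightarrow> 'a \<Rightarrow> complex" where
  "partials [] f = f"
| "partials (b # bs) f = (\<lambda>x. frechet_derivative (partials bs f) (at x) b)"

text \<open>
  A multi-index derivative is \<open>partials bs f\<close> for a list \<open>bs\<close> of standard basis vectors.
  Requiring all of these to be differentiable everywhere is smoothness.
\<close>

definition schwartz :: "('a::euclidean_space \<Rightarrow> complex) set" where
  "schwartz = {f. \<forall>bs\<in>lists Basis. (\<forall>x. partials bs f differentiable at x) \<and>
     (\<forall>m::nat. bounded (range (\<lambda>x. of_real (norm x ^ m) * partials bs f x)))}"

definition schwartz_r ::
    "((real ^ 'd::finite) \<times> (real ^ 'd) \<Rightarrow> complex) set" where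
  "schwartz_r = {f \<in> schwartz.
     \<forall>x y U. orthogonal_transformation U \<longrightarrow> f (x, y) = f (x, U y)}"

definition cone_transform ::
    "((real ^ 'd::finite) \<times> (real ^ 'd) \<Rightarrow> complex) \<Rightarrow> (real ^ 'd) \<times> (real ^ 'd) \<Rightarrow> complex" where
  "cone_transform f = (\<lambda>(u, v). LINT y|lborel. f (u + norm v *\<^sub>R y, y))"

text \<open>
  Surface measure on the unit sphere: the measure of \<open>A\<close> is the dimension times the Lebesgue
  measure of the cone \<open>{r \<theta>. 0 < r < 1, \<theta> \<in> A}\<close>.  Note \<open>sgn x = x / norm x\<close>.
\<close>

definition sphere_measure :: "(real ^ 'd::finite) measure" where
  "sphere_measure = scale_measure (of_nat CARD('d))
     (distr (restrict_space lborel (ball 0 1 - {0})) (restrict_space borel (sphere 0 1)) sgn)"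

text \<open>
  The function spaces here consist of functions on \<open>\<real>\<^sup>d \<times> [0, \<infinity>)\<close> with \<open>d = n - 1\<close>; values at a
  negative second argument are never used.  For \<open>d = 1\<close> the map \<open>vec\<close> identifies the reals
  with \<open>\<real>\<^sup>1\<close>.
\<close>

definition radial_cone_transform ::
    "((real ^ 'd::finite) \<times> real \<Rightarrow> complex) \<Rightarrow> (real ^ 'd) \<times> real \<Rightarrow> complex" where
  "radial_cone_transform f = (\<lambda>(u, s).
     if CARD('d) = 1
     then (LINT z:{0..}|lborel. (f (u + vec (z * s), z) + f (u - vec (z * s), z)))
     else (LINT \<theta>|sphere_measure. (LINT z:{0..}|lborel.
            (f (u + (z * s) *\<^sub>R \<theta>, z) * of_real (z ^ (CARD('d) - 1))))))"

definition fourier :: "('a::euclidean_space \<Rightarrow> complex) \<Rightarrow> 'a \<Rightarrow> complex" where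
  "fourier \<phi> \<xi> = (LINT x|lborel. exp (- \<i> * of_real (x \<bullet> \<xi>)) * \<phi> x)"

definition tempered :: "('a::euclidean_space \<Rightarrow> complex) \<Rightarrow> bool" where
  "tempered g \<longleftrightarrow> (\<forall>\<phi>\<in>schwartz. integrable lborel (\<lambda>x. g x * \<phi> x))"

text \<open>
  \<open>has_fourier g \<gamma>\<close>: the Fourier transform of \<open>g\<close> is the function \<open>\<gamma>\<close>, in the sense of tempered
  distributions.  The integral defining \<open>fourier\<close> does not suffice for Riesz potentials of
  positive order: these have a Fourier transform that is unbounded at the origin, and they need
  not be integrable even when the given function is Schwartz.
\<close>

definition has_fourier ::
    "('a::euclidean_space \<Rightarrow> complex) \<Rightarrow> ('a \<Rightarrow> complex) \<Rightarrow> bool" where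
  "has_fourier g \<gamma> \<longleftrightarrow> tempered g \<and> tempered \<gamma> \<and>
     (\<forall>\<phi>\<in>schwartz. (LINT x|lborel. g x * fourier \<phi> x) = (LINT \<xi>|lborel. \<gamma> \<xi> * \<phi> \<xi>))"

text \<open>
  The Fourier transform determines a function only almost everywhere; continuity selects the
  representative for which pointwise identities make sense.  The value of \<open>powr\<close> at \<open>\<xi> = 0\<close> is
  irrelevant, since \<open>{0}\<close> is a null set.
\<close>

definition riesz :: "real \<Rightarrow> ('a::euclidean_space \<Rightarrow> complex) \<Rightarrow> 'a \<Rightarrow> complex" where
  "riesz k g = (THE h. continuous_on UNIV h \<and>
     (\<exists>\<gamma>. has_fourier g \<gamma> \<and> has_fourier h (\<lambda>\<xi>. of_real (norm \<xi> powr (- k)) * \<gamma> \<xi>)))"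

definition riesz1 ::
    "real \<Rightarrow> ('a::euclidean_space \<times> 'b \<Rightarrow> complex) \<Rightarrow> 'a \<times> 'b \<Rightarrow> complex" where
  "riesz1 k g = (\<lambda>(x, y). riesz k (\<lambda>x'. g (x', y)) x)"

end

theory Submission
  imports Defs "HOL-Probability.Characteristic_Functions" "HOL-Probability.Sinc_Integral"
begin

text \<open>
  Write \<open>d = n - 1\<close>, let \<open>g \<xi> \<eta>\<close> be the Fourier transform of \<open>f\<close> in both variables and
  \<open>h \<xi> y\<close> the one in the first variable only. The transform in the first variable turns
  \<open>C f\<close> into \<open>g \<xi> (- \<bar>v\<bar> \<xi>)\<close>, and the Riesz potential multiplies this by \<open>\<bar>\<xi>\<bar> powr (d - k)\<close>. In the
  second cone transform \<open>v\<close> is replaced by the integration variable \<open>y\<close>; as \<open>g \<xi>\<close> is radial,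
  \<open>g \<xi> (- \<bar>y\<bar> \<xi>) = g \<xi> (\<bar>\<xi>\<bar> y)\<close>, so substituting \<open>\<eta> = \<bar>\<xi>\<bar> y\<close> in the \<open>y\<close>-integral absorbs
  \<open>\<bar>\<xi>\<bar> ^ d\<close>, and Fourier inversion in \<open>\<eta>\<close> yields
  \<open>(2 \<pi>) ^ d * \<bar>\<xi>\<bar> powr (- k) * h \<xi> v\<close>. The condition \<open>k < d\<close> makes all multipliers locally
  integrable. A Riesz potential of an inverse Fourier integral is computed by the multiplier, because
  the only test functions needed to identify a continuous tempered function are Gaussians.
  The radial version follows from polar coordinates.
\<close>

subsection \<open>Gaussian integrals\<close>

text \<open>\<open>riesz\<close> is a definite description over tempered functions, so the
  intermediate functions are reached only from the frequency side: each is an inverse Fourier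
  integral, with an integrable transform before and after the multiplier. High frequencies are
  harmless by Schwartz decay. Near 0 the critical weight is |\<xi>|^(-k), integrable there exactly
  when k < d. The same weight decides the interchange of integrals in the second cone transform: the
  L1 norm in \<open>y\<close> of its integrand is |\<xi>|^(-k) times the L1 norm of
  \<open>g \<xi>\<close>, since |\<xi>|^d is spent on the Jacobian. Gaussians enter because
  \<open>has_fourier\<close> shows a function only through pairings with transforms of Schwartz
  functions, and a modulated Gaussian has an explicit transform, a translated Gaussian. The constant
  (2 pi)^d comes from the inversion in \<eta> alone: there the forward integral carries no
  normalising factor, whereas the inversions in \<xi> are normalised.\<close>

lemma
  fixes f :: "'a::euclidean_space \<Rightarrow> real \<Rightarrow> 'b::{real_normed_field,banach,second_countable_topology}"
  assumes f: "\<And>b. b \<in> Basis \<Longrightarrow> integrable lborel (f b)"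
  shows integrable_lborel_prod: "integrable lborel (\<lambda>x::'a. \<Prod>b\<in>Basis. f b (x \<bullet> b))"
    and integral_lborel_prod: "(LINT x|lborel. (\<Prod>b\<in>Basis. f b (x \<bullet> b))) = (\<Prod>b\<in>Basis. (LINT t|lborel. f b t))"
proof -
  interpret product_sigma_finite "\<lambda>_::'a. lborel::real measure" by standard
  have [measurable]: "b \<in> Basis \<Longrightarrow> f b \<in> borel_measurable borel" for b
    using borel_measurable_integrable[OF f] by simp
  have eq: "(\<Prod>b\<in>Basis. f b ((\<Sum>c\<in>Basis. x c *\<^sub>R c) \<bullet> b)) = (\<Prod>b\<in>Basis. f b (x b))" for x :: "'a \<Rightarrow> real"
    by (intro prod.cong) (simp_all add: inner_sum_left inner_Basis if_distrib sum.delta cong: if_cong)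
  have m: "(\<lambda>x::'a \<Rightarrow> real. \<Sum>b\<in>Basis. x b *\<^sub>R b) \<in> measurable (\<Pi>\<^sub>M b\<in>Basis. lborel) borel"
    by measurable
  have m2: "(\<lambda>x::'a. \<Prod>b\<in>Basis. f b (x \<bullet> b)) \<in> borel_measurable borel"
    by measurable
  have i: "integrable (\<Pi>\<^sub>M b\<in>(Basis::'a set). lborel) (\<lambda>x. \<Prod>b\<in>Basis. f b (x b))"
    by (rule product_integrable_prod) (auto intro: f)
  show "integrable lborel (\<lambda>x::'a. \<Prod>b\<in>Basis. f b (x \<bullet> b))"
    by (subst lborel_eq, subst integrable_distr_eq[OF m m2]) (simp only: eq i)
  show "(LINT x|lborel. (\<Prod>b\<in>Basis. f b (x \<bullet> b))) = (\<Prod>b\<in>Basis. (LINT t|lborel. f b t))"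
    by (subst lborel_eq, subst integral_distr[OF m m2], simp only: eq)
       (rule product_integral_prod, auto intro: f)
qed

text \<open>Comparison with a product of one-dimensional integrands 1 / (1 + t^2). Each of the d
  factors 1 + (x . b)^2 is at most (1 + |x|)^2, which is where the exponent 2d comes from.\<close>

lemma integrable_inverse_power_norm:
  assumes m: "2 * DIM('a::euclidean_space) \<le> m"
  shows "integrable lborel (\<lambda>x::'a. 1 / (1 + norm x) ^ m)"
proof (rule Bochner_Integration.integrable_bound)
  have "integrable lborel (\<lambda>t::real. 1 / (1 + t\<^sup>2))"
    using integrable_inverse_1_plus_square
    by (simp add: set_integrable_def inverse_eq_divide)
  then show "integrable lborel (\<lambda>x::'a. \<Prod>b\<in>Basis. (\<lambda>t. 1 / (1 + t\<^sup>2)) (x \<bullet> b))"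
    by (intro integrable_lborel_prod)
  show "AE x::'a in lborel. norm (1 / (1 + norm x) ^ m) \<le> norm (\<Prod>b\<in>Basis. 1 / (1 + (x \<bullet> b)\<^sup>2))"
  proof (rule AE_I2)
    fix x :: 'a
    have "(\<Prod>b\<in>(Basis::'a set). 1 + (x \<bullet> b)\<^sup>2) \<le> (\<Prod>b\<in>(Basis::'a set). (1 + norm x)\<^sup>2)"
    proof (rule prod_mono)
      fix b :: 'a assume b: "b \<in> Basis"
      have "(x \<bullet> b)\<^sup>2 \<le> (norm x)\<^sup>2"
        using Basis_le_norm[OF b, of x] by (metis abs_ge_zero power2_abs power_mono)
      then show "0 \<le> 1 + (x \<bullet> b)\<^sup>2 \<and> 1 + (x \<bullet> b)\<^sup>2 \<le> (1 + norm x)\<^sup>2"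
        by (simp add: power2_sum add_increasing2)
    qed
    also have "\<dots> = (1 + norm x) ^ (2 * DIM('a))"
      by (simp add: power_mult)
    also have "\<dots> \<le> (1 + norm x) ^ m"
      by (rule power_increasing[OF m]) simp
    finally have "(\<Prod>b\<in>(Basis::'a set). 1 + (x \<bullet> b)\<^sup>2) \<le> (1 + norm x) ^ m" .
    moreover have "0 < (\<Prod>b\<in>(Basis::'a set). 1 + (x \<bullet> b)\<^sup>2)"
      by (intro prod_pos) (simp add: add_pos_nonneg)
    ultimately show "norm (1 / (1 + norm x) ^ m) \<le> norm (\<Prod>b\<in>Basis. 1 / (1 + (x \<bullet> b)\<^sup>2))"
      by (simp add: prod_dividef abs_of_pos frac_le)
  qed
qed measurable

lemma continuous_on_parametric_integral:
  fixes K :: "'p::metric_space \<Rightarrow> 'a \<Rightarrow> 'b::{banach,second_countable_topology}"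
  assumes "\<And>x. continuous_on UNIV (\<lambda>p. K p x)" and [measurable]: "\<And>p. K p \<in> borel_measurable M"
    and "integrable M B" and "\<And>p x. norm (K p x) \<le> B x"
  shows "continuous_on UNIV (\<lambda>p. LINT x|M. K p x)"
proof (clarsimp simp: continuous_on_sequentially comp_def)
  fix a and p :: "nat \<Rightarrow> 'p" assume p: "p \<longlonglongrightarrow> a"
  have "(\<lambda>n. K (p n) x) \<longlonglongrightarrow> K a x" for x
    using assms(1)[of x] p by (auto simp: continuous_on_sequentially comp_def)
  then show "(\<lambda>n. LINT x|M. K (p n) x) \<longlonglongrightarrow> (LINT x|M. K a x)"
    by (intro integral_dominated_convergence[where w=B]) (auto intro: assms)
qed

lemma norm_exp_ii [simp]: "norm (exp (- (\<i> * complex_of_real t))) = 1" "norm (exp (\<i> * complex_of_real t)) = 1"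
  by (simp_all add: norm_exp_eq_Re)

section \<open>Elementary properties of the Fourier integral\<close>

lemma integrable_fourier:
  assumes "integrable lborel \<phi>"
  shows "integrable lborel (\<lambda>x. exp (- \<i> * of_real (x \<bullet> \<xi>)) * \<phi> x)"
proof (rule Bochner_Integration.integrable_bound[OF assms])
  show "(\<lambda>x. exp (- \<i> * of_real (x \<bullet> \<xi>)) * \<phi> x) \<in> borel_measurable lborel"
    using assms by measurable
qed (simp add: norm_mult)

lemma norm_fourier_le: "norm (fourier \<phi> \<xi>) \<le> (LINT x|lborel. norm (\<phi> x))"
  unfolding fourier_def by (rule order.trans[OF integral_norm_bound]) (simp add: norm_mult)

lemma continuous_fourier:
  assumes "integrable lborel \<phi>"
  shows "continuous_on UNIV (fourier \<phi>)"
  unfolding fourier_def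
proof (rule continuous_on_parametric_integral[where B="\<lambda>x. norm (\<phi> x)"])
  show "(\<lambda>x. exp (- \<i> * of_real (x \<bullet> p)) * \<phi> x) \<in> borel_measurable lborel" for p
    using assms by measurable
qed (auto intro!: continuous_intros assms simp: norm_mult)

lemma fourier_cmult: "fourier (\<lambda>x. c * \<phi> x) \<xi> = c * fourier \<phi> \<xi>"
  unfolding fourier_def by (simp add: mult.left_commute)

lemma fourier_cong_AE:
  assumes "AE x in lborel. \<phi> x = \<psi> x" "\<phi> \<in> borel_measurable borel" "\<psi> \<in> borel_measurable borel"
  shows "fourier \<phi> = fourier \<psi>"
  unfolding fourier_def using assms
  by (intro ext integral_cong_AE) auto

text \<open>This is the characteristic function of the standard normal law after the substitution x
  = c t with c = sqrt (2 s), for which x^2 / 2 = s t^2. The frequency -w / c compensates for the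
  scaling and for the sign convention of \<open>fourier\<close>.\<close>

lemma
  fixes s w :: real
  assumes s: "s > 0"
  shows integrable_gaussian_1d:
      "integrable lborel (\<lambda>t::real. exp (- \<i> * of_real (t * w)) * complex_of_real (exp (- s * t\<^sup>2)))" (is "integrable _ ?g")
    and fourier_gaussian_1d:
      "(LINT t|lborel. exp (- \<i> * of_real (t * w)) * complex_of_real (exp (- s * t\<^sup>2))) =
       of_real (sqrt (pi / s) * exp (- w\<^sup>2 / (4 * s)))"
proof -
  let ?c = "sqrt (2 * s)"
  have c: "?c \<noteq> 0" "?c > 0" using s by auto
  define t where "t = - w / ?c"
  let ?f = "\<lambda>x. complex_of_real (std_normal_density x) * iexp (t * x)"
  have i: "integrable lborel ?f"
    by (rule Bochner_Integration.integrable_bound[OF integrable_normal_density[where \<mu>=0 and \<sigma>=1]])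
       (auto simp: norm_mult)
  have int: "(LINT x|lborel. ?f x) = of_real (exp (- t\<^sup>2 / 2))"
  proof -
    have "char std_normal_distribution t = (LINT x|lborel. std_normal_density x *\<^sub>R iexp (t * x))"
      unfolding char_def by (subst integral_density) (auto simp: normal_density_nonneg)
    then show ?thesis by (simp add: char_std_normal_distribution scaleR_conv_of_real)
  qed
  have eq: "?f (0 + ?c * x) = of_real (1 / sqrt (2 * pi)) * ?g x" for x
  proof -
    have "t * (?c * x) = - (x * w)" using c by (simp add: t_def field_simps)
    moreover have "(?c * x)\<^sup>2 / 2 = s * x\<^sup>2" using s by (simp add: power_mult_distrib)
    ultimately show ?thesis
      by (simp add: std_normal_density_def mult.commute)
  qed
  have "integrable lborel (\<lambda>x. of_real (1 / sqrt (2 * pi)) * ?g x)"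
    using lborel_integrable_real_affine[OF i c(1), of 0] unfolding eq .
  then have "integrable lborel (\<lambda>x. of_real (sqrt (2 * pi)) * (of_real (1 / sqrt (2 * pi)) * ?g x))"
    by (rule integrable_mult_right)
  then show "integrable lborel ?g" by (simp add: field_simps)
  have t2: "t\<^sup>2 / 2 = w\<^sup>2 / (4 * s)" using s by (simp add: t_def power_divide)
  have "of_real (exp (- t\<^sup>2 / 2)) = \<bar>?c\<bar> *\<^sub>R (LINT x|lborel. ?f (0 + ?c * x))"
    using lborel_integral_real_affine[OF c(1), of ?f 0] int by simp
  also have "\<dots> = of_real (?c / sqrt (2 * pi)) * (LINT x|lborel. ?g x)"
    unfolding eq using c by (simp add: scaleR_conv_of_real)
  finally have "(LINT x|lborel. ?g x) = of_real (sqrt (2 * pi) / ?c * exp (- t\<^sup>2 / 2))"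
    using c by (simp add: field_simps)
  also have "sqrt (2 * pi) / ?c = sqrt (pi / s)" using s by (simp add: real_sqrt_divide real_sqrt_mult)
  finally show "(LINT x|lborel. ?g x) = of_real (sqrt (pi / s) * exp (- w\<^sup>2 / (4 * s)))"
    using t2 by simp
qed

lemma norm_power2_sum_Basis: "(norm (x::'a::euclidean_space))\<^sup>2 = (\<Sum>b\<in>Basis. (x \<bullet> b)\<^sup>2)"
  by (subst power2_norm_eq_inner, subst euclidean_inner) (simp add: power2_eq_square)

lemma
  fixes \<xi> :: "'a::euclidean_space"
  assumes s: "s > 0"
  shows integrable_gaussian: "integrable lborel (\<lambda>x::'a. exp (- s * (norm x)\<^sup>2))" (is ?I)
    and fourier_gaussian: "fourier (\<lambda>x. complex_of_real (exp (- s * (norm x)\<^sup>2))) \<xi> =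
      of_real (sqrt (pi / s) ^ DIM('a) * exp (- (norm \<xi>)\<^sup>2 / (4 * s)))"
proof -
  have eq: "exp (- \<i> * of_real (x \<bullet> \<xi>)) * complex_of_real (exp (- s * (norm x)\<^sup>2)) =
    (\<Prod>b\<in>Basis. exp (- \<i> * of_real ((x \<bullet> b) * (\<xi> \<bullet> b))) * complex_of_real (exp (- s * (x \<bullet> b)\<^sup>2)))" for x \<xi> :: 'a
    unfolding prod.distrib of_real_prod[symmetric]
    by (subst (1 2) exp_sum[symmetric])
       (auto simp: norm_power2_sum_Basis euclidean_inner[of x \<xi>] sum_distrib_left sum_negf)
  \<comment> \<open>At frequency 0 the exponential is 1, so the complex product formula also yields
    the real Gaussian as a real part.\<close>
  have "integrable lborel (\<lambda>x::'a. exp (- \<i> * of_real (x \<bullet> 0)) * complex_of_real (exp (- s * (norm x)\<^sup>2)))"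
    unfolding eq by (rule integrable_lborel_prod) (rule integrable_gaussian_1d[OF s])
  then have "integrable lborel (\<lambda>x::'a. Re (exp (- \<i> * of_real (x \<bullet> 0)) * complex_of_real (exp (- s * (norm x)\<^sup>2))))"
    by (rule integrable_Re)
  then show ?I by simp
  have "fourier (\<lambda>x::'a. complex_of_real (exp (- s * (norm x)\<^sup>2))) \<xi> =
     (\<Prod>b\<in>(Basis::'a set). of_real (sqrt (pi / s) * exp (- (\<xi> \<bullet> b)\<^sup>2 / (4 * s))))"
    unfolding fourier_def eq
    by (subst integral_lborel_prod) (simp_all only: integrable_gaussian_1d[OF s] fourier_gaussian_1d[OF s])
  also have "\<dots> = of_real (sqrt (pi / s) ^ DIM('a) * exp (- (norm \<xi>)\<^sup>2 / (4 * s)))"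
    by (simp add: prod.distrib exp_sum[symmetric] norm_power2_sum_Basis sum_divide_distrib sum_negf flip: of_real_prod)
  finally show "fourier (\<lambda>x. complex_of_real (exp (- s * (norm x)\<^sup>2))) \<xi> =
      of_real (sqrt (pi / s) ^ DIM('a) * exp (- (norm \<xi>)\<^sup>2 / (4 * s)))" .
qed

subsection \<open>Fourier inversion and uniqueness\<close>

lemma nn_integral_lborel_affine:
  fixes g :: "'a::euclidean_space \<Rightarrow> ennreal"
  assumes [measurable]: "g \<in> borel_measurable borel" and c: "c \<noteq> 0"
  shows "(\<integral>\<^sup>+x. g x \<partial>lborel) = ennreal (\<bar>c\<bar> ^ DIM('a)) * (\<integral>\<^sup>+x. g (t + c *\<^sub>R x) \<partial>lborel)"
  by (subst lborel_affine[OF c, of t]) (simp add: nn_integral_density nn_integral_distr nn_integral_cmult)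

lemma integrable_lborel_affine:
  fixes g :: "'a::euclidean_space \<Rightarrow> 'b::{banach,second_countable_topology}"
  assumes g: "integrable lborel g" and c: "c \<noteq> 0"
  shows "integrable lborel (\<lambda>x. g (t + c *\<^sub>R x))"
proof -
  have [measurable]: "g \<in> borel_measurable borel" using g by auto
  have "ennreal (\<bar>c\<bar> ^ DIM('a)) * (\<integral>\<^sup>+x. norm (g (t + c *\<^sub>R x)) \<partial>lborel) < \<infinity>"
    using g c by (subst nn_integral_lborel_affine[symmetric]) (auto simp: integrable_iff_bounded)
  then show ?thesis using c by (auto simp: integrable_iff_bounded ennreal_mult_less_top)
qed

lemma integral_lborel_affine:
  fixes g :: "'a::euclidean_space \<Rightarrow> 'b::{banach,second_countable_topology}"
  assumes g: "integrable lborel g" and c: "c \<noteq> 0"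
  shows "(LINT x|lborel. g x) = \<bar>c\<bar> ^ DIM('a) *\<^sub>R (LINT x|lborel. g (t + c *\<^sub>R x))"
proof -
  have [measurable]: "g \<in> borel_measurable borel" using g by auto
  show ?thesis by (subst lborel_affine[OF c, of t]) (simp add: integral_density integral_distr)
qed

text \<open>The form in which Fubini's hypothesis is checked whenever the kernel is an oscillating
  factor times something dominated by a product.\<close>

lemma integrable_tensor:
  fixes f :: "'a::euclidean_space \<Rightarrow> complex" and g :: "'b::euclidean_space \<Rightarrow> complex"
  assumes f: "integrable lborel f" and g: "integrable lborel g"
    and [measurable]: "k \<in> borel_measurable (borel \<Otimes>\<^sub>M borel)"
    and le: "\<And>x y. norm (k (x, y)) \<le> norm (f x) * norm (g y)"
  shows "integrable (lborel \<Otimes>\<^sub>M lborel) (k :: 'a \<times> 'b \<Rightarrow> complex)"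
proof -
  have [measurable]: "f \<in> borel_measurable borel" "g \<in> borel_measurable borel" using f g by auto
  have "integrable (lborel \<Otimes>\<^sub>M lborel) (\<lambda>p. f (fst p) * g (snd p))"
  proof (rule lborel_pair.Fubini_integrable)
    show "(\<lambda>p. f (fst p) * g (snd p)) \<in> borel_measurable (lborel \<Otimes>\<^sub>M lborel)"
      by measurable
  qed (use f g in \<open>auto simp: norm_mult\<close>)
  then show ?thesis
  proof (rule Bochner_Integration.integrable_bound)
    show "k \<in> borel_measurable (lborel \<Otimes>\<^sub>M lborel)" by measurable
  qed (use le in \<open>auto simp: norm_mult\<close>)
qed

lemma fourier_multiplication:
  fixes f g :: "'a::euclidean_space \<Rightarrow> complex"
  assumes f: "integrable lborel f" and g: "integrable lborel g"
  shows "(LINT x|lborel. fourier f x * g x) = (LINT x|lborel. f x * fourier g x)"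
proof -
  have [measurable]: "f \<in> borel_measurable borel" "g \<in> borel_measurable borel" using f g by auto
  have int: "integrable (lborel \<Otimes>\<^sub>M lborel) (\<lambda>(y, x). f y * exp (- \<i> * of_real (y \<bullet> x)) * g x)"
    by (rule integrable_tensor[OF f g], measurable) (simp add: norm_mult)
  have "(LINT x|lborel. fourier f x * g x) = (LINT x|lborel. LINT y|lborel. f y * exp (- \<i> * of_real (y \<bullet> x)) * g x)"
    unfolding fourier_def
    by (simp flip: integral_mult_left_zero) (simp add: mult_ac)
  also have "\<dots> = (LINT y|lborel. LINT x|lborel. f y * exp (- \<i> * of_real (y \<bullet> x)) * g x)"
    by (rule lborel_pair.Fubini_integral[OF int])
  also have "\<dots> = (LINT x|lborel. f x * fourier g x)"
    unfolding fourier_def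
    by (simp flip: integral_mult_right_zero) (simp add: inner_commute mult_ac)
  finally show ?thesis .
qed

text \<open>Written through \<open>fourier\<close> at the reflected point, so that continuity and
  boundedness carry over from the forward transform.\<close>

definition inverse_fourier :: "('a::euclidean_space \<Rightarrow> complex) \<Rightarrow> 'a \<Rightarrow> complex" where
  "inverse_fourier \<gamma> x = fourier \<gamma> (- x) / of_real ((2 * pi) ^ DIM('a))"

lemma inverse_fourier_eq:
  "inverse_fourier \<gamma> (x::'a::euclidean_space) =
    (LINT \<xi>|lborel. exp (\<i> * of_real (x \<bullet> \<xi>)) * \<gamma> \<xi>) / of_real ((2 * pi) ^ DIM('a))"
  by (simp add: inverse_fourier_def fourier_def inner_commute)

lemma integral_gaussian:
  "(LINT x|lborel. exp (- (norm (x::'a::euclidean_space))\<^sup>2)) = sqrt pi ^ DIM('a)"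
proof -
  have "complex_of_real (LINT x|lborel. exp (- (norm (x::'a))\<^sup>2)) = of_real (sqrt pi ^ DIM('a))"
    using fourier_gaussian[of 1 "0::'a"] by (simp add: fourier_def flip: integral_complex_of_real)
  then show ?thesis by (simp only: of_real_eq_iff)
qed

text \<open>The explicit transform pair on which the rest depends: it supplies the approximate
  identity in the inversion theorem and the test functions in the uniqueness theorem.\<close>

lemma fourier_modulated_gaussian:
  fixes x a :: "'a::euclidean_space"
  assumes "s > 0"
  shows "fourier (\<lambda>\<xi>. exp (\<i> * of_real (a \<bullet> \<xi>)) * complex_of_real (exp (- s * (norm \<xi>)\<^sup>2))) x =
    of_real (sqrt (pi / s) ^ DIM('a) * exp (- (norm (x - a))\<^sup>2 / (4 * s)))"
  using fourier_gaussian[OF assms, of "x - a"] unfolding fourier_def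
  by (simp add: mult.assoc[symmetric] exp_add[symmetric] inner_diff_right inner_commute algebra_simps)

text \<open>The inversion integral is regularised by a Gaussian factor. The multiplication formula
  moves the transform from \<open>g\<close> to the modulated Gaussian, whose transform is an
  approximate identity at \<open>x\<close> of width \<delta>. Letting \<delta> tend to 0, dominated
  convergence applies on the frequency side because \<open>fourier g\<close> is integrable and on
  the space side because \<open>g\<close> is bounded and continuous.\<close>

lemma fourier_inversion:
  fixes g :: "'a::euclidean_space \<Rightarrow> complex"
  assumes g: "integrable lborel g" and cont: "continuous_on UNIV g" and bdd: "\<And>x. norm (g x) \<le> C"
    and gh: "integrable lborel (fourier g)"
  shows "inverse_fourier (fourier g) = g"
proof
  fix x :: 'a
  have [measurable]: "g \<in> borel_measurable borel" "fourier g \<in> borel_measurable borel" using g gh by auto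
  define \<delta> where "\<delta> n = inverse (real (Suc n))" for n
  have \<delta>: "\<delta> n > 0" for n by (simp add: \<delta>_def)
  have \<delta>0: "\<delta> \<longlonglongrightarrow> 0" unfolding \<delta>_def by (rule LIMSEQ_inverse_real_of_nat)
  let ?L = "\<lambda>n. LINT \<xi>|lborel. fourier g \<xi> * (exp (\<i> * of_real (x \<bullet> \<xi>)) * complex_of_real (exp (- ((\<delta> n)\<^sup>2 / 4) * (norm \<xi>)\<^sup>2)))"
  let ?R = "\<lambda>n. LINT z|lborel. g (x + \<delta> n *\<^sub>R z) * complex_of_real (exp (- (norm z)\<^sup>2))"
  have eq: "?L n = of_real ((2 * sqrt pi) ^ DIM('a)) * ?R n" for n
  proof -
    \<comment> \<open>With s = \<delta>^2 / 4 the transformed Gaussian decays at rate 1 / (4 s) = 1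
      / \<delta>^2, so y = x + \<delta> z turns it into exp (-|z|^2).\<close>
    let ?s = "(\<delta> n)\<^sup>2 / 4"
    have s: "?s > 0" using \<delta>[of n] by simp
    have i: "integrable lborel (\<lambda>\<xi>::'a. exp (\<i> * of_real (x \<bullet> \<xi>)) * complex_of_real (exp (- ?s * (norm \<xi>)\<^sup>2)))"
      by (rule Bochner_Integration.integrable_bound[OF integrable_gaussian[OF s]]) (auto simp: norm_mult)
    let ?G = "\<lambda>y. g y * of_real (sqrt (pi / ?s) ^ DIM('a) * exp (- (norm (y - x))\<^sup>2 / (4 * ?s)))"
    have iG: "integrable lborel ?G"
      by (rule Bochner_Integration.integrable_bound[OF integrable_mult_right[OF g, of "of_real (sqrt (pi / ?s) ^ DIM('a))"]])
         (use s in \<open>auto simp: norm_mult norm_power mult.left_commute[of "norm (g _)"] intro!: mult_left_mono mult_left_le\<close>)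
    have "?L n = (LINT y|lborel. ?G y)"
      by (subst fourier_multiplication[OF g i]) (simp only: fourier_modulated_gaussian[OF s])
    also have "\<dots> = \<bar>\<delta> n\<bar> ^ DIM('a) *\<^sub>R (LINT z|lborel. ?G (x + \<delta> n *\<^sub>R z))"
      using \<delta>[of n] by (intro integral_lborel_affine iG) auto
    also have "(\<lambda>z. ?G (x + \<delta> n *\<^sub>R z)) = (\<lambda>z. of_real (sqrt (pi / ?s) ^ DIM('a)) * (g (x + \<delta> n *\<^sub>R z) * complex_of_real (exp (- (norm z)\<^sup>2))))"
      using \<delta>[of n] by (auto simp: power_mult_distrib mult_ac)
    also have "\<bar>\<delta> n\<bar> ^ DIM('a) *\<^sub>R (LINT z|lborel. of_real (sqrt (pi / ?s) ^ DIM('a)) * (g (x + \<delta> n *\<^sub>R z) * complex_of_real (exp (- (norm z)\<^sup>2))))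
       = of_real ((\<bar>\<delta> n\<bar> * sqrt (pi / ?s)) ^ DIM('a)) * ?R n"
      by (simp add: scaleR_conv_of_real power_mult_distrib)
    \<comment> \<open>Per dimension the Jacobian \<delta> and the amplitude sqrt (pi / s) leave 2
      sqrt pi; the Gaussian integral contributes another sqrt pi, giving the 2 pi of the inversion
      formula.\<close>
    also have "\<bar>\<delta> n\<bar> * sqrt (pi / ?s) = 2 * sqrt pi"
      using \<delta>[of n] by (simp add: real_sqrt_divide real_sqrt_mult)
    finally show ?thesis .
  qed
  have c\<delta>: "(\<lambda>n. g (x + \<delta> n *\<^sub>R z)) \<longlonglongrightarrow> g x" for z
  proof -
    have "(\<lambda>n. x + \<delta> n *\<^sub>R z) \<longlonglongrightarrow> x + 0 *\<^sub>R z"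
      by (intro tendsto_intros \<delta>0)
    then show ?thesis using cont by (auto simp: continuous_on_sequentially comp_def)
  qed
  have "?R \<longlonglongrightarrow> (LINT z|lborel. g x * complex_of_real (exp (- (norm (z::'a))\<^sup>2)))"
  proof (rule integral_dominated_convergence)
    show "integrable lborel (\<lambda>z::'a. C * exp (- (norm z)\<^sup>2))"
      using integrable_gaussian[where 'a='a, of 1] by simp
    show "AE z in lborel. (\<lambda>n. g (x + \<delta> n *\<^sub>R z) * complex_of_real (exp (- (norm z)\<^sup>2))) \<longlonglongrightarrow> g x * complex_of_real (exp (- (norm z)\<^sup>2))"
      by (auto intro!: tendsto_intros c\<delta>)
  qed (use bdd in \<open>auto simp: norm_mult\<close>)
  then have R: "?R \<longlonglongrightarrow> g x * of_real (sqrt pi ^ DIM('a))"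
    by (simp add: integral_gaussian)
  have "?L \<longlonglongrightarrow> (LINT \<xi>|lborel. fourier g \<xi> * (exp (\<i> * of_real (x \<bullet> \<xi>)) * complex_of_real (exp (- ((0::real)\<^sup>2 / 4) * (norm \<xi>)\<^sup>2))))"
  proof (rule integral_dominated_convergence)
    show "integrable lborel (\<lambda>x. norm (fourier g x))" using gh by auto
    show "AE \<xi> in lborel. (\<lambda>n. fourier g \<xi> * (exp (\<i> * of_real (x \<bullet> \<xi>)) * complex_of_real (exp (- ((\<delta> n)\<^sup>2 / 4) * (norm \<xi>)\<^sup>2))))
       \<longlonglongrightarrow> fourier g \<xi> * (exp (\<i> * of_real (x \<bullet> \<xi>)) * complex_of_real (exp (- ((0::real)\<^sup>2 / 4) * (norm \<xi>)\<^sup>2)))"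
      by (intro AE_I2 tendsto_intros \<delta>0) simp
  qed (auto simp: norm_mult mult_left_le)
  moreover have "?L \<longlonglongrightarrow> of_real ((2 * sqrt pi) ^ DIM('a)) * (g x * of_real (sqrt pi ^ DIM('a)))"
    unfolding eq by (intro tendsto_intros R)
  ultimately have "(LINT \<xi>|lborel. exp (\<i> * of_real (x \<bullet> \<xi>)) * fourier g \<xi>) = of_real ((2 * sqrt pi) ^ DIM('a)) * (g x * of_real (sqrt pi ^ DIM('a)))"
    by (auto dest: LIMSEQ_unique simp: mult_ac)
  also have "\<dots> = g x * of_real ((2 * pi) ^ DIM('a))"
  proof -
    have "(2 * sqrt pi) ^ DIM('a) * sqrt pi ^ DIM('a) = (2 * pi) ^ DIM('a)"
      unfolding power_mult_distrib[symmetric] by (simp add: mult.assoc)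
    then show ?thesis by (metis (no_types, opaque_lifting) mult.assoc mult.commute of_real_mult)
  qed
  finally show "inverse_fourier (fourier g) x = g x"
    by (simp add: inverse_fourier_eq)
qed

text \<open>Boxes are an intersection-stable generator of the Borel sets, so vanishing integrals
  propagate to every Borel set. The whole space is not a box; its integral is what the complement
  step consumes.\<close>

lemma AE_zero_if_box_integrals_zero:
  fixes W :: "'a::euclidean_space \<Rightarrow> real"
  assumes W: "integrable lborel W"
    and box: "\<And>l u. (LINT x:box l u|lborel. W x) = 0" and univ: "(LINT x|lborel. W x) = 0"
  shows "AE x in lborel. W x = 0"
proof (rule density_unique_real)
  show "integrable lborel W" by fact
  show "integrable lborel (\<lambda>_::'a. 0::real)" by simp
  fix A :: "'a set" assume "A \<in> sets lborel"
  then have A: "A \<in> sigma_sets UNIV (range (\<lambda>(a, b). box a b))"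
    by (simp add: borel_eq_box)
  have si: "set_integrable lborel B W" if "B \<in> sets borel" for B
    using integrable_mult_indicator[OF _ W, of B] that by (simp add: set_integrable_def)
  have meas: "B \<in> sigma_sets UNIV (range (\<lambda>(a, b). box a b)) \<Longrightarrow> B \<in> sets borel" for B :: "'a set"
    by (simp add: borel_eq_box)
  have "Int_stable (range (\<lambda>(a::'a, b). box a b))"
    by (auto simp: Int_stable_def box_Int_box)
  moreover have "range (\<lambda>(a::'a, b). box a b) \<subseteq> Pow UNIV" by simp
  ultimately have "(LINT x:A|lborel. W x) = 0" using A
  proof (induction rule: sigma_sets_induct_disjoint)
    case (basic A)
    then show ?case using box by auto
  next
    case empty
    show ?case by (simp add: set_lebesgue_integral_def)
  next
    case (compl A)
    have "(LINT x:A \<union> (UNIV - A)|lborel. W x) = (LINT x:A|lborel. W x) + (LINT x:UNIV - A|lborel. W x)"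
      using meas[OF compl(1)] by (intro set_integral_Un si) auto
    then show ?case using compl univ by (simp add: set_lebesgue_integral_def)
  next
    case (union A)
    then have "(LINT x:(\<Union>i. A i)|lborel. W x) = (\<Sum>i. (LINT x:(A i)|lborel. W x))"
      using meas by (intro lebesgue_integral_countable_add si)
        (auto simp: disjoint_family_on_def image_subset_iff)
    then show ?case using union by simp
  qed
  then show "(LINT x:A|lborel. W x) = (LINT x:A|lborel. 0)" by simp
qed

text \<open>Averaging the translates \<open>\<lambda>x. exp (- t * (norm (x - a))\<^sup>2)\<close> over \<open>a \<in> B\<close> approximates the indicator of \<open>B\<close>.\<close>

lemma gaussians_separate:
  fixes w :: "'a::euclidean_space \<Rightarrow> complex"
  assumes int: "\<And>s a. s > 0 \<Longrightarrow> integrable lborel (\<lambda>x. w x * of_real (exp (- s * (norm (x - a))\<^sup>2)))"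
    and zero: "\<And>s a. s > 0 \<Longrightarrow> (LINT x|lborel. w x * of_real (exp (- s * (norm (x - a))\<^sup>2))) = 0"
  shows "AE x in lborel. w x = 0"
proof -
  \<comment> \<open>\<open>w\<close> itself may fail to be integrable. Multiplying by one fixed
    Gaussian makes it so and changes the zero set in no way.\<close>
  define W where "W x = w x * of_real (exp (- 1 * (norm (x - 0))\<^sup>2))" for x
  have W: "integrable lborel W" unfolding W_def by (rule int) simp
  then have [measurable]: "W \<in> borel_measurable borel" by auto
  have Wzero: "(LINT x|lborel. W x * of_real (exp (- t * (norm (x - a))\<^sup>2))) = 0" if t: "t > 0" for t a
  proof -
    \<comment> \<open>Completing the square: the product of Gaussians of rate 1 at 0 and rate t at
      \<open>a\<close> is a constant times the Gaussian of rate 1 + t centred at the weighted mean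
      \<open>q *\<^sub>R a\<close>. Hence tests of \<open>W\<close> are again tests of
      \<open>w\<close>.\<close>
    define q where "q = t / (1 + t)"
    have q: "(1 + t) * q = t" using t by (simp add: q_def)
    have eq: "W x * of_real (exp (- t * (norm (x - a))\<^sup>2)) =
       of_real (exp (t * q * (norm a)\<^sup>2 - t * (norm a)\<^sup>2)) * (w x * of_real (exp (- (1 + t) * (norm (x - q *\<^sub>R a))\<^sup>2)))" for x
    proof -
      have "(1 + t) * (X - 2 * q * Y + q * q * A) = (1 + t) * X - 2 * ((1 + t) * q) * Y + ((1 + t) * q) * q * A" for X Y A
        by (simp add: algebra_simps)
      from this[of "x \<bullet> x" "a \<bullet> x" "a \<bullet> a", unfolded q]
      have "- 1 * (norm (x - 0))\<^sup>2 + - t * (norm (x - a))\<^sup>2 =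
        (t * q * (norm a)\<^sup>2 - t * (norm a)\<^sup>2) + - (1 + t) * (norm (x - q *\<^sub>R a))\<^sup>2"
        by (simp add: power2_norm_eq_inner inner_diff_left inner_diff_right inner_commute algebra_simps)
      then have "exp (- 1 * (norm (x - 0))\<^sup>2) * exp (- t * (norm (x - a))\<^sup>2) =
        exp (t * q * (norm a)\<^sup>2 - t * (norm a)\<^sup>2) * exp (- (1 + t) * (norm (x - q *\<^sub>R a))\<^sup>2)"
        by (simp only: exp_add[symmetric])
      then show ?thesis unfolding W_def
        by (metis (no_types, opaque_lifting) mult.assoc mult.commute of_real_mult)
    qed
    show ?thesis unfolding eq using zero[of "1 + t"] t by simp
  qed
  \<comment> \<open>Only sets with null boundary are treated: the smoothed indicator
    \<open>J n\<close> converges to a multiple of the indicator at interior and exterior points of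
    \<open>B\<close>.\<close>
  have main: "(LINT x|lborel. indicator B x *\<^sub>R W x) = 0"
    if B[measurable]: "B \<in> sets borel" and N: "AE x in lborel. x \<in> interior B \<or> x \<in> interior (- B)" for B
  proof -
    define \<delta> where "\<delta> n = inverse (real (Suc n))" for n
    have \<delta>: "\<delta> n > 0" for n by (simp add: \<delta>_def)
    have \<delta>0: "\<delta> \<longlonglongrightarrow> 0" unfolding \<delta>_def by (rule LIMSEQ_inverse_real_of_nat)
    define J where "J n x = (LINT z|lborel. indicator B (x + \<delta> n *\<^sub>R z) * exp (- (norm (z::'a))\<^sup>2))" for n x
    have g1: "integrable lborel (\<lambda>z::'a. exp (- (norm z)\<^sup>2))" using integrable_gaussian[where 'a='a, of 1] by simp
    have J_bound: "norm (J n x) \<le> (LINT z|lborel. exp (- (norm (z::'a))\<^sup>2))" for n x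
      unfolding J_def
      by (rule Bochner_Integration.integral_norm_bound_integral[OF Bochner_Integration.integrable_bound[OF g1] g1])
        (auto simp: indicator_def)
    have [measurable]: "J n \<in> borel_measurable borel" for n
      unfolding J_def by measurable
    have Jlim: "(\<lambda>n. J n x) \<longlonglongrightarrow> (LINT z|lborel. indicator B x * exp (- (norm (z::'a))\<^sup>2))"
      if x: "x \<in> interior B \<or> x \<in> interior (- B)" for x
      unfolding J_def
    proof (rule integral_dominated_convergence[where w="\<lambda>z. exp (- (norm z)\<^sup>2)"])
      show "AE z in lborel. (\<lambda>n. indicator B (x + \<delta> n *\<^sub>R z) * exp (- (norm z)\<^sup>2)) \<longlonglongrightarrow> indicator B x * exp (- (norm (z::'a))\<^sup>2)"
      proof (rule AE_I2, rule tendsto_mult, rule tendsto_eventually)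
        fix z :: 'a
        have l: "(\<lambda>n. x + \<delta> n *\<^sub>R z) \<longlonglongrightarrow> x + 0 *\<^sub>R z"
          by (intro tendsto_intros \<delta>0)
        show "\<forall>\<^sub>F n in sequentially. indicator B (x + \<delta> n *\<^sub>R z) = (indicator B x :: real)"
          using x
        proof
          assume x: "x \<in> interior B"
          then have "\<forall>\<^sub>F n in sequentially. x + \<delta> n *\<^sub>R z \<in> interior B"
            using topological_tendstoD[OF l, of "interior B"] by auto
          then show ?thesis by eventually_elim (use x interior_subset in \<open>auto simp: indicator_def\<close>)
        next
          assume x: "x \<in> interior (- B)"
          then have "\<forall>\<^sub>F n in sequentially. x + \<delta> n *\<^sub>R z \<in> interior (- B)"
            using topological_tendstoD[OF l, of "interior (- B)"] by auto
          then show ?thesis by eventually_elim (use x interior_subset[of "- B"] in \<open>auto simp: indicator_def\<close>)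
        qed
      qed simp
    qed (auto simp: g1 indicator_def)
    have zeroJ: "(LINT x|lborel. W x * of_real (J n x)) = 0" for n
    proof -
      have int2: "integrable (lborel \<Otimes>\<^sub>M lborel) (\<lambda>(x, z). W x * of_real (indicator B (x + \<delta> n *\<^sub>R z) * exp (- (norm (z::'a))\<^sup>2)))"
        by (rule integrable_tensor[OF W integrable_of_real[OF g1]], measurable) (auto simp: norm_mult indicator_def)
      \<comment> \<open>With a = x + \<delta> z, the smoothing becomes a superposition of Gaussians
        translated by the points of \<open>B\<close>, each of which annihilates
        \<open>W\<close>.\<close>
      have aff: "\<bar>\<delta> n\<bar> ^ DIM('a) *\<^sub>R J n x = (LINT a|lborel. indicator B a * exp (- (1 / (\<delta> n)\<^sup>2) * (norm (x - a))\<^sup>2))" for x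
      proof -
        have i: "integrable lborel (\<lambda>a. exp (- (1 / (\<delta> n)\<^sup>2) * (norm (x - a))\<^sup>2))"
          using integrable_lborel_affine[OF integrable_gaussian[of "1 / (\<delta> n)\<^sup>2"], of "-1" x] \<delta>[of n] by simp
        have "integrable lborel (\<lambda>a. indicator B a * exp (- (1 / (\<delta> n)\<^sup>2) * (norm (x - a))\<^sup>2))"
          by (rule Bochner_Integration.integrable_bound[OF i]) (auto simp: indicator_def)
        from integral_lborel_affine[OF this, of "\<delta> n" x] show ?thesis
          unfolding J_def using \<delta>[of n] by (simp add: power_mult_distrib)
      qed
      have int3: "integrable (lborel \<Otimes>\<^sub>M lborel) (\<lambda>(x, a). W x * of_real (indicator B a * exp (- (1 / (\<delta> n)\<^sup>2) * (norm (x - a))\<^sup>2)))"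
      \<comment> \<open>The kernel couples \<open>x\<close> and \<open>a\<close>, so the integral
        over \<open>a\<close> is taken first; it equals a multiple of \<open>J n x\<close>, which is
        bounded uniformly in \<open>x\<close>.\<close>
      proof (rule lborel_pair.Fubini_integrable)
        have i: "integrable lborel (\<lambda>a. exp (- (1 / (\<delta> n)\<^sup>2) * (norm (x - a))\<^sup>2))" for x :: 'a
          using integrable_lborel_affine[OF integrable_gaussian[of "1 / (\<delta> n)\<^sup>2"], of "-1" x] \<delta>[of n] by simp
        have i2: "integrable lborel (\<lambda>a. indicator B a * exp (- (1 / (\<delta> n)\<^sup>2) * (norm (x - a))\<^sup>2))" for x
          by (rule Bochner_Integration.integrable_bound[OF i]) (auto simp: indicator_def)
        show "AE x in lborel. integrable lborel (\<lambda>y. case (x, y) of (x, a) \<Rightarrow> W x * of_real (indicator B a * exp (- (1 / (\<delta> n)\<^sup>2) * (norm (x - a))\<^sup>2)))"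
          unfolding prod.case by (intro AE_I2 integrable_mult_right integrable_of_real i2)
        have "(\<lambda>x. LINT y|lborel. norm (case (x, y) of (x, a) \<Rightarrow> W x * of_real (indicator B a * exp (- (1 / (\<delta> n)\<^sup>2) * (norm (x - a))\<^sup>2))))
          = (\<lambda>x. norm (W x) * (\<bar>\<delta> n\<bar> ^ DIM('a) *\<^sub>R J n x))"
          unfolding aff by (simp add: norm_mult)
        moreover have "integrable lborel \<dots>"
        proof (rule Bochner_Integration.integrable_bound)
          show "integrable lborel (\<lambda>x. (\<bar>\<delta> n\<bar> ^ DIM('a) * (LINT z|lborel. exp (- (norm (z::'a))\<^sup>2))) * norm (W x))"
            using W by (intro integrable_mult_right integrable_norm)
          show "AE x in lborel. norm (norm (W x) * (\<bar>\<delta> n\<bar> ^ DIM('a) *\<^sub>R J n x)) \<le> norm ((\<bar>\<delta> n\<bar> ^ DIM('a) * (LINT z|lborel. exp (- (norm (z::'a))\<^sup>2))) * norm (W x))"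
          proof (rule AE_I2)
            fix x
            have "\<bar>J n x\<bar> \<le> \<bar>LINT z|lborel. exp (- (norm (z::'a))\<^sup>2)\<bar>"
              using J_bound[of n x] by simp
            then have "(norm (W x) * \<bar>\<delta> n\<bar> ^ DIM('a)) * \<bar>J n x\<bar> \<le> (norm (W x) * \<bar>\<delta> n\<bar> ^ DIM('a)) * \<bar>LINT z|lborel. exp (- (norm (z::'a))\<^sup>2)\<bar>"
              by (intro mult_left_mono) auto
            then show "norm (norm (W x) * (\<bar>\<delta> n\<bar> ^ DIM('a) *\<^sub>R J n x)) \<le> norm ((\<bar>\<delta> n\<bar> ^ DIM('a) * (LINT z|lborel. exp (- (norm (z::'a))\<^sup>2))) * norm (W x))"
              by (simp add: abs_mult mult.commute mult.left_commute)
          qed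
        qed measurable
        ultimately show "integrable lborel (\<lambda>x. LINT y|lborel. norm (case (x, y) of (x, a) \<Rightarrow> W x * of_real (indicator B a * exp (- (1 / (\<delta> n)\<^sup>2) * (norm (x - a))\<^sup>2))))" by simp
      qed measurable
      have "of_real (\<bar>\<delta> n\<bar> ^ DIM('a)) * (LINT x|lborel. W x * of_real (J n x)) = (LINT x|lborel. W x * of_real (\<bar>\<delta> n\<bar> ^ DIM('a) *\<^sub>R J n x))"
        by (subst integral_mult_right_zero[symmetric]) (simp add: mult_ac del: integral_mult_right_zero)
      also have "\<dots> = (LINT x|lborel. LINT a|lborel. W x * of_real (indicator B a * exp (- (1 / (\<delta> n)\<^sup>2) * (norm (x - a))\<^sup>2)))"
        unfolding aff integral_mult_right_zero integral_complex_of_real ..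
      also have "\<dots> = (LINT a|lborel. LINT x|lborel. W x * of_real (indicator B a * exp (- (1 / (\<delta> n)\<^sup>2) * (norm (x - a))\<^sup>2)))"
        by (rule lborel_pair.Fubini_integral[OF int3, symmetric])
      also have "\<dots> = (LINT a|lborel. indicator B a * (LINT x|lborel. W x * of_real (exp (- (1 / (\<delta> n)\<^sup>2) * (norm (x - a))\<^sup>2))))"
        by (intro Bochner_Integration.integral_cong refl) (auto simp: indicator_def)
      also have "\<dots> = 0"
        by (subst Wzero) (use \<delta>[of n] in auto)
      finally show ?thesis using \<delta>[of n] by auto
    qed
    have "(\<lambda>n. LINT x|lborel. W x * of_real (J n x)) \<longlonglongrightarrow> (LINT x|lborel. W x * of_real (LINT z|lborel. indicator B x * exp (- (norm (z::'a))\<^sup>2)))"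
    proof (rule integral_dominated_convergence)
      show "integrable lborel (\<lambda>x. norm (W x) * (LINT z|lborel. exp (- (norm (z::'a))\<^sup>2)))"
        using W by auto
      show "AE x in lborel. (\<lambda>n. W x * of_real (J n x)) \<longlonglongrightarrow> W x * of_real (LINT z|lborel. indicator B x * exp (- (norm (z::'a))\<^sup>2))"
        using N by eventually_elim (intro tendsto_intros Jlim)
      show "AE x in lborel. norm (W x * of_real (J n x)) \<le> norm (W x) * (LINT z|lborel. exp (- (norm (z::'a))\<^sup>2))" for n
        using J_bound[of n] by (auto simp: norm_mult intro!: mult_left_mono)
    qed measurable
    then have "(LINT x|lborel. W x * of_real (LINT z|lborel. indicator B x * exp (- (norm (z::'a))\<^sup>2))) = 0"
      unfolding zeroJ by (simp add: LIMSEQ_const_iff)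
    moreover have "(LINT z|lborel. exp (- (norm (z::'a))\<^sup>2)) \<noteq> 0"
      by (simp add: integral_gaussian)
    ultimately have "(LINT x|lborel. W x * of_real (indicator B x)) = 0"
      by (simp add: mult.assoc[symmetric])
    then show ?thesis by (simp add: scaleR_conv_of_real mult.commute)
  qed
  have univ: "(LINT x|lborel. W x) = 0" using main[of UNIV] by simp
  have box: "(LINT x|lborel. indicator (box l u) x *\<^sub>R W x) = 0" for l u
  proof (rule main)
    have "AE x in lborel. x \<notin> cbox l u - box l u"
      using negligible_frontier_interval[of l u]
      by (intro AE_not_in) (auto simp: negligible_iff_null_sets null_sets_completion_iff)
    then show "AE x in lborel. x \<in> interior (box l u) \<or> x \<in> interior (- box l u)"
    proof eventually_elim
      case (elim x)
      show ?case
      proof (cases "x \<in> box l u")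
        case False
        then have "x \<in> - cbox l u" using elim by auto
        moreover have "- cbox l u \<subseteq> - box l u" using box_subset_cbox by auto
        ultimately have "x \<in> interior (- box l u)" by (intro interiorI[of "- cbox l u"]) auto
        then show ?thesis ..
      qed (simp add: interior_open open_box)
    qed
  qed simp
  have "AE x in lborel. Re (W x) = 0"
  proof (rule AE_zero_if_box_integrals_zero)
    show "(LINT x:box l u|lborel. Re (W x)) = 0" for l u
      using arg_cong[OF box[of l u], of Re] W unfolding set_lebesgue_integral_def
      by (subst (asm) integral_Re[symmetric]) (auto intro: integrable_mult_indicator)
  qed (use W univ in auto)
  moreover have "AE x in lborel. Im (W x) = 0"
  proof (rule AE_zero_if_box_integrals_zero)
    show "(LINT x:box l u|lborel. Im (W x)) = 0" for l u
      using arg_cong[OF box[of l u], of Im] W unfolding set_lebesgue_integral_def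
      by (subst (asm) integral_Im[symmetric]) (auto intro: integrable_mult_indicator)
  qed (use W univ in auto)
  ultimately show ?thesis
    by eventually_elim (auto simp: W_def complex_eq_iff)
qed

subsection \<open>Decay of Fourier transforms of Schwartz functions\<close>

lemma has_vector_derivative_tendsto:
  assumes "(h has_vector_derivative D) (at 0)"
  shows "((\<lambda>t. (h t - h 0) /\<^sub>R t) \<longlongrightarrow> D) (at (0::real))"
proof -
  have "((\<lambda>t. norm (h (0 + t) - h 0 - t *\<^sub>R D) / norm t) \<longlongrightarrow> 0) (at 0)"
    using assms unfolding has_vector_derivative_def has_derivative_at by blast
  moreover have "\<forall>\<^sub>F t in at 0. norm (h (0 + t) - h 0 - t *\<^sub>R D) / norm t = norm ((h t - h 0) /\<^sub>R t - D)"
  proof (rule eventually_at_filter[THEN iffD2], rule always_eventually, intro allI impI)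
    fix t :: real assume t: "t \<noteq> 0"
    then have "(h t - h 0) /\<^sub>R t - D = (h (0 + t) - h 0 - t *\<^sub>R D) /\<^sub>R t"
      by (simp add: scaleR_diff_right)
    then show "norm (h (0 + t) - h 0 - t *\<^sub>R D) / norm t = norm ((h t - h 0) /\<^sub>R t - D)"
      by (simp add: divide_inverse mult.commute)
  qed
  ultimately have "((\<lambda>t. norm ((h t - h 0) /\<^sub>R t - D)) \<longlongrightarrow> 0) (at 0)"
    by (rule Lim_transform_eventually)
  then show ?thesis by (simp add: tendsto_norm_zero_iff Lim_null[of _ D])
qed

lemma integrable_of_decay:
  fixes g :: "'a::euclidean_space \<Rightarrow> complex"
  assumes [measurable]: "g \<in> borel_measurable borel"
    and le: "\<And>x. norm (g x) \<le> C / (1 + norm x) ^ m" and m: "2 * DIM('a) \<le> m"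
  shows "integrable lborel g"
proof (rule Bochner_Integration.integrable_bound)
  show "integrable lborel (\<lambda>x::'a. C * (1 / (1 + norm x) ^ m))"
    by (intro integrable_mult_right integrable_inverse_power_norm m)
  show "AE x in lborel. norm (g x) \<le> norm (C * (1 / (1 + norm x) ^ m))"
    by (intro AE_I2 order.trans[OF le]) (simp add: divide_right_mono)
qed simp

text \<open>Difference quotients take the place of integration by parts: a translation of
  \<open>g\<close> becomes a phase on the transform, so the quotient is transformed into (exp (i
  \<delta> (b . \<xi>)) - 1) / \<delta> times \<open>fourier g \<xi>\<close>. The mean value
  inequality and the decay of \<open>g'\<close> provide a dominating function.\<close>

lemma fourier_deriv:
  fixes g g' :: "'a::euclidean_space \<Rightarrow> complex" and b \<xi> :: 'a
  assumes [measurable]: "g \<in> borel_measurable borel" "g' \<in> borel_measurable borel"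
    and g: "\<And>x. norm (g x) \<le> C / (1 + norm x) ^ m"
    and g': "\<And>x. norm (g' x) \<le> C' / (1 + norm x) ^ m" and m: "2 * DIM('a) \<le> m"
    and der: "\<And>x t. ((\<lambda>t. g (x + t *\<^sub>R b)) has_vector_derivative g' (x + t *\<^sub>R b)) (at t)"
  shows "fourier g' \<xi> = \<i> * of_real (b \<bullet> \<xi>) * fourier g \<xi>"
proof -
  have ig: "integrable lborel g" by (rule integrable_of_decay[OF _ g m]) measurable
  define \<delta> where "\<delta> n = inverse (real (Suc n))" for n
  have \<delta>: "\<delta> n > 0" "\<delta> n \<le> 1" for n by (simp_all add: \<delta>_def inverse_eq_divide)
  have "\<delta> \<longlonglongrightarrow> 0" unfolding \<delta>_def by (rule LIMSEQ_inverse_real_of_nat)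
  then have \<delta>0: "filterlim \<delta> (at 0) sequentially"
    using \<delta> by (auto simp: filterlim_at intro!: always_eventually less_imp_neq[symmetric])
  define D where "D n x = (g (x + \<delta> n *\<^sub>R b) - g x) /\<^sub>R \<delta> n" for n x
  have Dlim: "(\<lambda>n. D n x) \<longlonglongrightarrow> g' x" for x
    using filterlim_compose[OF has_vector_derivative_tendsto \<delta>0, OF der[of x 0]]
    by (simp add: D_def)
  have Dbound: "norm (D n x) \<le> (C' * (1 + norm b) ^ m) * (1 / (1 + norm x) ^ m)" for n x
  proof -
    have "\<exists>s\<in>{0<..<\<delta> n}. norm (g (x + \<delta> n *\<^sub>R b) - g (x + 0 *\<^sub>R b)) \<le> norm ((\<delta> n - 0) *\<^sub>R g' (x + s *\<^sub>R b))"
    proof (rule mvt_general[where f="\<lambda>t. g (x + t *\<^sub>R b)" and f'="\<lambda>s h. h *\<^sub>R g' (x + s *\<^sub>R b)"])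
      show "continuous_on {0..\<delta> n} (\<lambda>t. g (x + t *\<^sub>R b))"
        using der by (intro continuous_at_imp_continuous_on ballI has_vector_derivative_continuous) auto
    qed (use \<delta> der in \<open>auto simp: has_vector_derivative_def\<close>)
    then obtain s where s: "0 < s" "s < \<delta> n" and le: "norm (g (x + \<delta> n *\<^sub>R b) - g x) \<le> norm (\<delta> n *\<^sub>R g' (x + s *\<^sub>R b))"
      by auto
    have "norm (D n x) = norm (g (x + \<delta> n *\<^sub>R b) - g x) / \<delta> n"
      using \<delta>[of n] by (simp add: D_def divide_inverse mult.commute)
    also have "\<dots> \<le> norm (g' (x + s *\<^sub>R b))"
      using le \<delta>[of n] by (simp add: divide_simps mult.commute)
    also have "\<dots> \<le> C' / (1 + norm (x + s *\<^sub>R b)) ^ m" by (rule g')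
    also have "\<dots> \<le> (C' * (1 + norm b) ^ m) * (1 / (1 + norm x) ^ m)"
    proof -
      have "norm x \<le> norm (x + s *\<^sub>R b) + norm (s *\<^sub>R b)"
        using norm_triangle_ineq4[of "x + s *\<^sub>R b" "s *\<^sub>R b"] by simp
      also have "norm (s *\<^sub>R b) \<le> 1 * norm b"
        unfolding norm_scaleR using s \<delta>[of n] by (intro mult_right_mono) auto
      finally have "norm x \<le> norm (x + s *\<^sub>R b) + 1 * norm b" by simp
      moreover have "0 \<le> norm (x + s *\<^sub>R b) * norm b" by simp
      \<comment> \<open>A shift by at most |b| costs only the constant factor 1 + |b| in the weight,
        uniformly in the intermediate point \<open>s\<close>.\<close>
      ultimately have "1 + norm x \<le> (1 + norm (x + s *\<^sub>R b)) * (1 + norm b)"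
        by (simp only: distrib_left distrib_right mult_1_left mult_1_right)
      then have "(1 + norm x) ^ m \<le> (1 + norm (x + s *\<^sub>R b)) ^ m * (1 + norm b) ^ m"
        by (metis power_mono power_mult_distrib add_nonneg_nonneg norm_ge_zero zero_le_one)
      moreover have "C' \<ge> 0" using order.trans[OF norm_ge_zero g'[of 0]] by simp
      ultimately have "C' * (1 + norm x) ^ m \<le> C' * ((1 + norm (x + s *\<^sub>R b)) ^ m * (1 + norm b) ^ m)"
        by (intro mult_left_mono)
      then show ?thesis
        by (simp add: divide_simps mult_ac add_pos_nonneg add_nonneg_eq_0_iff)
    qed
    finally show ?thesis .
  qed
  have [measurable]: "D n \<in> borel_measurable borel" for n unfolding D_def by measurable
  have "(\<lambda>n. fourier (D n) \<xi>) \<longlonglongrightarrow> fourier g' \<xi>"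
    unfolding fourier_def
  proof (rule integral_dominated_convergence)
    show "integrable lborel (\<lambda>x::'a. (C' * (1 + norm b) ^ m) * (1 / (1 + norm x) ^ m))"
      by (intro integrable_mult_right integrable_inverse_power_norm m)
    show "AE x in lborel. norm (exp (- \<i> * complex_of_real (x \<bullet> \<xi>)) * D n x) \<le> (C' * (1 + norm b) ^ m) * (1 / (1 + norm x) ^ m)" for n
      using Dbound by (simp add: norm_mult)
  qed (auto intro!: tendsto_intros Dlim)
  moreover have "fourier (D n) \<xi> = ((exp (\<i> * of_real (\<delta> n * (b \<bullet> \<xi>))) - exp (\<i> * of_real (0 * (b \<bullet> \<xi>)))) /\<^sub>R \<delta> n) * fourier g \<xi>" for n
  proof -
    let ?e = "\<lambda>x. exp (- \<i> * complex_of_real (x \<bullet> \<xi>))"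
    have i: "integrable lborel (\<lambda>x. ?e x * g (x + \<delta> n *\<^sub>R b))"
      using integrable_fourier[OF integrable_lborel_affine[OF ig, of 1 "\<delta> n *\<^sub>R b"]] by (simp add: add.commute)
    have "(LINT x|lborel. ?e x * g (x + \<delta> n *\<^sub>R b)) = (LINT x|lborel. ?e (x - \<delta> n *\<^sub>R b) * g x)"
      using integral_lborel_affine[OF i, of 1 "- \<delta> n *\<^sub>R b"] by (simp add: algebra_simps)
    also have "(\<lambda>x. ?e (x - \<delta> n *\<^sub>R b) * g x) = (\<lambda>x. exp (\<i> * of_real (\<delta> n * (b \<bullet> \<xi>))) * (?e x * g x))"
      by (auto simp: inner_diff_left exp_diff exp_minus field_simps)
    finally have 1: "(LINT x|lborel. ?e x * g (x + \<delta> n *\<^sub>R b)) = exp (\<i> * of_real (\<delta> n * (b \<bullet> \<xi>))) * fourier g \<xi>"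
      by (simp add: fourier_def)
    have "fourier (D n) \<xi> = (LINT x|lborel. (?e x * g (x + \<delta> n *\<^sub>R b) - ?e x * g x) /\<^sub>R \<delta> n)"
      unfolding fourier_def D_def by (intro Bochner_Integration.integral_cong refl) (simp add: algebra_simps scaleR_conv_of_real)
    also have "\<dots> = (exp (\<i> * of_real (\<delta> n * (b \<bullet> \<xi>))) * fourier g \<xi> - fourier g \<xi>) /\<^sub>R \<delta> n"
      using i integrable_fourier[OF ig, of \<xi>] 1 by (simp add: fourier_def)
    finally show ?thesis by (simp add: algebra_simps)
  qed
  moreover have "(\<lambda>n. ((exp (\<i> * of_real (\<delta> n * (b \<bullet> \<xi>))) - exp (\<i> * of_real (0 * (b \<bullet> \<xi>)))) /\<^sub>R \<delta> n) * fourier g \<xi>)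
     \<longlonglongrightarrow> (\<i> * of_real (b \<bullet> \<xi>)) * fourier g \<xi>"
  proof (intro tendsto_mult tendsto_const)
    have "((\<lambda>t. exp (\<i> * of_real (t * (b \<bullet> \<xi>)))) has_vector_derivative (\<i> * of_real (b \<bullet> \<xi>)) * exp (\<i> * of_real (0 * (b \<bullet> \<xi>)))) (at 0)"
      by (auto intro!: derivative_eq_intros has_vector_derivative_real_field)
    then show "(\<lambda>n. (exp (\<i> * of_real (\<delta> n * (b \<bullet> \<xi>))) - exp (\<i> * of_real (0 * (b \<bullet> \<xi>)))) /\<^sub>R \<delta> n) \<longlonglongrightarrow> \<i> * of_real (b \<bullet> \<xi>)"
      using filterlim_compose[OF has_vector_derivative_tendsto \<delta>0] by fastforce
  qed
  ultimately show ?thesis by (simp add: LIMSEQ_unique)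
qed

text \<open>Multiplying a transform by coordinate powers corresponds to differentiating the
  function, so the weight (1 + |x|)^m has to be bounded by pure coordinate powers. The largest
  coordinate does this.\<close>

lemma one_plus_norm_power_le:
  fixes x :: "'a::euclidean_space"
  shows "(1 + norm x) ^ m \<le> (1 + real DIM('a)) ^ m * (1 + (\<Sum>b\<in>Basis. \<bar>x \<bullet> b\<bar> ^ m))"
proof -
  \<comment> \<open>Including 1 gives 1 + |x| \<le> (1 + d) M even for small \<open>x\<close>, and
    \<open>M ^ m\<close> is still one of the summands on the right.\<close>
  define M where "M = Max (insert 1 ((\<lambda>b. \<bar>x \<bullet> b\<bar>) ` (Basis::'a set)))"
  have M: "1 \<le> M" "\<And>b. b \<in> Basis \<Longrightarrow> \<bar>x \<bullet> b\<bar> \<le> M"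
    unfolding M_def by (rule Max_ge; force)+
  have "M \<in> insert 1 ((\<lambda>b. \<bar>x \<bullet> b\<bar>) ` (Basis::'a set))" unfolding M_def by (rule Max_in) auto
  then consider "M = 1" | b where "b \<in> Basis" "M = \<bar>x \<bullet> b\<bar>" by auto
  then have *: "M ^ m \<le> 1 + (\<Sum>b\<in>Basis. \<bar>x \<bullet> b\<bar> ^ m)"
  proof cases
    case 2
    then have "M ^ m \<le> (\<Sum>b\<in>Basis. \<bar>x \<bullet> b\<bar> ^ m)"
      by (auto intro!: member_le_sum)
    then show ?thesis by simp
  qed (auto intro!: sum_nonneg)
  have "(1 + norm x) ^ m \<le> ((1 + real DIM('a)) * M) ^ m"
  proof (rule power_mono)
    have "norm x \<le> (\<Sum>b\<in>Basis. \<bar>x \<bullet> b\<bar>)" by (rule norm_le_l1)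
    also have "\<dots> \<le> real DIM('a) * M" using M by (intro sum_bounded_above) auto
    finally show "1 + norm x \<le> (1 + real DIM('a)) * M" using M by (simp add: algebra_simps)
  qed simp
  also have "\<dots> \<le> (1 + real DIM('a)) ^ m * (1 + (\<Sum>b\<in>Basis. \<bar>x \<bullet> b\<bar> ^ m))"
    unfolding power_mult_distrib by (intro mult_left_mono *) simp
  finally show ?thesis .
qed

lemma fourier_decay:
  fixes g :: "'a::euclidean_space \<Rightarrow> complex" and G :: "'a \<Rightarrow> nat \<Rightarrow> 'a \<Rightarrow> complex"
  assumes G0: "\<And>b. b \<in> Basis \<Longrightarrow> G b 0 = g"
    and meas: "\<And>b j. b \<in> Basis \<Longrightarrow> G b j \<in> borel_measurable borel"
    and decay: "\<And>b j. b \<in> Basis \<Longrightarrow> \<exists>C. \<forall>x. norm (G b j x) \<le> C / (1 + norm x) ^ (2 * DIM('a))"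
    and der: "\<And>b j x t. b \<in> Basis \<Longrightarrow> ((\<lambda>t. G b j (x + t *\<^sub>R b)) has_vector_derivative G b (Suc j) (x + t *\<^sub>R b)) (at t)"
  shows "(1 + norm \<xi>) ^ m * norm (fourier g \<xi>) \<le>
    (1 + real DIM('a)) ^ m * ((LINT x|lborel. norm (g x)) + (\<Sum>b\<in>Basis. (LINT x|lborel. norm (G b m x))))"
proof -
  have it: "fourier (G b j) \<xi> = (\<i> * of_real (b \<bullet> \<xi>)) ^ j * fourier g \<xi>" if b: "b \<in> Basis" for b j
  proof (induction j)
    case (Suc j)
    obtain C C' where "\<And>x. norm (G b j x) \<le> C / (1 + norm x) ^ (2 * DIM('a))" "\<And>x. norm (G b (Suc j) x) \<le> C' / (1 + norm x) ^ (2 * DIM('a))"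
      using decay[OF b] by metis
    from fourier_deriv[OF meas[OF b] meas[OF b] this order_refl der[OF b]] Suc show ?case by simp
  qed (simp add: G0 b)
  have b: "\<bar>\<xi> \<bullet> b\<bar> ^ m * norm (fourier g \<xi>) \<le> (LINT x|lborel. norm (G b m x))" if "b \<in> Basis" for b
    using norm_fourier_le[of "G b m" \<xi>] unfolding it[OF that]
    by (simp add: norm_mult norm_power inner_commute)
  have "(1 + norm \<xi>) ^ m * norm (fourier g \<xi>) \<le> ((1 + real DIM('a)) ^ m * (1 + (\<Sum>b\<in>Basis. \<bar>\<xi> \<bullet> b\<bar> ^ m))) * norm (fourier g \<xi>)"
    by (intro mult_right_mono one_plus_norm_power_le) simp
  also have "\<dots> = (1 + real DIM('a)) ^ m * (norm (fourier g \<xi>) + (\<Sum>b\<in>Basis. \<bar>\<xi> \<bullet> b\<bar> ^ m * norm (fourier g \<xi>)))"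
    by (simp add: algebra_simps sum_distrib_left)
  also have "\<dots> \<le> (1 + real DIM('a)) ^ m * ((LINT x|lborel. norm (g x)) + (\<Sum>b\<in>Basis. (LINT x|lborel. norm (G b m x))))"
    by (intro mult_left_mono add_mono sum_mono b norm_fourier_le) auto
  finally show ?thesis .
qed

section \<open>Schwartz functions: regularity, decay and Fourier inversion\<close>

lemma partials_schwartz_has_derivative:
  assumes "f \<in> schwartz" "bs \<in> lists Basis"
  shows "(partials bs f has_derivative frechet_derivative (partials bs f) (at x)) (at x)"
  using assms by (auto simp: schwartz_def frechet_derivative_works[symmetric])

lemma partials_schwartz_line_derivative:
  assumes "f \<in> schwartz" "bs \<in> lists Basis"
  shows "((\<lambda>t. partials bs f (x + t *\<^sub>R c)) has_vector_derivative partials (c # bs) f (x + t *\<^sub>R c)) (at t)"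
proof -
  have "((\<lambda>t. x + t *\<^sub>R c) has_vector_derivative c) (at t)"
    by (auto intro!: derivative_eq_intros)
  from vector_derivative_diff_chain_within[OF this has_derivative_at_withinI[OF partials_schwartz_has_derivative[OF assms]]]
  show ?thesis by (simp add: comp_def)
qed

lemma partials_schwartz_continuous:
  assumes "f \<in> schwartz" "bs \<in> lists Basis"
  shows "continuous_on UNIV (partials bs f)"
  by (intro continuous_at_imp_continuous_on ballI has_derivative_continuous[OF partials_schwartz_has_derivative[OF assms]])

lemma partials_schwartz_measurable:
  assumes "f \<in> schwartz" "bs \<in> lists Basis"
  shows "partials bs f \<in> borel_measurable borel"
  by (rule borel_measurable_continuous_onI[OF partials_schwartz_continuous[OF assms]])

lemma partials_schwartz_decay:
  assumes "f \<in> schwartz" "bs \<in> lists Basis"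
  shows "\<exists>C. \<forall>x. norm (partials bs f x) \<le> C / (1 + norm x) ^ m"
proof -
  have "\<exists>B. \<forall>x. norm x ^ k * norm (partials bs f x) \<le> B" for k
  proof -
    have "bounded (range (\<lambda>x. of_real (norm x ^ k) * partials bs f x))"
      using assms by (auto simp: schwartz_def)
    then show ?thesis by (auto simp: bounded_iff norm_mult norm_power)
  qed
  then obtain B where B: "\<And>k x. norm x ^ k * norm (partials bs f x) \<le> B k" by metis
  have "norm (partials bs f x) \<le> 2 ^ m * (B 0 + B m) / (1 + norm x) ^ m" for x
  proof -
    have "(1 + norm x) ^ m \<le> (2 * max 1 (norm x)) ^ m" by (intro power_mono) auto
    also have "\<dots> \<le> 2 ^ m * (1 + norm x ^ m)" by (auto simp: power_mult_distrib max_def)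
    finally have "(1 + norm x) ^ m * norm (partials bs f x) \<le> 2 ^ m * (1 + norm x ^ m) * norm (partials bs f x)"
      by (rule mult_right_mono) simp
    also have "\<dots> = 2 ^ m * (norm x ^ 0 * norm (partials bs f x) + norm x ^ m * norm (partials bs f x))"
      by (simp add: algebra_simps)
    also have "\<dots> \<le> 2 ^ m * (B 0 + B m)" by (intro mult_left_mono add_mono B) auto
    finally show ?thesis by (subst pos_le_divide_eq) (auto simp: mult.commute add_pos_nonneg)
  qed
  then show ?thesis by blast
qed

lemma schwartz_continuous: "f \<in> schwartz \<Longrightarrow> continuous_on UNIV f"
  using partials_schwartz_continuous[of f "[]"] by simp

lemma schwartz_decay: "f \<in> schwartz \<Longrightarrow> \<exists>C. \<forall>x. norm (f x) \<le> C / (1 + norm x) ^ m"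
  using partials_schwartz_decay[of f "[]"] by simp

lemma schwartz_measurable: "f \<in> schwartz \<Longrightarrow> f \<in> borel_measurable borel"
  using partials_schwartz_measurable[of f "[]"] by simp

lemma integrable_schwartz: "f \<in> schwartz \<Longrightarrow> integrable lborel (f :: 'a::euclidean_space \<Rightarrow> complex)"
  using schwartz_decay[of f "2 * DIM('a)"] schwartz_measurable[of f] by (auto intro: integrable_of_decay)

lemma fourier_schwartz_decay:
  fixes f :: "'a::euclidean_space \<Rightarrow> complex"
  assumes f: "f \<in> schwartz"
  shows "\<exists>C. \<forall>\<xi>. norm (fourier f \<xi>) \<le> C / (1 + norm \<xi>) ^ m"
proof -
  have l: "replicate j b \<in> lists Basis" if "b \<in> Basis" for j and b :: 'a
    using that by (induction j) auto
  have "(1 + norm \<xi>) ^ m * norm (fourier f \<xi>) \<le> (1 + real DIM('a)) ^ m * ((LINT x|lborel. norm (f x)) +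
     (\<Sum>b\<in>Basis. (LINT x|lborel. norm (partials (replicate m b) f x))))" for \<xi>
  proof (rule fourier_decay)
    show "((\<lambda>t. partials (replicate j b) f (x + t *\<^sub>R b)) has_vector_derivative partials (replicate (Suc j) b) f (x + t *\<^sub>R b)) (at t)"
      if "b \<in> Basis" for b j x t
      using partials_schwartz_line_derivative[OF f l[OF that]] by simp
  qed (use l f in \<open>auto intro: partials_schwartz_decay partials_schwartz_measurable\<close>)
  then show ?thesis
    by (intro exI allI, subst pos_le_divide_eq) (auto simp: add_pos_nonneg mult.commute)
qed

lemma integrable_fourier_schwartz:
  "f \<in> schwartz \<Longrightarrow> integrable lborel (fourier f :: 'a::euclidean_space \<Rightarrow> complex)"
  using fourier_schwartz_decay[of f "2 * DIM('a)"] integrable_schwartz[of f]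
  by (auto intro!: integrable_of_decay borel_measurable_continuous_onI continuous_fourier)

lemma schwartz_bounded:
  assumes "f \<in> schwartz" shows "\<exists>C. \<forall>x. norm (f x) \<le> C"
  using schwartz_decay[OF assms, of 0] by simp

lemma fourier_inversion_schwartz:
  assumes f: "f \<in> schwartz" shows "inverse_fourier (fourier f) = f"
proof -
  obtain C where "\<And>x. norm (f x) \<le> C" using schwartz_bounded[OF f] by blast
  then show ?thesis
    by (rule fourier_inversion[OF integrable_schwartz[OF f] schwartz_continuous[OF f] _ integrable_fourier_schwartz[OF f]])
qed

subsection \<open>Riesz potentials of inverse Fourier integrals\<close>

text \<open>The coefficients produced by differentiating a Gaussian. Generating them from constants
  and linear forms, rather than from coefficient families, makes stability under differentiation and
  polynomial growth plain inductions.\<close>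

inductive complex_polynomial :: "('a::euclidean_space \<Rightarrow> complex) \<Rightarrow> bool" where
  const: "complex_polynomial (\<lambda>_. c)"
| inner: "complex_polynomial (\<lambda>x. of_real (x \<bullet> a))"
| add: "complex_polynomial P \<Longrightarrow> complex_polynomial Q \<Longrightarrow> complex_polynomial (\<lambda>x. P x + Q x)"
| mult: "complex_polynomial P \<Longrightarrow> complex_polynomial Q \<Longrightarrow> complex_polynomial (\<lambda>x. P x * Q x)"

lemma complex_polynomial_sum:
  assumes "\<And>i. i \<in> I \<Longrightarrow> complex_polynomial (P i)"
  shows "complex_polynomial (\<lambda>x. \<Sum>i\<in>I. P i x)"
  using assms by (induction I rule: infinite_finite_induct) (auto intro: complex_polynomial.intros)

lemma complex_polynomial_has_derivative:
  "complex_polynomial P \<Longrightarrow> \<exists>D. (\<forall>x. (P has_derivative D x) (at x)) \<and> (\<forall>c. complex_polynomial (\<lambda>x. D x c))"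
proof (induction rule: complex_polynomial.induct)
  case (const c)
  show ?case by (rule exI[of _ "\<lambda>_ _. 0"]) (auto intro: complex_polynomial.const)
next
  case (inner a)
  show ?case
    by (rule exI[of _ "\<lambda>_ c. of_real (c \<bullet> a)"]) (auto intro!: complex_polynomial.const derivative_eq_intros)
next
  case (add P Q)
  then obtain D E where "\<And>x. (P has_derivative D x) (at x)" "\<And>c. complex_polynomial (\<lambda>x. D x c)"
    "\<And>x. (Q has_derivative E x) (at x)" "\<And>c. complex_polynomial (\<lambda>x. E x c)" by blast
  then show ?case
    by (intro exI[of _ "\<lambda>x c. D x c + E x c"]) (auto intro!: complex_polynomial.add derivative_intros)
next
  case (mult P Q)
  then obtain D E where "\<And>x. (P has_derivative D x) (at x)" "\<And>c. complex_polynomial (\<lambda>x. D x c)"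
    "\<And>x. (Q has_derivative E x) (at x)" "\<And>c. complex_polynomial (\<lambda>x. E x c)" by blast
  then show ?case using mult.hyps
    by (intro exI[of _ "\<lambda>x c. P x * E x c + D x c * Q x"]) (auto intro!: complex_polynomial.intros derivative_intros)
qed

lemma complex_polynomial_growth:
  "complex_polynomial P \<Longrightarrow> \<exists>C m. \<forall>x. norm (P x) \<le> C * (1 + norm x) ^ m"
proof (induction rule: complex_polynomial.induct)
  case (const c)
  show ?case by (rule exI[of _ "norm c"], rule exI[of _ 0]) simp
next
  case (inner a)
  have "norm (complex_of_real (x \<bullet> a)) \<le> norm a * (1 + norm x) ^ 1" for x
    using Cauchy_Schwarz_ineq2[of x a] by (simp add: algebra_simps add_increasing)
  then show ?case by blast
next
  case (add P Q)
  then obtain C m D k where P: "\<And>x. norm (P x) \<le> C * (1 + norm x) ^ m" and Q: "\<And>x. norm (Q x) \<le> D * (1 + norm x) ^ k"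
    by blast
  have "norm (P x + Q x) \<le> (\<bar>C\<bar> + \<bar>D\<bar>) * (1 + norm x) ^ (m + k)" for x
  proof -
    have "norm (P x) \<le> \<bar>C\<bar> * (1 + norm x) ^ (m + k)"
      by (rule order.trans[OF P]) (intro mult_mono power_increasing, auto)
    moreover have "norm (Q x) \<le> \<bar>D\<bar> * (1 + norm x) ^ (m + k)"
      by (rule order.trans[OF Q]) (intro mult_mono power_increasing, auto)
    ultimately show ?thesis using norm_triangle_ineq[of "P x" "Q x"] by (simp add: distrib_right)
  qed
  then show ?case by blast
next
  case (mult P Q)
  then obtain C m D k where P: "\<And>x. norm (P x) \<le> C * (1 + norm x) ^ m" and Q: "\<And>x. norm (Q x) \<le> D * (1 + norm x) ^ k"
    by blast
  have "norm (P x * Q x) \<le> (C * D) * (1 + norm x) ^ (m + k)" for x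
    using mult_mono[OF P[of x] Q[of x] order.trans[OF norm_ge_zero P]] by (simp add: norm_mult power_add mult_ac)
  then show ?case by blast
qed

text \<open>One directional derivative replaces the coefficient \<open>R\<close> by R Q' + R', again
  a polynomial, while the exponential stays. So the shape persists through every iterated
  derivative.\<close>

lemma partials_polynomial_exp:
  assumes P: "complex_polynomial P" and Q: "complex_polynomial Q"
  shows "\<exists>R. complex_polynomial R \<and> partials bs (\<lambda>x. P x * exp (Q x)) = (\<lambda>x. R x * exp (Q x))"
proof (induction bs)
  case Nil
  then show ?case using P by auto
next
  case (Cons b bs)
  then obtain R where R: "complex_polynomial R" and eq: "partials bs (\<lambda>x. P x * exp (Q x)) = (\<lambda>x. R x * exp (Q x))" by blast
  obtain D where D: "\<And>x. (R has_derivative D x) (at x)" "\<And>c. complex_polynomial (\<lambda>x. D x c)"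
    using complex_polynomial_has_derivative[OF R] by blast
  obtain E where E: "\<And>x. (Q has_derivative E x) (at x)" "\<And>c. complex_polynomial (\<lambda>x. E x c)"
    using complex_polynomial_has_derivative[OF Q] by blast
  have "((\<lambda>x. R x * exp (Q x)) has_derivative (\<lambda>c. R x * (exp (Q x) * E x c) + D x c * exp (Q x))) (at x)" for x
    by (intro has_derivative_mult D has_derivative_compose[OF E(1), of exp "\<lambda>z. exp (Q x) * z" x])
       (metis DERIV_exp has_field_derivative_def)
  from frechet_derivative_at[OF this, symmetric]
  have "partials (b # bs) (\<lambda>x. P x * exp (Q x)) = (\<lambda>x. (R x * E x b + D x b) * exp (Q x))"
    by (simp add: eq algebra_simps)
  moreover have "complex_polynomial (\<lambda>x. R x * E x b + D x b)"
    by (intro complex_polynomial.intros R D E)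
  ultimately show ?case by blast
qed

text \<open>A quadratic exponent with linear, constant and oscillating terms, so that translation
  (via \<open>a\<close> and \<open>c\<close>) and modulation (via \<open>b\<close>) are covered at
  once.\<close>

lemma gaussian_in_schwartz:
  fixes a b :: "'a::euclidean_space"
  assumes s: "s > 0"
  shows "(\<lambda>x. exp (of_real (- s * (norm x)\<^sup>2 + a \<bullet> x + c) + \<i> * of_real (b \<bullet> x))) \<in> schwartz"
proof -
  define Q where "Q x = complex_of_real (- s * (norm x)\<^sup>2 + a \<bullet> x + c) + \<i> * of_real (b \<bullet> x)" for x
  have Q: "complex_polynomial Q"
  proof -
    have "Q = (\<lambda>x. (of_real (- s) * (\<Sum>e\<in>Basis. of_real (x \<bullet> e) * of_real (x \<bullet> e)) + of_real (x \<bullet> a) + of_real c) + \<i> * of_real (x \<bullet> b))"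
      unfolding Q_def norm_power2_sum_Basis by (simp add: power2_eq_square inner_commute)
    then show ?thesis
      by (simp only:) (intro complex_polynomial.intros complex_polynomial_sum)
  qed
  show ?thesis unfolding schwartz_def Q_def[symmetric]
  proof (intro CollectI ballI conjI allI)
    fix bs :: "'a list" assume "bs \<in> lists Basis"
    obtain R where R: "complex_polynomial R" and eq: "partials bs (\<lambda>x. exp (Q x)) = (\<lambda>x. R x * exp (Q x))"
      using partials_polynomial_exp[OF complex_polynomial.const[of 1] Q, of bs] by auto
    obtain D E where "\<And>x. (R has_derivative D x) (at x)" "\<And>x. (Q has_derivative E x) (at x)"
      using complex_polynomial_has_derivative[OF R] complex_polynomial_has_derivative[OF Q] by blast
    then have "R differentiable at x" "Q differentiable at x" for x by (auto simp: differentiable_def)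
    then show "partials bs (\<lambda>x. exp (Q x)) differentiable at x" for x
      unfolding eq by (intro derivative_intros differentiable_compose[of exp Q])
        (auto simp: field_differentiable_imp_differentiable field_differentiable_within_exp)
    fix m :: nat
    obtain C k where C: "\<And>x. norm (R x) \<le> C * (1 + norm x) ^ k" using complex_polynomial_growth[OF R] by blast
    \<comment> \<open>By 1 + r \<le> exp r the polynomial weights cost at most exp ((m + k) r); with
      the linear term of the exponent this gives exp (L r - s r^2), whose exponent has maximum L^2 /
      (4 s).\<close>
    define L where "L = real (m + k) + norm a"
    have "norm (of_real (norm x ^ m) * (R x * exp (Q x))) \<le> C * exp (L\<^sup>2 / (4 * s) + c)" for x
    proof -
      have C0: "C \<ge> 0" using order.trans[OF norm_ge_zero C[of 0]] by simp
      have "norm (of_real (norm x ^ m) * (R x * exp (Q x))) = norm x ^ m * norm (R x) * exp (- s * (norm x)\<^sup>2 + a \<bullet> x + c)"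
        by (simp add: norm_mult norm_power Q_def norm_exp_eq_Re)
      also have "\<dots> \<le> (1 + norm x) ^ m * (C * (1 + norm x) ^ k) * exp (- s * (norm x)\<^sup>2 + norm a * norm x + c)"
        using C0 by (intro mult_mono power_mono C) (auto intro: norm_cauchy_schwarz)
      also have "\<dots> = C * ((1 + norm x) ^ (m + k) * exp (- s * (norm x)\<^sup>2 + norm a * norm x + c))"
        by (simp add: power_add)
      also have "\<dots> \<le> C * (exp (norm x) ^ (m + k) * exp (- s * (norm x)\<^sup>2 + norm a * norm x + c))"
        using C0 by (intro mult_left_mono mult_right_mono power_mono exp_ge_add_one_self) auto
      also have "\<dots> = C * exp (L * norm x - s * (norm x)\<^sup>2 + c)"
        by (simp add: exp_of_nat_mult[symmetric] exp_add[symmetric] L_def algebra_simps)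
      also have "\<dots> \<le> C * exp (L\<^sup>2 / (4 * s) + c)"
      proof -
        have "0 \<le> (2 * s * norm x - L)\<^sup>2" by simp
        then have "L * norm x - s * (norm x)\<^sup>2 \<le> L\<^sup>2 / (4 * s)"
          using s by (simp add: field_simps power2_eq_square)
        then show ?thesis using C0 by (intro mult_left_mono) auto
      qed
      finally show ?thesis .
    qed
    then show "bounded (range (\<lambda>x. of_real (norm x ^ m) * partials bs (\<lambda>x. exp (Q x)) x))"
      unfolding eq bounded_iff by blast
  qed
qed

lemma translated_gaussian_in_schwartz:
  fixes a :: "'a::euclidean_space"
  assumes "s > 0"
  shows "(\<lambda>x. complex_of_real (exp (- s * (norm (x - a))\<^sup>2))) \<in> schwartz"
proof -
  have eq: "- s * (norm x)\<^sup>2 + ((2 * s) *\<^sub>R a) \<bullet> x + - s * (norm a)\<^sup>2 = - s * (norm (x - a))\<^sup>2" for x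
    by (simp add: power2_norm_eq_inner inner_diff_left inner_diff_right inner_commute algebra_simps)
  show ?thesis
    using gaussian_in_schwartz[OF assms, of "(2 * s) *\<^sub>R a" "- s * (norm a)\<^sup>2" 0]
    by (simp only: eq inner_zero_left of_real_0 mult_zero_right add_0_right exp_of_real)
qed

lemma modulated_gaussian_in_schwartz:
  assumes "s > 0"
  shows "(\<lambda>\<xi>. exp (\<i> * of_real (a \<bullet> \<xi>)) * complex_of_real (exp (- s * (norm \<xi>)\<^sup>2))) \<in> schwartz"
  using gaussian_in_schwartz[OF assms, of 0 0 a]
  by (simp only: exp_add inner_zero_left add_0_right exp_of_real mult.commute)

text \<open>Both candidates have equal pairings with every Schwartz function, in particular with
  translated Gaussians, which separate functions up to null sets; \<open>tempered\<close> supplies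
  the integrability.\<close>

lemma has_fourier_unique_transform:
  assumes "has_fourier g \<gamma>" "has_fourier g \<gamma>'"
  shows "AE \<xi> in lborel. \<gamma> \<xi> = \<gamma>' \<xi>"
proof -
  have int: "integrable lborel (\<lambda>x. \<gamma> x * \<phi> x)" "integrable lborel (\<lambda>x. \<gamma>' x * \<phi> x)" if "\<phi> \<in> schwartz" for \<phi>
    using assms that by (auto simp: has_fourier_def tempered_def)
  have "AE \<xi> in lborel. \<gamma> \<xi> - \<gamma>' \<xi> = 0"
  proof (rule gaussians_separate)
    fix s :: real and a :: 'a assume s: "s > 0"
    note i = int[OF translated_gaussian_in_schwartz[OF s, of a]]
    show "integrable lborel (\<lambda>x. (\<gamma> x - \<gamma>' x) * of_real (exp (- s * (norm (x - a))\<^sup>2)))"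
      unfolding left_diff_distrib using i by (rule Bochner_Integration.integrable_diff)
    show "(LINT x|lborel. (\<gamma> x - \<gamma>' x) * of_real (exp (- s * (norm (x - a))\<^sup>2))) = 0"
      unfolding left_diff_distrib Bochner_Integration.integral_diff[OF i]
      using assms translated_gaussian_in_schwartz[OF s, of a] by (simp add: has_fourier_def)
  qed
  then show ?thesis by simp
qed

lemma continuous_AE_zero:
  fixes w :: "'a::euclidean_space \<Rightarrow> complex"
  assumes "continuous_on UNIV w" "AE x in lborel. w x = 0"
  shows "w x = 0"
proof (rule ccontr)
  assume x: "w x \<noteq> 0"
  have o: "open {x. w x \<noteq> 0}"
    using assms(1) by (intro open_Collect_neq) auto
  obtain N where "{x \<in> space lborel. w x \<noteq> 0} \<subseteq> N" "N \<in> null_sets lborel"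
    using assms(2) by (auto simp: eventually_ae_filter)
  then have "{x. w x \<noteq> 0} \<in> null_sets lborel"
    using o null_sets_subset[of N lborel "{x. w x \<noteq> 0}"] by auto
  then have "negligible {x. w x \<noteq> 0}"
    by (simp add: negligible_iff_null_sets null_sets_completionI)
  then show False using open_not_negligible[OF o] x by auto
qed

text \<open>The pairings of \<open>h\<close> are known only against functions of the form
  \<open>fourier \<phi>\<close>. Choosing \<phi> as a modulated Gaussian makes these exactly the
  translated Gaussians; continuity then upgrades equality almost everywhere to equality.\<close>

lemma has_fourier_unique_continuous:
  assumes h: "has_fourier h \<gamma>" and h': "has_fourier h' \<gamma>'" and ae: "AE \<xi> in lborel. \<gamma> \<xi> = \<gamma>' \<xi>"
    and cont: "continuous_on UNIV h" "continuous_on UNIV h'"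
  shows "h = h'"
proof -
  have eq: "(LINT x|lborel. h x * fourier \<phi> x) = (LINT x|lborel. h' x * fourier \<phi> x)" if \<phi>: "\<phi> \<in> schwartz" for \<phi>
  proof -
    have "integrable lborel (\<lambda>x. \<gamma> x * \<phi> x)" "integrable lborel (\<lambda>x. \<gamma>' x * \<phi> x)"
      using h h' \<phi> by (auto simp: has_fourier_def tempered_def)
    then have "(LINT x|lborel. \<gamma> x * \<phi> x) = (LINT x|lborel. \<gamma>' x * \<phi> x)"
      using ae by (intro integral_cong_AE) auto
    then show ?thesis using h h' \<phi> by (simp add: has_fourier_def)
  qed
  have "AE x in lborel. h x - h' x = 0"
  proof (rule gaussians_separate)
    fix s :: real and a :: 'a assume s: "s > 0"
    \<comment> \<open>Transforming a Gaussian of rate 1 / (4 s) gives back rate \<open>s\<close>;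
      \<open>c\<close> is its amplitude.\<close>
    define c where "c = sqrt (pi / (1 / (4 * s))) ^ DIM('a)"
    have c: "c \<noteq> 0" using s by (simp add: c_def)
    have s': "1 / (4 * s) > 0" using s by simp
    note S = modulated_gaussian_in_schwartz[OF s', of a]
    have F: "fourier (\<lambda>\<xi>. exp (\<i> * of_real (a \<bullet> \<xi>)) * complex_of_real (exp (- (1 / (4 * s)) * (norm \<xi>)\<^sup>2))) x =
      of_real c * of_real (exp (- s * (norm (x - a))\<^sup>2))" for x
      unfolding fourier_modulated_gaussian[OF s'] c_def using s by (simp add: mult.commute)
    have i: "integrable lborel (\<lambda>x. h x * of_real (exp (- s * (norm (x - a))\<^sup>2)))"
      "integrable lborel (\<lambda>x. h' x * of_real (exp (- s * (norm (x - a))\<^sup>2)))"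
      using h h' translated_gaussian_in_schwartz[OF s, of a] by (auto simp: has_fourier_def tempered_def)
    show "integrable lborel (\<lambda>x. (h x - h' x) * of_real (exp (- s * (norm (x - a))\<^sup>2)))"
      unfolding left_diff_distrib using i by (rule Bochner_Integration.integrable_diff)
    show "(LINT x|lborel. (h x - h' x) * of_real (exp (- s * (norm (x - a))\<^sup>2))) = 0"
      unfolding left_diff_distrib Bochner_Integration.integral_diff[OF i]
      using eq[OF S] c unfolding F by (simp add: mult.left_commute[of _ "of_real c"])
  qed
  then show ?thesis
    using continuous_AE_zero[of "\<lambda>x. h x - h' x"] cont by (auto intro!: continuous_intros)
qed

section \<open>Distributional transforms of inverse Fourier integrals\<close>

lemma tempered_bounded:
  assumes "g \<in> borel_measurable borel" "\<And>x. norm (g x) \<le> C"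
  shows "tempered g"
  unfolding tempered_def
proof
  fix \<phi> :: "'a \<Rightarrow> complex" assume \<phi>: "\<phi> \<in> schwartz"
  show "integrable lborel (\<lambda>x. g x * \<phi> x)"
  proof (rule Bochner_Integration.integrable_bound[OF integrable_mult_right[OF integrable_norm[OF integrable_schwartz[OF \<phi>]], of C]])
    show "AE x in lborel. norm (g x * \<phi> x) \<le> norm (C * norm (\<phi> x))"
      using assms(2) order.trans[OF norm_ge_zero assms(2)]
      by (auto simp: norm_mult abs_mult intro!: mult_right_mono)
  qed (use assms(1) schwartz_measurable[OF \<phi>] in measurable)
qed

lemma tempered_integrable:
  assumes "integrable lborel \<gamma>"
  shows "tempered \<gamma>"
  unfolding tempered_def
proof
  fix \<phi> :: "'a \<Rightarrow> complex" assume \<phi>: "\<phi> \<in> schwartz"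
  obtain C where C: "\<And>x. norm (\<phi> x) \<le> C" using schwartz_bounded[OF \<phi>] by blast
  show "integrable lborel (\<lambda>x. \<gamma> x * \<phi> x)"
  proof (rule Bochner_Integration.integrable_bound[OF integrable_mult_left[OF integrable_norm[OF assms], of C]])
    show "AE x in lborel. norm (\<gamma> x * \<phi> x) \<le> norm (norm (\<gamma> x) * C)"
      using C order.trans[OF norm_ge_zero C]
      by (auto simp: norm_mult abs_mult intro!: mult_left_mono)
  qed (use assms schwartz_measurable[OF \<phi>] in measurable)
qed

lemma continuous_inverse_fourier:
  assumes "integrable lborel \<gamma>"
  shows "continuous_on UNIV (inverse_fourier \<gamma>)"
  unfolding inverse_fourier_def
  by (intro continuous_intros continuous_on_compose2[OF continuous_fourier[OF assms], of UNIV uminus]) auto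

lemma integral_reflect:
  fixes g :: "'a::euclidean_space \<Rightarrow> complex"
  assumes "integrable lborel g"
  shows "(LINT x|lborel. g (- x)) = (LINT x|lborel. g x)"
  using integral_lborel_affine[OF assms, of "-1" 0] by simp

text \<open>For merely integrable \<gamma> the inverse transform is bounded and continuous but
  perhaps not integrable, so the statement is distributional. The multiplication formula shifts the
  transform to the reflected \<open>fourier \<phi>\<close>, and inversion is applied to the Schwartz
  function \<phi> instead of \<gamma>.\<close>

lemma has_fourier_inverse_fourier:
  fixes \<gamma> :: "'a::euclidean_space \<Rightarrow> complex"
  assumes \<gamma>: "integrable lborel \<gamma>"
  shows "has_fourier (inverse_fourier \<gamma>) \<gamma>"
  unfolding has_fourier_def
proof (intro conjI ballI)
  show "tempered \<gamma>" by (rule tempered_integrable[OF \<gamma>])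
  show "tempered (inverse_fourier \<gamma>)"
  proof (rule tempered_bounded)
    show "inverse_fourier \<gamma> \<in> borel_measurable borel"
      by (intro borel_measurable_continuous_onI continuous_inverse_fourier \<gamma>)
    show "norm (inverse_fourier \<gamma> x) \<le> (LINT x|lborel. norm (\<gamma> x)) / (2 * pi) ^ DIM('a)" for x
      unfolding inverse_fourier_def using norm_fourier_le[of \<gamma> "- x"]
      by (simp add: norm_divide norm_power norm_mult divide_right_mono)
  qed
  fix \<phi> :: "'a \<Rightarrow> complex" assume \<phi>: "\<phi> \<in> schwartz"
  define c where "c = complex_of_real ((2 * pi) ^ DIM('a))"
  have c: "c \<noteq> 0" by (simp add: c_def)
  have i: "integrable lborel (\<lambda>x. fourier \<phi> (- x))"
    using integrable_lborel_affine[OF integrable_fourier_schwartz[OF \<phi>], of "-1" 0] by simp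
  have ii: "integrable lborel (\<lambda>x. fourier \<gamma> x * fourier \<phi> (- x))"
  proof (rule Bochner_Integration.integrable_bound[OF integrable_mult_right[OF integrable_norm[OF i], of "LINT x|lborel. norm (\<gamma> x)"]])
    show "AE x in lborel. norm (fourier \<gamma> x * fourier \<phi> (- x)) \<le> norm ((LINT x|lborel. norm (\<gamma> x)) * norm (fourier \<phi> (- x)))"
      using norm_fourier_le[of \<gamma>] by (auto simp: norm_mult abs_mult intro!: mult_right_mono order.trans[OF _ abs_ge_self])
    have [measurable]: "fourier \<gamma> \<in> borel_measurable borel" "fourier \<phi> \<in> borel_measurable borel"
      by (intro borel_measurable_continuous_onI continuous_fourier \<gamma> integrable_schwartz \<phi>)+
    show "(\<lambda>x. fourier \<gamma> x * fourier \<phi> (- x)) \<in> borel_measurable lborel" by measurable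
  qed
  have inv: "fourier (\<lambda>x. fourier \<phi> (- x)) x = c * \<phi> x" for x
  proof -
    have "fourier (\<lambda>x. fourier \<phi> (- x)) x = fourier (fourier \<phi>) (- x)"
      using integral_reflect[OF integrable_fourier[OF integrable_fourier_schwartz[OF \<phi>], of "- x"]]
      by (simp add: fourier_def)
    also have "\<dots> = c * inverse_fourier (fourier \<phi>) x" using c unfolding inverse_fourier_def c_def[symmetric] by simp
    finally show ?thesis by (simp only: fourier_inversion_schwartz[OF \<phi>])
  qed
  have "(LINT x|lborel. inverse_fourier \<gamma> x * fourier \<phi> x) = (LINT x|lborel. fourier \<gamma> (- x) * fourier \<phi> (- (- x))) / c"
    unfolding inverse_fourier_def c_def[symmetric] by simp
  also have "\<dots> = (LINT x|lborel. fourier \<gamma> x * fourier \<phi> (- x)) / c"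
    by (subst integral_reflect[OF ii]) simp
  also have "\<dots> = (LINT x|lborel. \<gamma> x * fourier (\<lambda>x. fourier \<phi> (- x)) x) / c"
    by (subst fourier_multiplication[OF \<gamma> i]) simp
  also have "\<dots> = (LINT \<xi>|lborel. \<gamma> \<xi> * \<phi> \<xi>)"
    unfolding inv using c by (simp add: mult.left_commute[of _ c])
  finally show "(LINT x|lborel. inverse_fourier \<gamma> x * fourier \<phi> x) = (LINT \<xi>|lborel. \<gamma> \<xi> * \<phi> \<xi>)" .
qed

text \<open>\<open>THE\<close> demands existence and uniqueness. Any competing transform of the
  given function agrees with \<gamma> almost everywhere; so do the multiplied transforms, and the
  continuous function they represent is unique.\<close>

lemma riesz_inverse_fourier:
  fixes \<gamma> :: "'a::euclidean_space \<Rightarrow> complex"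
  assumes \<gamma>: "integrable lborel \<gamma>"
    and k\<gamma>: "integrable lborel (\<lambda>\<xi>. of_real (norm \<xi> powr (- k)) * \<gamma> \<xi>)"
  shows "riesz k (inverse_fourier \<gamma>) = inverse_fourier (\<lambda>\<xi>. of_real (norm \<xi> powr (- k)) * \<gamma> \<xi>)"
  unfolding riesz_def
proof (rule the_equality)
  show "continuous_on UNIV (inverse_fourier (\<lambda>\<xi>. of_real (norm \<xi> powr (- k)) * \<gamma> \<xi>)) \<and>
    (\<exists>\<gamma>'. has_fourier (inverse_fourier \<gamma>) \<gamma>' \<and>
       has_fourier (inverse_fourier (\<lambda>\<xi>. of_real (norm \<xi> powr (- k)) * \<gamma> \<xi>)) (\<lambda>\<xi>. of_real (norm \<xi> powr (- k)) * \<gamma>' \<xi>))"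
    using continuous_inverse_fourier[OF k\<gamma>] has_fourier_inverse_fourier[OF \<gamma>] has_fourier_inverse_fourier[OF k\<gamma>] by blast
next
  fix h assume "continuous_on UNIV h \<and> (\<exists>\<gamma>'. has_fourier (inverse_fourier \<gamma>) \<gamma>' \<and> has_fourier h (\<lambda>\<xi>. of_real (norm \<xi> powr (- k)) * \<gamma>' \<xi>))"
  then obtain \<gamma>' where h: "continuous_on UNIV h" "has_fourier (inverse_fourier \<gamma>) \<gamma>'"
    "has_fourier h (\<lambda>\<xi>. of_real (norm \<xi> powr (- k)) * \<gamma>' \<xi>)" by blast
  have "AE \<xi> in lborel. \<gamma>' \<xi> = \<gamma> \<xi>"
    by (rule has_fourier_unique_transform[OF h(2) has_fourier_inverse_fourier[OF \<gamma>]])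
  then have "AE \<xi> in lborel. of_real (norm \<xi> powr (- k)) * \<gamma>' \<xi> = of_real (norm \<xi> powr (- k)) * \<gamma> \<xi>"
    by eventually_elim simp
  from has_fourier_unique_continuous[OF h(3) has_fourier_inverse_fourier[OF k\<gamma>] this h(1) continuous_inverse_fourier[OF k\<gamma>]]
  show "h = inverse_fourier (\<lambda>\<xi>. of_real (norm \<xi> powr (- k)) * \<gamma> \<xi>)" .
qed

subsection \<open>Orthogonal transformations and polar coordinates\<close>

text \<open>Both sides, multiplied by the volume of the unit ball, are the double integral of
  \<open>g (U x + z)\<close> over all \<open>x\<close> and all \<open>z\<close> in the unit ball.\<close>

lemma nn_integral_orthogonal_transformation:
  fixes g :: "'a::euclidean_space \<Rightarrow> ennreal" and U :: "'a \<Rightarrow> 'a"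
  assumes U: "orthogonal_transformation U" and [measurable]: "g \<in> borel_measurable borel"
  shows "(\<integral>\<^sup>+x. g (U x) \<partial>lborel) = (\<integral>\<^sup>+x. g x \<partial>lborel)"
proof -
  define V where "V = inv U"
  have V: "orthogonal_transformation V"
    unfolding V_def by (rule orthogonal_transformation_inv[OF U])
  have UV: "U (V x) = x" "V (U x) = x" for x
    using orthogonal_transformation_bij[OF U] by (simp_all add: V_def bij_is_surj bij_is_inj surj_f_inv_f inv_f_f)
  have lin: "U (x + y) = U x + U y" "U (x - y) = U x - U y" for x y
    using orthogonal_transformation_linear[OF U] by (auto simp: linear_add linear_diff)
  have U_borel: "U \<in> borel_measurable borel"
    using orthogonal_transformation_linear[OF U]
    by (intro borel_measurable_continuous_onI linear_continuous_on) (simp add: linear_conv_bounded_linear)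
  note [measurable] = U_borel
  have [measurable]: "ball (0::'a) 1 \<in> sets borel" "cball (0::'a) 1 \<in> sets borel" "{0::'a} \<in> sets borel" by auto
  define h where "h z = (indicator (ball 0 1) z :: ennreal)" for z :: 'a
  have [measurable]: "h \<in> borel_measurable borel" unfolding h_def by measurable
  let ?k = "emeasure lborel (ball (0::'a) 1)"
  have hint: "(\<integral>\<^sup>+z. h z \<partial>lborel) = ?k" by (simp add: h_def)
  have k: "?k \<noteq> 0" "?k \<noteq> \<infinity>"
  proof -
    show "?k \<noteq> 0"
      using open_not_negligible[of "ball (0::'a) 1"] by (auto simp: negligible_iff_null_sets null_sets_completion_iff null_sets_def)
    show "?k \<noteq> \<infinity>" using emeasure_lborel_ball_finite[of "0::'a" 1] by simp
  qed
  have "?k * (\<integral>\<^sup>+x. g (U x) \<partial>lborel) = (\<integral>\<^sup>+z. h z * (\<integral>\<^sup>+x. g (U x) \<partial>lborel) \<partial>lborel)"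
    by (simp add: nn_integral_multc hint)
  also have "\<dots> = (\<integral>\<^sup>+z. (\<integral>\<^sup>+x. h z * g (U x + z) \<partial>lborel) \<partial>lborel)"
  proof (rule nn_integral_cong)
    fix z :: 'a
    have "(\<integral>\<^sup>+x. g (U x) \<partial>lborel) = (\<integral>\<^sup>+x. g (U (V z + x)) \<partial>lborel)"
      using nn_integral_lborel_affine[of "\<lambda>x. g (U x)" 1 "V z"] by simp
    also have "\<dots> = (\<integral>\<^sup>+x. g (U x + z) \<partial>lborel)" by (simp add: lin UV add.commute)
    finally show "h z * (\<integral>\<^sup>+x. g (U x) \<partial>lborel) = (\<integral>\<^sup>+x. h z * g (U x + z) \<partial>lborel)"
      by (simp add: nn_integral_cmult)
  qed
  also have "\<dots> = (\<integral>\<^sup>+x. (\<integral>\<^sup>+z. h z * g (U x + z) \<partial>lborel) \<partial>lborel)"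
    by (rule lborel_pair.Fubini') measurable
  also have "\<dots> = (\<integral>\<^sup>+x. (\<integral>\<^sup>+z. h (V z - x) * g z \<partial>lborel) \<partial>lborel)"
  proof (rule nn_integral_cong)
    fix x :: 'a
    \<comment> \<open>Invariance of the unit ball: |z - U x| = |U (V z - x)| = |V z - x|. This moves
      \<open>U\<close> off \<open>x\<close>, so that the integral over \<open>x\<close> becomes a
      plain translate and reflection of the ball.\<close>
    have h: "h (z - U x) = h (V z - x)" for z
    proof -
      have "norm (z - U x) = norm (U (V z - x))" by (simp add: lin UV add.commute)
      then show ?thesis using orthogonal_transformation_norm[OF U] by (simp add: h_def indicator_def)
    qed
    show "(\<integral>\<^sup>+z. h z * g (U x + z) \<partial>lborel) = (\<integral>\<^sup>+z. h (V z - x) * g z \<partial>lborel)"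
      using nn_integral_lborel_affine[of "\<lambda>z. h z * g (U x + z)" 1 "- U x"] by (simp add: h)
  qed
  also have "\<dots> = (\<integral>\<^sup>+z. (\<integral>\<^sup>+x. h (V z - x) * g z \<partial>lborel) \<partial>lborel)"
  proof (rule lborel_pair.Fubini')
    have "V \<in> borel_measurable borel"
      using orthogonal_transformation_linear[OF V]
      by (intro borel_measurable_continuous_onI linear_continuous_on) (simp add: linear_conv_bounded_linear)
    note [measurable] = this
    show "(\<lambda>(x, y). h (V x - y) * g x) \<in> borel_measurable (lborel \<Otimes>\<^sub>M lborel)" by measurable
  qed
  also have "\<dots> = (\<integral>\<^sup>+z. ?k * g z \<partial>lborel)"
  proof (rule nn_integral_cong)
    fix z :: 'a
    have "(\<integral>\<^sup>+x. h (V z - x) \<partial>lborel) = ?k"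
      using nn_integral_lborel_affine[of h "-1" "V z"] by (simp add: hint)
    then show "(\<integral>\<^sup>+x. h (V z - x) * g z \<partial>lborel) = ?k * g z" by (simp add: nn_integral_multc)
  qed
  also have "\<dots> = ?k * (\<integral>\<^sup>+z. g z \<partial>lborel)" by (simp add: nn_integral_cmult)
  finally show ?thesis using k by (simp add: ennreal_mult_cancel_left)
qed

lemma distr_orthogonal_transformation:
  fixes U :: "'a::euclidean_space \<Rightarrow> 'a"
  assumes U: "orthogonal_transformation U"
  shows "distr lborel borel U = lborel"
proof (rule measure_eqI)
  have [measurable]: "U \<in> borel_measurable borel"
    using orthogonal_transformation_linear[OF U]
    by (intro borel_measurable_continuous_onI linear_continuous_on) (simp add: linear_conv_bounded_linear)
  fix A assume "A \<in> sets (distr lborel borel U)"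
  then have [measurable]: "A \<in> sets borel" by simp
  have "emeasure (distr lborel borel U) A = (\<integral>\<^sup>+x. indicator A x \<partial>distr lborel borel U)"
    by (rule nn_integral_indicator[symmetric]) simp
  also have "\<dots> = (\<integral>\<^sup>+x. indicator A (U x) \<partial>lborel)"
    by (rule nn_integral_distr) measurable
  also have "\<dots> = emeasure lborel A"
    by (subst nn_integral_orthogonal_transformation[OF U]) simp_all
  finally show "emeasure (distr lborel borel U) A = emeasure lborel A" .
qed simp

lemma integral_orthogonal_transformation:
  fixes g :: "'a::euclidean_space \<Rightarrow> complex" and U :: "'a \<Rightarrow> 'a"
  assumes U: "orthogonal_transformation U" and [measurable]: "g \<in> borel_measurable borel"
  shows "(LINT x|lborel. g (U x)) = (LINT x|lborel. g x)"
proof -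
  have [measurable]: "U \<in> borel_measurable borel"
    using orthogonal_transformation_linear[OF U]
    by (intro borel_measurable_continuous_onI linear_continuous_on) (simp add: linear_conv_bounded_linear)
  have "(LINT x|lborel. g (U x)) = (LINT x|distr lborel borel U. g x)"
    by (simp add: integral_distr)
  then show ?thesis by (simp add: distr_orthogonal_transformation[OF U])
qed

text \<open>The integral over scales left at the end of the polar coordinate computation; its value
  supplies the 1 / d that the normalisation of the sphere measure cancels.\<close>

lemma nn_integral_inverse_power:
  assumes r: "r > 0" and d: "d > 0"
  shows "(\<integral>\<^sup>+w. ennreal (1 / w ^ (d + 1)) * indicator {r<..} w \<partial>lborel) = ennreal (1 / (real d * r ^ d))"
proof -
  have "(\<integral>\<^sup>+w. ennreal (1 / w ^ (d + 1)) * indicator {r<..} w \<partial>lborel) = (\<integral>\<^sup>+w. ennreal (1 / w ^ (d + 1)) * indicator {r..} w \<partial>lborel)"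
    by (intro nn_integral_cong_AE) (use AE_lborel_singleton[of r] in \<open>eventually_elim, auto simp: indicator_def\<close>)
  also have "\<dots> = ennreal (0 - (- 1 / (real d * r ^ d)))"
  proof (rule nn_integral_FTC_atLeast)
    show "((\<lambda>w. - 1 / (real d * w ^ d)) has_real_derivative 1 / x ^ (d + 1)) (at x)" if "r \<le> x" for x
    proof -
      have "x ^ d = x ^ (d - 1) * x" using d by (metis power_minus_mult)
      then show ?thesis using that r d
        by (auto intro!: derivative_eq_intros simp: divide_simps power2_eq_square)
    qed
    show "((\<lambda>w. - 1 / (real d * w ^ d)) \<longlongrightarrow> 0) at_top"
      using d by (intro tendsto_divide_0[OF tendsto_const] filterlim_at_top_imp_at_infinity
          filterlim_tendsto_pos_mult_at_top[OF tendsto_const] filterlim_pow_at_top) (auto simp: filterlim_ident)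
    show "0 \<le> 1 / x ^ (d + 1)" if "r \<le> x" for x using that r by simp
  qed simp
  finally show ?thesis by simp
qed

text \<open>Polar coordinates, with the sphere replaced by the punctured unit ball: the substitution
  \<open>z = norm x * w\<close> and Fubini reduce the right-hand side to integrals over balls.\<close>

lemma nn_integral_polar:
  fixes g :: "'a::euclidean_space \<Rightarrow> ennreal"
  assumes [measurable]: "g \<in> borel_measurable borel"
  shows "(\<integral>\<^sup>+y. g y \<partial>lborel) = of_nat DIM('a) *
    (\<integral>\<^sup>+x. (\<integral>\<^sup>+z. g (z *\<^sub>R sgn x) * ennreal (z ^ (DIM('a) - 1)) * indicator {0<..} z \<partial>lborel) * indicator (ball 0 1 - {0}) x \<partial>lborel)"
proof -
  let ?d = "DIM('a)"
  let ?K = "\<lambda>w x. g (w *\<^sub>R x) * ennreal (w ^ (?d - 1) * norm x ^ ?d) * indicator {0<..} w * indicator (ball 0 1 - {0}) (x::'a)"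
  have [measurable]: "ball (0::'a) 1 \<in> sets borel" "cball (0::'a) 1 \<in> sets borel" "{0::'a} \<in> sets borel" by auto
  have [measurable]: "(sgn :: 'a \<Rightarrow> 'a) \<in> borel_measurable borel"
    unfolding sgn_div_norm[abs_def] by measurable
  have "(\<integral>\<^sup>+x. (\<integral>\<^sup>+z. g (z *\<^sub>R sgn x) * ennreal (z ^ (?d - 1)) * indicator {0<..} z \<partial>lborel) * indicator (ball 0 1 - {0}) x \<partial>lborel)
    = (\<integral>\<^sup>+x. (\<integral>\<^sup>+w. ?K w x \<partial>lborel) \<partial>lborel)"
  proof (rule nn_integral_cong)
    fix x :: 'a
    show "(\<integral>\<^sup>+z. g (z *\<^sub>R sgn x) * ennreal (z ^ (?d - 1)) * indicator {0<..} z \<partial>lborel) * indicator (ball 0 1 - {0}) x = (\<integral>\<^sup>+w. ?K w x \<partial>lborel)"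
    proof (cases "x = 0")
      case False
      then have n: "norm x > 0" by simp
      have "(\<integral>\<^sup>+z. g (z *\<^sub>R sgn x) * ennreal (z ^ (?d - 1)) * indicator {0<..} z \<partial>lborel)
        = ennreal (norm x) * (\<integral>\<^sup>+w. g ((norm x * w) *\<^sub>R sgn x) * ennreal ((norm x * w) ^ (?d - 1)) * indicator {0<..} (norm x * w) \<partial>lborel)"
        using nn_integral_lborel_affine[of "\<lambda>z::real. g (z *\<^sub>R sgn x) * ennreal (z ^ (?d - 1)) * indicator {0<..} z" "norm x" 0] n by simp
      also have "\<dots> = (\<integral>\<^sup>+w. g (w *\<^sub>R x) * ennreal (w ^ (?d - 1) * norm x ^ ?d) * indicator {0<..} w \<partial>lborel)"
      proof (subst nn_integral_cmult[symmetric], measurable, intro nn_integral_cong)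
        fix w :: real
        have "norm x * (norm x * w) ^ (?d - 1) = w ^ (?d - 1) * norm x ^ ?d"
          by (simp add: power_mult_distrib power_eq_if[of "norm x" "?d"])
        then have e: "ennreal (norm x) * ennreal ((norm x * w) ^ (?d - 1)) = ennreal (w ^ (?d - 1) * norm x ^ ?d)"
          by (subst ennreal_mult'[symmetric]) simp_all
        have sc: "(norm x * w) *\<^sub>R sgn x = w *\<^sub>R x" using n by (simp add: sgn_div_norm)
        have ind: "indicator {0<..} (norm x * w) = (indicator {0<..} w :: ennreal)"
          using n by (simp add: indicator_def zero_less_mult_iff)
        have "ennreal (norm x) * (g ((norm x * w) *\<^sub>R sgn x) * ennreal ((norm x * w) ^ (?d - 1)) * indicator {0<..} (norm x * w))
          = g (w *\<^sub>R x) * (ennreal (norm x) * ennreal ((norm x * w) ^ (?d - 1))) * indicator {0<..} w"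
          unfolding sc ind by (simp only: mult_ac)
        then show "ennreal (norm x) * (g ((norm x * w) *\<^sub>R sgn x) * ennreal ((norm x * w) ^ (?d - 1)) * indicator {0<..} (norm x * w))
          = g (w *\<^sub>R x) * ennreal (w ^ (?d - 1) * norm x ^ ?d) * indicator {0<..} w"
          by (simp only: e)
      qed
      finally show ?thesis by (simp add: nn_integral_multc)
    qed simp
  qed
  also have "\<dots> = (\<integral>\<^sup>+w. (\<integral>\<^sup>+x. ?K w x \<partial>lborel) \<partial>lborel)"
    by (rule lborel_pair.Fubini') measurable
  \<comment> \<open>Now y = w x at fixed scale \<open>w\<close>: the unit ball becomes |y| < w, and
    the powers w^(d-1), w^(-d) from |x|^d = |y|^d / w^d, and w^(-d) from the Jacobian combine to 1 /
    w^(d+1).\<close>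
  also have "\<dots> = (\<integral>\<^sup>+w. (\<integral>\<^sup>+y. g y * ennreal (norm y ^ ?d) * (ennreal (1 / w ^ (?d + 1)) * indicator {norm y<..} w) * indicator (- {0}) y \<partial>lborel) \<partial>lborel)"
  proof (rule nn_integral_cong)
    fix w :: real
    show "(\<integral>\<^sup>+x. ?K w x \<partial>lborel) = (\<integral>\<^sup>+y. g y * ennreal (norm y ^ ?d) * (ennreal (1 / w ^ (?d + 1)) * indicator {norm y<..} w) * indicator (- {0}) y \<partial>lborel)"
    proof (cases "w > 0")
      case True
      have "(\<lambda>y::'a. indicator {norm y<..} w :: ennreal) = indicator (ball 0 w)"
        by (auto simp: indicator_def fun_eq_iff)
      then have [measurable]: "(\<lambda>y::'a. indicator {norm y<..} w :: ennreal) \<in> borel_measurable borel"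
        by (simp only:) (intro borel_measurable_indicator borel_open open_ball)
      have "(\<integral>\<^sup>+y. g y * ennreal (norm y ^ ?d) * (ennreal (1 / w ^ (?d + 1)) * indicator {norm y<..} w) * indicator (- {0}) y \<partial>lborel)
        = ennreal (w ^ ?d) * (\<integral>\<^sup>+x. g (w *\<^sub>R x) * ennreal (norm (w *\<^sub>R x) ^ ?d) * (ennreal (1 / w ^ (?d + 1)) * indicator {norm (w *\<^sub>R x)<..} w) * indicator (- {0}) (w *\<^sub>R x) \<partial>lborel)"
        using nn_integral_lborel_affine[of "\<lambda>y::'a. g y * ennreal (norm y ^ ?d) * (ennreal (1 / w ^ (?d + 1)) * indicator {norm y<..} w) * indicator (- {0}) y" w 0] True by simp
      also have "\<dots> = (\<integral>\<^sup>+x. ?K w x \<partial>lborel)"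
      proof (subst nn_integral_cmult[symmetric], measurable, intro nn_integral_cong)
        fix x :: 'a
        have e: "w ^ ?d * (norm (w *\<^sub>R x) ^ ?d * (1 / w ^ (?d + 1))) = w ^ (?d - 1) * norm x ^ ?d"
          using True by (simp add: power_mult_distrib power_eq_if[of w "?d"])
        have e2: "ennreal (w ^ ?d) * (ennreal (norm (w *\<^sub>R x) ^ ?d) * ennreal (1 / w ^ (?d + 1))) = ennreal (w ^ (?d - 1) * norm x ^ ?d)"
          unfolding e[symmetric] using True by (simp add: ennreal_mult'[symmetric] del: power_Suc)
        have ind: "indicator {norm (w *\<^sub>R x)<..} w * indicator (- {0}) (w *\<^sub>R x) = (indicator {0<..} w * indicator (ball 0 1 - {0}) x :: ennreal)"
          using True by (auto simp: indicator_def)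
        have "ennreal (w ^ ?d) * (g (w *\<^sub>R x) * ennreal (norm (w *\<^sub>R x) ^ ?d) * (ennreal (1 / w ^ (?d + 1)) * indicator {norm (w *\<^sub>R x)<..} w) * indicator (- {0}) (w *\<^sub>R x))
          = g (w *\<^sub>R x) * (ennreal (w ^ ?d) * (ennreal (norm (w *\<^sub>R x) ^ ?d) * ennreal (1 / w ^ (?d + 1)))) * (indicator {norm (w *\<^sub>R x)<..} w * indicator (- {0}) (w *\<^sub>R x))"
          by (simp only: mult_ac)
        then show "ennreal (w ^ ?d) * (g (w *\<^sub>R x) * ennreal (norm (w *\<^sub>R x) ^ ?d) * (ennreal (1 / w ^ (?d + 1)) * indicator {norm (w *\<^sub>R x)<..} w) * indicator (- {0}) (w *\<^sub>R x)) = ?K w x"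
          by (simp only: e2 ind mult.assoc)
      qed
      finally show ?thesis ..
    next
      case False
      then have "\<not> norm y < w" for y :: 'a using norm_ge_zero[of y] by linarith
      then show ?thesis using False by (simp add: indicator_def)
    qed
  qed
  also have "\<dots> = (\<integral>\<^sup>+y. (\<integral>\<^sup>+w. g y * ennreal (norm y ^ ?d) * (ennreal (1 / w ^ (?d + 1)) * indicator {norm y<..} w) * indicator (- {0}) y \<partial>lborel) \<partial>lborel)"
  proof (rule lborel_pair.Fubini')
    have "(\<lambda>p::'a \<times> real. indicator {norm (fst p)<..} (snd p)) = (indicator {p. norm (fst p) < snd p} :: _ \<Rightarrow> ennreal)"
      by (auto simp: indicator_def fun_eq_iff)
    moreover have "{p::'a \<times> real. norm (fst p) < snd p} \<in> sets (borel \<Otimes>\<^sub>M borel)"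
      unfolding borel_prod by (intro borel_open open_Collect_less continuous_intros)
    ultimately have [measurable]: "(\<lambda>p::'a \<times> real. indicator {norm (fst p)<..} (snd p) :: ennreal) \<in> borel_measurable (borel \<Otimes>\<^sub>M borel)"
      by simp
    show "(\<lambda>(y, w). g y * ennreal (norm y ^ ?d) * (ennreal (1 / w ^ (?d + 1)) * indicator {norm y<..} w) * indicator (- {0}) y) \<in> borel_measurable (lborel \<Otimes>\<^sub>M lborel)"
      unfolding case_prod_unfold by measurable
  qed
  \<comment> \<open>The scale integral over w > |y| is 1 / (d |y|^d), which cancels the factor |y|^d
    for y \<noteq> 0.\<close>
  also have "\<dots> = (\<integral>\<^sup>+y. g y * ennreal (1 / ?d) \<partial>lborel)"
  proof (rule nn_integral_cong_AE, rule eventually_mono[OF AE_lborel_singleton[of 0]])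
    fix y :: 'a assume y: "y \<noteq> 0"
    have "(\<integral>\<^sup>+w. g y * ennreal (norm y ^ ?d) * (ennreal (1 / w ^ (?d + 1)) * indicator {norm y<..} w) * indicator (- {0}) y \<partial>lborel)
      = g y * ennreal (norm y ^ ?d) * (\<integral>\<^sup>+w. ennreal (1 / w ^ (?d + 1)) * indicator {norm y<..} w \<partial>lborel)"
      using y by (simp add: nn_integral_cmult del: power_Suc)
    also have "\<dots> = g y * (ennreal (norm y ^ ?d) * ennreal (1 / (real ?d * norm y ^ ?d)))"
      using y by (subst nn_integral_inverse_power) (auto simp: mult.assoc)
    also have "ennreal (norm y ^ ?d) * ennreal (1 / (real ?d * norm y ^ ?d)) = ennreal (1 / ?d)"
      using y by (subst ennreal_mult[symmetric]) auto
    finally show "(\<integral>\<^sup>+w. g y * ennreal (norm y ^ ?d) * (ennreal (1 / w ^ (?d + 1)) * indicator {norm y<..} w) * indicator (- {0}) y \<partial>lborel) = g y * ennreal (1 / ?d)" .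
  qed
  also have "\<dots> = ennreal (1 / ?d) * (\<integral>\<^sup>+y. g y \<partial>lborel)"
    by (simp add: nn_integral_multc mult.commute)
  finally have "of_nat ?d * (\<integral>\<^sup>+x. (\<integral>\<^sup>+z. g (z *\<^sub>R sgn x) * ennreal (z ^ (?d - 1)) * indicator {0<..} z \<partial>lborel) * indicator (ball 0 1 - {0}) x \<partial>lborel)
    = (ennreal (real ?d) * ennreal (1 / ?d)) * (\<integral>\<^sup>+y. g y \<partial>lborel)"
    by (simp only: ennreal_of_nat_eq_real_of_nat mult.assoc)
  also have "ennreal (real ?d) * ennreal (1 / ?d) = 1"
    by (subst ennreal_mult[symmetric]) auto
  finally show ?thesis by simp
qed

text \<open>Near the origin polar coordinates leave z^(p + d - 1) on (0, 1), integrable because p >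
  -d. Away from it the denominator has enough room to absorb |x|^p and still leave (1 +
  |x|)^(-2d).\<close>

lemma integrable_powr_norm_decay:
  assumes p: "p > - real DIM('a::euclidean_space)" and m: "2 * real DIM('a) + p \<le> real m" "2 * DIM('a) \<le> m"
  shows "integrable lborel (\<lambda>x::'a. norm x powr p / (1 + norm x) ^ m)"
proof -
  let ?d = "DIM('a)"
  have [measurable]: "ball (0::'a) 1 \<in> sets borel" "cball (0::'a) 1 \<in> sets borel" "{0::'a} \<in> sets borel" by auto
  have pw: "((\<lambda>x. x powr (p + (real ?d - 1))) has_integral (1 / (p + real ?d))) {0..1}"
    using has_integral_powr_from_0[of "p + (real ?d - 1)" 1] p by (simp add: algebra_simps)
  have J: "(\<integral>\<^sup>+z. ennreal (z powr (p + (real ?d - 1)) * indicator {0..1} z) \<partial>lborel) = ennreal (1 / (p + real ?d))"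
  proof (rule nn_integral_has_integral_lborel)
    have "(\<lambda>z. z powr (p + (real ?d - 1)) * indicator {0..1} z) = (\<lambda>z. if z \<in> {0..1} then z powr (p + (real ?d - 1)) else 0)"
      by (auto simp: indicator_def)
    then show "((\<lambda>z. z powr (p + (real ?d - 1)) * indicator {0..1} z) has_integral (1 / (p + real ?d))) UNIV"
      using pw by (simp only: has_integral_restrict_UNIV)
  qed simp_all
  have "(\<integral>\<^sup>+x. ennreal (norm x powr p * indicator (cball (0::'a) 1) x) \<partial>lborel) < \<infinity>"
  proof -
    have "(\<integral>\<^sup>+x. ennreal (norm x powr p * indicator (cball (0::'a) 1) x) \<partial>lborel) = of_nat ?d *
      (\<integral>\<^sup>+x. (\<integral>\<^sup>+z. ennreal (norm (z *\<^sub>R sgn x :: 'a) powr p * indicator (cball 0 1) (z *\<^sub>R sgn x)) * ennreal (z ^ (?d - 1)) * indicator {0<..} z \<partial>lborel) * indicator (ball 0 1 - {0}) x \<partial>lborel)"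
      by (rule nn_integral_polar) measurable
    \<comment> \<open>In every direction the radial integral is at most the integral of z^(p + d -
      1) over the unit interval, that is 1 / (p + d).\<close>
    also have "\<dots> \<le> of_nat ?d * (\<integral>\<^sup>+x. ennreal (1 / (p + real ?d)) * indicator (ball (0::'a) 1) x \<partial>lborel)"
    proof (intro mult_left_mono nn_integral_mono)
      fix x :: 'a
      show "(\<integral>\<^sup>+z. ennreal (norm (z *\<^sub>R sgn x) powr p * indicator (cball 0 1) (z *\<^sub>R sgn x)) * ennreal (z ^ (?d - 1)) * indicator {0<..} z \<partial>lborel) * indicator (ball 0 1 - {0}) x
        \<le> ennreal (1 / (p + real ?d)) * indicator (ball 0 1) x"
      proof (cases "x \<in> ball 0 1 - {0}")
        case True
        have "(\<integral>\<^sup>+z. ennreal (norm (z *\<^sub>R sgn x) powr p * indicator (cball 0 1) (z *\<^sub>R sgn x)) * ennreal (z ^ (?d - 1)) * indicator {0<..} z \<partial>lborel)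
          \<le> (\<integral>\<^sup>+z. ennreal (z powr (p + (real ?d - 1)) * indicator {0..1} z) \<partial>lborel)"
        proof (intro nn_integral_mono)
          fix z :: real
          show "ennreal (norm (z *\<^sub>R sgn x) powr p * indicator (cball 0 1) (z *\<^sub>R sgn x)) * ennreal (z ^ (?d - 1)) * indicator {0<..} z
             \<le> ennreal (z powr (p + (real ?d - 1)) * indicator {0..1} z)"
          proof (cases "0 < z")
            case z: True
            have "z ^ (?d - 1) = z powr (real ?d - 1)"
              using z by (subst powr_realpow[symmetric]) (auto simp: of_nat_diff Suc_leI)
            then show ?thesis
              using z True by (auto simp: norm_sgn indicator_def powr_add ennreal_mult[symmetric])
          qed simp
        qed
        then show ?thesis using True J by simp
      qed simp
    qed simp
    also have "\<dots> = of_nat ?d * (ennreal (1 / (p + real ?d)) * emeasure lborel (ball (0::'a) 1))"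
      by (simp add: nn_integral_cmult)
    also have "\<dots> < \<infinity>"
      using emeasure_lborel_ball_finite[of "0::'a" 1] by (auto simp: ennreal_mult_less_top ennreal_of_nat_eq_real_of_nat)
    finally show ?thesis .
  qed
  then have 1: "integrable lborel (\<lambda>x::'a. norm x powr p * indicator (cball 0 1) x)"
    by (intro integrableI_bounded) (auto simp: abs_mult)
  show ?thesis
  proof (rule Bochner_Integration.integrable_bound[OF Bochner_Integration.integrable_add[OF 1 integrable_inverse_power_norm[of "2 * ?d"]]])
    show "AE x::'a in lborel. norm (norm x powr p / (1 + norm x) ^ m) \<le> norm (norm x powr p * indicator (cball 0 1) x + 1 / (1 + norm x) ^ (2 * ?d))"
    proof (rule AE_I2)
      fix x :: 'a
      have "norm x powr p / (1 + norm x) ^ m \<le> norm x powr p * indicator (cball 0 1) x + 1 / (1 + norm x) ^ (2 * ?d)"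
      proof (cases "norm x \<le> 1")
        case True
        have "norm x powr p / (1 + norm x) ^ m \<le> norm x powr p / 1"
          by (intro divide_left_mono) (auto simp: add_pos_nonneg)
        then show ?thesis using True by (simp add: add_increasing2)
      next
        case False
        \<comment> \<open>The exponent m - 2d is nonnegative and at least \<open>p\<close>, which
          settles both signs of \<open>p\<close>.\<close>
        have "norm x powr p \<le> (1 + norm x) powr (real m - 2 * real ?d)"
        proof (cases "p \<ge> 0")
          case True
          have "norm x powr p \<le> (1 + norm x) powr p" using True by (intro powr_mono2) auto
          also have "\<dots> \<le> (1 + norm x) powr (real m - 2 * real ?d)" using m by (intro powr_mono) auto
          finally show ?thesis .
        next
          case p: False
          have "norm x powr p \<le> norm x powr 0" using False p by (intro powr_mono) auto
          also have "\<dots> = 1" using False by auto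
          also have "1 \<le> (1 + norm x) powr (real m - 2 * real ?d)" using m(2)
            by (intro ge_one_powr_ge_zero) auto
          finally show ?thesis .
        qed
        also have "\<dots> = (1 + norm x) ^ (m - 2 * ?d)"
          using m(2) by (subst powr_realpow[symmetric]) (auto simp: of_nat_diff add_pos_nonneg)
        finally have "norm x powr p / (1 + norm x) ^ m \<le> (1 + norm x) ^ (m - 2 * ?d) / (1 + norm x) ^ m"
          by (intro divide_right_mono) auto
        also have "\<dots> = 1 / (1 + norm x) ^ (2 * ?d)"
        proof -
          have "(1 + norm x) ^ m = (1 + norm x) ^ (m - 2 * ?d) * (1 + norm x) ^ (2 * ?d)"
            using m(2) by (simp flip: power_add)
          moreover have "(1 + norm x) \<noteq> 0" using norm_ge_zero[of x] by linarith
          ultimately show ?thesis by simp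
        qed
        finally show ?thesis using False by simp
      qed
      moreover have "0 \<le> norm x powr p * indicator (cball 0 1) x + 1 / (1 + norm x) ^ (2 * ?d)"
        by (intro add_nonneg_nonneg mult_nonneg_nonneg) auto
      ultimately show "norm (norm x powr p / (1 + norm x) ^ m) \<le> norm (norm x powr p * indicator (cball 0 1) x + 1 / (1 + norm x) ^ (2 * ?d))"
        by simp
    qed
  qed simp_all
qed

subsection \<open>Partial Fourier transforms\<close>

text \<open>The function \<open>h\<close> of the overview. It is curried because it is transformed,
  inverted and integrated in one variable at a time.\<close>

definition partial_fourier :: "('a::euclidean_space \<times> 'b::euclidean_space \<Rightarrow> complex) \<Rightarrow> 'a \<Rightarrow> 'b \<Rightarrow> complex" where
  "partial_fourier f \<xi> y = fourier (\<lambda>x. f (x, y)) \<xi>"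

lemma one_plus_norm_Pair_ge:
  "(1 + norm x) ^ k * (1 + norm y) ^ m \<le> (1 + norm (x, y)) ^ (k + m)"
proof -
  have "norm x \<le> norm (x, y)" "norm y \<le> norm (x, y)"
    using norm_fst_le norm_snd_le by auto
  then show ?thesis unfolding power_add
    by (intro mult_mono power_mono) auto
qed

lemma decay_Pair:
  assumes "\<And>z. norm (g z) \<le> C / (1 + norm z) ^ (k + m)"
  shows "norm (g (x, y)) \<le> C / ((1 + norm x) ^ k * (1 + norm y) ^ m)"
proof -
  have C: "C \<ge> 0" using order.trans[OF norm_ge_zero assms[of 0]] by simp
  have "norm (g (x, y)) \<le> C / (1 + norm (x, y)) ^ (k + m)" by (rule assms)
  also have "\<dots> \<le> C / ((1 + norm x) ^ k * (1 + norm y) ^ m)"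
    using C by (intro divide_left_mono one_plus_norm_Pair_ge mult_pos_pos zero_less_power) (auto simp: add_pos_nonneg)
  finally show ?thesis .
qed

section \<open>Slices and partial transforms of a fixed Schwartz function on a product\<close>

context
  fixes f :: "'a::euclidean_space \<times> 'b::euclidean_space \<Rightarrow> complex"
  assumes f: "f \<in> schwartz"
begin

lemma partials_slice_measurable:
  assumes "bs \<in> lists Basis"
  shows "(\<lambda>x. partials bs f (x, y)) \<in> borel_measurable borel"
  by (intro borel_measurable_continuous_onI continuous_on_compose2[OF partials_schwartz_continuous[OF f assms]] continuous_intros) auto

lemma partials_slice_decay:
  assumes bs: "bs \<in> lists Basis"
  shows "\<exists>C. \<forall>x y. norm (partials bs f (x, y)) \<le> C / ((1 + norm x) ^ k * (1 + norm y) ^ m)"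
proof -
  obtain C where C: "\<And>z. norm (partials bs f z) \<le> C / (1 + norm z) ^ (k + m)"
    using partials_schwartz_decay[OF f bs] by metis
  show ?thesis using decay_Pair[OF C] by blast
qed

lemma slice_decay: "\<exists>C. \<forall>x y. norm (f (x, y)) \<le> C / ((1 + norm x) ^ k * (1 + norm y) ^ m)"
  using partials_slice_decay[of "[]" k m] by simp

lemma integrable_slice: "integrable lborel (\<lambda>x. f (x, y))"
proof -
  obtain C where C: "\<And>x y. norm (f (x, y)) \<le> C / ((1 + norm x) ^ (2 * DIM('a)) * (1 + norm y) ^ 0)"
    using slice_decay[of "2 * DIM('a)" 0] by blast
  show ?thesis
    by (rule integrable_of_decay[where C=C and m="2 * DIM('a)"]) (use C partials_slice_measurable[of "[]" y] in auto)
qed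

text \<open>Decay in \<open>y\<close> of the L1 norms in \<open>x\<close>: these norms are the
  right-hand side of \<open>fourier_decay\<close> for the slice at \<open>y\<close>.\<close>

lemma partials_slice_integral:
  assumes bs: "bs \<in> lists Basis"
  shows "\<exists>K. \<forall>y. (LINT x|lborel. norm (partials bs f (x, y))) \<le> K / (1 + norm y) ^ m"
proof -
  obtain C where C: "\<And>x y. norm (partials bs f (x, y)) \<le> C / ((1 + norm x) ^ (2 * DIM('a)) * (1 + norm y) ^ m)"
    using partials_slice_decay[OF bs] by blast
  have "(LINT x|lborel. norm (partials bs f (x, y))) \<le> (C * (LINT x|lborel. 1 / (1 + norm (x::'a)) ^ (2 * DIM('a)))) / (1 + norm y) ^ m" for y
  proof -
    have i: "integrable lborel (\<lambda>x::'a. (C / (1 + norm y) ^ m) * (1 / (1 + norm x) ^ (2 * DIM('a))))"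
      by (intro integrable_mult_right integrable_inverse_power_norm order_refl)
    have le: "norm (partials bs f (x, y)) \<le> (C / (1 + norm y) ^ m) * (1 / (1 + norm x) ^ (2 * DIM('a)))" for x
      using C[of x y] by (simp add: mult.commute)
    have [measurable]: "(\<lambda>x. partials bs f (x, y)) \<in> borel_measurable borel" by (rule partials_slice_measurable[OF bs])
    have "(LINT x|lborel. norm (partials bs f (x, y))) \<le> (LINT x|lborel. (C / (1 + norm y) ^ m) * (1 / (1 + norm (x::'a)) ^ (2 * DIM('a))))"
    proof (rule integral_mono[OF _ i le])
      show "integrable lborel (\<lambda>x. norm (partials bs f (x, y)))"
        by (rule Bochner_Integration.integrable_bound[OF i]) (simp, intro AE_I2, simp only: real_norm_def abs_norm_cancel, rule order.trans[OF le abs_ge_self])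
    qed
    then show ?thesis unfolding integral_mult_right_zero by (simp only: times_divide_eq_left)
  qed
  then show ?thesis by blast
qed

text \<open>Decay in \<xi> comes from differentiating the slice in the directions
  \<open>(b, 0)\<close>, and decay in \<open>y\<close> from the L1 norms of those derivatives.
  Having both at once justifies the later interchanges of integrals.\<close>

lemma partial_fourier_decay:
  "\<exists>C. \<forall>\<xi> y. norm (partial_fourier f \<xi> y) \<le> C / ((1 + norm \<xi>) ^ k * (1 + norm y) ^ m)"
proof -
  have l: "replicate j (b, 0) \<in> lists Basis" if "b \<in> Basis" for j and b :: 'a
    using that by (induction j) (auto simp: Basis_prod_def)
  obtain K0 where K0: "\<And>y. (LINT x|lborel. norm (f (x, y))) \<le> K0 / (1 + norm y) ^ m"
    using partials_slice_integral[of "[]" m] by auto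
  have "\<exists>K. \<forall>b\<in>Basis. \<forall>y. (LINT x|lborel. norm (partials (replicate k (b, 0)) f (x, y))) \<le> K b / (1 + norm y) ^ m"
    using partials_slice_integral[OF l] by (intro bchoice) blast
  then obtain K where K: "\<And>b y. b \<in> Basis \<Longrightarrow> (LINT x|lborel. norm (partials (replicate k (b, 0)) f (x, y))) \<le> K b / (1 + norm y) ^ m"
    by blast
  define C where "C = (1 + real DIM('a)) ^ k * (K0 + (\<Sum>b\<in>Basis. K b))"
  have "norm (partial_fourier f \<xi> y) \<le> C / ((1 + norm \<xi>) ^ k * (1 + norm y) ^ m)" for \<xi> y
  proof -
    have "(1 + norm \<xi>) ^ k * norm (fourier (\<lambda>x. f (x, y)) \<xi>) \<le> (1 + real DIM('a)) ^ k *
      ((LINT x|lborel. norm (f (x, y))) + (\<Sum>b\<in>Basis. (LINT x|lborel. norm (partials (replicate k (b, 0)) f (x, y)))))"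
    proof (rule fourier_decay[where G="\<lambda>b j x. partials (replicate j (b, 0)) f (x, y)"])
      fix b :: 'a and j assume b: "b \<in> Basis"
      show "(\<lambda>x. partials (replicate j (b, 0)) f (x, y)) \<in> borel_measurable borel"
        by (rule partials_slice_measurable[OF l[OF b]])
      obtain D where D: "\<And>x y. norm (partials (replicate j (b, 0)) f (x, y)) \<le> D / ((1 + norm x) ^ (2 * DIM('a)) * (1 + norm y) ^ 0)"
        using partials_slice_decay[OF l[OF b]] by blast
      then show "\<exists>D. \<forall>x. norm (partials (replicate j (b, 0)) f (x, y)) \<le> D / (1 + norm x) ^ (2 * DIM('a))"
        by (intro exI[of _ D]) simp
      fix x t
      show "((\<lambda>t. partials (replicate j (b, 0)) f (x + t *\<^sub>R b, y)) has_vector_derivative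
              partials (replicate (Suc j) (b, 0)) f (x + t *\<^sub>R b, y)) (at t)"
        using partials_schwartz_line_derivative[OF f l[OF b, of j], of "(x, y)" "(b, 0)" t] by simp
    qed simp
    also have "\<dots> \<le> (1 + real DIM('a)) ^ k * (K0 / (1 + norm y) ^ m + (\<Sum>b\<in>Basis. K b / (1 + norm y) ^ m))"
      by (intro mult_left_mono add_mono sum_mono K K0) auto
    also have "\<dots> = C / (1 + norm y) ^ m"
      by (simp only: C_def sum_divide_distrib[symmetric] add_divide_distrib[symmetric] times_divide_eq_right)
    finally have "(1 + norm \<xi>) ^ k * norm (partial_fourier f \<xi> y) \<le> C / (1 + norm y) ^ m"
      by (simp add: partial_fourier_def)
    moreover have "0 < (1 + norm \<xi>) ^ k" "0 < (1 + norm y) ^ m" by (auto intro!: zero_less_power simp: add_pos_nonneg)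
    ultimately show ?thesis by (simp add: field_simps)
  qed
  then show ?thesis by blast
qed

lemma continuous_partial_fourier: "continuous_on UNIV (\<lambda>p. partial_fourier f (fst p) (snd p))"
proof -
  obtain C where C: "\<And>x y. norm (f (x, y)) \<le> C / ((1 + norm x) ^ (2 * DIM('a)) * (1 + norm y) ^ 0)"
    using slice_decay[of "2 * DIM('a)" 0] by blast
  show ?thesis unfolding partial_fourier_def fourier_def
  proof (rule continuous_on_parametric_integral)
    show "integrable lborel (\<lambda>x::'a. C * (1 / (1 + norm x) ^ (2 * DIM('a))))"
      by (intro integrable_mult_right integrable_inverse_power_norm order_refl)
    show "norm (exp (- \<i> * complex_of_real (x \<bullet> fst p)) * f (x, snd p)) \<le> C * (1 / (1 + norm x) ^ (2 * DIM('a)))" for x and p :: "'a \<times> 'b"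
      using C[of x "snd p"] by (simp add: norm_mult)
    show "continuous_on UNIV (\<lambda>p::'a \<times> 'b. exp (- \<i> * complex_of_real (x \<bullet> fst p)) * f (x, snd p))" for x
      by (intro continuous_intros continuous_on_compose2[OF schwartz_continuous[OF f]]) auto
    show "(\<lambda>x. exp (- \<i> * complex_of_real (x \<bullet> fst p)) * f (x, snd p)) \<in> borel_measurable lborel" for p :: "'a \<times> 'b"
      using partials_slice_measurable[of "[]" "snd p"] by simp
  qed
qed

lemma partial_fourier_measurable [measurable]:
  "(\<lambda>p. partial_fourier f (fst p) (snd p)) \<in> borel_measurable (borel \<Otimes>\<^sub>M borel)"
  unfolding borel_prod by (rule borel_measurable_continuous_onI[OF continuous_partial_fourier])

lemma continuous_partial_fourier1: "continuous_on UNIV (\<lambda>\<xi>. partial_fourier f \<xi> y)"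
proof -
  have "continuous_on UNIV (\<lambda>\<xi>::'a. (\<xi>, y))" by (intro continuous_intros)
  from continuous_on_compose2[OF continuous_partial_fourier this] show ?thesis by simp
qed

lemma continuous_partial_fourier2: "continuous_on UNIV (partial_fourier f \<xi>)"
proof -
  have "continuous_on UNIV (\<lambda>y::'b. (\<xi>, y))" by (intro continuous_intros)
  from continuous_on_compose2[OF continuous_partial_fourier this] show ?thesis by simp
qed

lemma integrable_partial_fourier1: "integrable lborel (\<lambda>\<xi>. partial_fourier f \<xi> y)"
proof -
  obtain C where C: "\<And>\<xi> y. norm (partial_fourier f \<xi> y) \<le> C / ((1 + norm \<xi>) ^ (2 * DIM('a)) * (1 + norm y) ^ 0)"
    using partial_fourier_decay by blast
  show ?thesis
    by (rule integrable_of_decay[OF _ _ order_refl, of _ C])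
       (use C in \<open>auto intro: borel_measurable_continuous_onI continuous_partial_fourier1\<close>)
qed

lemma integrable_partial_fourier2: "integrable lborel (partial_fourier f \<xi>)"
proof -
  obtain C where C: "\<And>\<xi> y. norm (partial_fourier f \<xi> y) \<le> C / ((1 + norm \<xi>) ^ 0 * (1 + norm y) ^ (2 * DIM('b)))"
    using partial_fourier_decay by blast
  show ?thesis
    by (rule integrable_of_decay[OF _ _ order_refl, of _ C])
       (use C in \<open>auto intro: borel_measurable_continuous_onI continuous_partial_fourier2\<close>)
qed

lemma fourier_eq_iterated: "fourier f (\<xi>, \<eta>) = fourier (partial_fourier f \<xi>) \<eta>"
proof -
  let ?g = "\<lambda>(x, y). exp (- \<i> * of_real ((x, y) \<bullet> (\<xi>, \<eta>))) * f (x, y)"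
  have i: "integrable (lborel \<Otimes>\<^sub>M lborel) ?g"
    using integrable_fourier[OF integrable_schwartz[OF f], of "(\<xi>, \<eta>)"] by (simp add: lborel_prod case_prod_unfold inner_prod_def)
  have "fourier f (\<xi>, \<eta>) = integral\<^sup>L (lborel \<Otimes>\<^sub>M lborel) ?g"
    by (simp add: fourier_def lborel_prod case_prod_unfold inner_prod_def)
  also have "\<dots> = (LINT y|lborel. LINT x|lborel. exp (- \<i> * of_real ((x, y) \<bullet> (\<xi>, \<eta>))) * f (x, y))"
    using lborel_pair.integral_snd[OF i] by simp
  also have "\<dots> = (LINT y|lborel. LINT x|lborel. exp (- \<i> * of_real (y \<bullet> \<eta>)) * (exp (- \<i> * of_real (x \<bullet> \<xi>)) * f (x, y)))"
    by (simp only: inner_Pair of_real_add distrib_left exp_add mult_ac)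
  also have "\<dots> = fourier (partial_fourier f \<xi>) \<eta>"
    by (simp only: integral_mult_right_zero fourier_def partial_fourier_def)
  finally show ?thesis .
qed

lemma fourier_decay_Pair:
  "\<exists>C. \<forall>\<xi> \<eta>. norm (fourier f (\<xi>, \<eta>)) \<le> C / ((1 + norm \<xi>) ^ k * (1 + norm \<eta>) ^ m)"
proof -
  obtain C where C: "\<And>z. norm (fourier f z) \<le> C / (1 + norm z) ^ (k + m)"
    using fourier_schwartz_decay[OF f] by metis
  show ?thesis using decay_Pair[OF C] by blast
qed

lemma fourier_continuous_compose:
  assumes "continuous_on UNIV p" shows "continuous_on UNIV (\<lambda>x. fourier f (p x))"
  by (rule continuous_on_compose2[OF continuous_fourier[OF integrable_schwartz[OF f]] assms]) auto

lemma slice_inversion: "inverse_fourier (\<lambda>\<xi>. partial_fourier f \<xi> y) x = f (x, y)"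
proof -
  obtain C where C: "\<And>z. norm (f z) \<le> C" using schwartz_bounded[OF f] by blast
  have "inverse_fourier (fourier (\<lambda>x. f (x, y))) = (\<lambda>x. f (x, y))"
  proof (rule fourier_inversion[OF integrable_slice _ C])
    show "continuous_on UNIV (\<lambda>x. f (x, y))"
      by (intro continuous_on_compose2[OF schwartz_continuous[OF f]] continuous_intros) auto
    show "integrable lborel (fourier (\<lambda>x. f (x, y)))"
      using integrable_partial_fourier1[of y] by (simp add: partial_fourier_def)
  qed
  then show ?thesis by (simp add: partial_fourier_def fun_eq_iff)
qed

lemma integrable_fourier_slice: "integrable lborel (\<lambda>\<eta>. fourier f (\<xi>, \<eta>))"
proof -
  obtain C where C: "\<And>\<xi> \<eta>. norm (fourier f (\<xi>, \<eta>)) \<le> C / ((1 + norm \<xi>) ^ 0 * (1 + norm \<eta>) ^ (2 * DIM('b)))"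
    using fourier_decay_Pair by blast
  show ?thesis
    by (rule integrable_of_decay[OF _ _ order_refl, of _ C])
       (use C in \<open>auto intro!: borel_measurable_continuous_onI fourier_continuous_compose continuous_intros\<close>)
qed

lemma partial_fourier_inversion: "inverse_fourier (\<lambda>\<eta>. fourier f (\<xi>, \<eta>)) = partial_fourier f \<xi>"
proof -
  obtain C where C: "\<And>\<xi> y. norm (partial_fourier f \<xi> y) \<le> C / ((1 + norm \<xi>) ^ 0 * (1 + norm y) ^ 0)"
    using partial_fourier_decay by blast
  show ?thesis unfolding fourier_eq_iterated
    by (rule fourier_inversion[OF integrable_partial_fourier2 continuous_partial_fourier2, of _ C])
       (use C integrable_fourier_slice in \<open>simp_all add: fourier_eq_iterated\<close>)
qed

lemma integrable_powr_partial_fourier: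
  assumes p: "p > - real DIM('a)"
  shows "integrable lborel (\<lambda>\<xi>. of_real (norm \<xi> powr p) * partial_fourier f \<xi> y)"
proof -
  obtain m where "max (2 * real DIM('a) + p) (2 * real DIM('a)) \<le> real m"
    using real_arch_simple by blast
  then have m: "2 * real DIM('a) + p \<le> real m" "2 * DIM('a) \<le> m" by linarith+
  obtain C where C: "\<And>\<xi> y. norm (partial_fourier f \<xi> y) \<le> C / ((1 + norm \<xi>) ^ m * (1 + norm y) ^ 0)"
    using partial_fourier_decay by blast
  show ?thesis
  proof (rule Bochner_Integration.integrable_bound[OF integrable_mult_left[OF integrable_powr_norm_decay[OF p m], of C]])
    show "AE \<xi> in lborel. norm (of_real (norm \<xi> powr p) * partial_fourier f \<xi> y) \<le> norm (norm \<xi> powr p / (1 + norm \<xi>) ^ m * C)"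
    proof (rule AE_I2)
      fix \<xi>
      have "norm \<xi> powr p * norm (partial_fourier f \<xi> y) \<le> norm \<xi> powr p * (C / (1 + norm \<xi>) ^ m)"
        using C[of \<xi> y] by (intro mult_left_mono) auto
      then show "norm (of_real (norm \<xi> powr p) * partial_fourier f \<xi> y) \<le> norm (norm \<xi> powr p / (1 + norm \<xi>) ^ m * C)"
        using order.trans[OF norm_ge_zero C[of 0 0]] by (simp add: norm_mult abs_mult)
    qed
    have [measurable]: "(\<lambda>\<xi>. partial_fourier f \<xi> y) \<in> borel_measurable borel"
      by (rule borel_measurable_continuous_onI[OF continuous_partial_fourier1])
    show "(\<lambda>\<xi>. of_real (norm \<xi> powr p) * partial_fourier f \<xi> y) \<in> borel_measurable lborel" by measurable
  qed
qed

text \<open>The decay in \<xi> is uniform in the second argument, so the transform may be restricted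
  to the graph of any continuous \<open>q\<close>. The cone transform uses the graph of -|v|
  \<xi>.\<close>

lemma integrable_powr_fourier:
  assumes p: "p > - real DIM('a)" and q: "continuous_on UNIV q"
  shows "integrable lborel (\<lambda>\<xi>. of_real (norm \<xi> powr p) * fourier f (\<xi>, q \<xi>))"
proof -
  obtain m where "max (2 * real DIM('a) + p) (2 * real DIM('a)) \<le> real m"
    using real_arch_simple by blast
  then have m: "2 * real DIM('a) + p \<le> real m" "2 * DIM('a) \<le> m" by linarith+
  obtain C where C: "\<And>\<xi> y. norm (fourier f (\<xi>, y)) \<le> C / ((1 + norm \<xi>) ^ m * (1 + norm y) ^ 0)"
    using fourier_decay_Pair by blast
  show ?thesis
  proof (rule Bochner_Integration.integrable_bound[OF integrable_mult_left[OF integrable_powr_norm_decay[OF p m], of C]])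
    show "AE \<xi> in lborel. norm (of_real (norm \<xi> powr p) * fourier f (\<xi>, q \<xi>)) \<le> norm (norm \<xi> powr p / (1 + norm \<xi>) ^ m * C)"
    proof (rule AE_I2)
      fix \<xi>
      have "norm \<xi> powr p * norm (fourier f (\<xi>, q \<xi>)) \<le> norm \<xi> powr p * (C / (1 + norm \<xi>) ^ m)"
        using C[of \<xi> "q \<xi>"] by (intro mult_left_mono) auto
      then show "norm (of_real (norm \<xi> powr p) * fourier f (\<xi>, q \<xi>)) \<le> norm (norm \<xi> powr p / (1 + norm \<xi>) ^ m * C)"
        using order.trans[OF norm_ge_zero C[of 0 0]] by (simp add: norm_mult abs_mult)
    qed
    have [measurable]: "(\<lambda>\<xi>. fourier f (\<xi>, q \<xi>)) \<in> borel_measurable borel"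
      by (intro borel_measurable_continuous_onI fourier_continuous_compose continuous_intros q)
    show "(\<lambda>\<xi>. of_real (norm \<xi> powr p) * fourier f (\<xi>, q \<xi>)) \<in> borel_measurable lborel" by measurable
  qed
qed

end

subsection \<open>The radial cone transform\<close>

lemma nn_integral_sphere_measure:
  fixes \<Phi> :: "real ^ 'd::finite \<Rightarrow> ennreal"
  assumes [measurable]: "\<Phi> \<in> borel_measurable borel"
  shows "(\<integral>\<^sup>+\<theta>. \<Phi> \<theta> \<partial>sphere_measure) =
    of_nat CARD('d) * (\<integral>\<^sup>+x. \<Phi> (sgn x) * indicator (ball 0 1 - {0}) x \<partial>lborel)"
proof -
  have [measurable]: "(sgn :: real ^ 'd \<Rightarrow> _) \<in> borel_measurable borel"
    unfolding sgn_div_norm[abs_def] by measurable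
  have m: "sgn \<in> measurable (restrict_space lborel (ball 0 1 - {0})) (restrict_space borel (sphere (0::real ^ 'd) 1))"
    by (intro measurable_restrict_space3) (auto simp: norm_sgn)
  have \<Phi>: "\<Phi> \<in> borel_measurable (restrict_space borel (sphere 0 1))"
    by (intro measurable_restrict_space1) measurable
  have "(\<integral>\<^sup>+\<theta>. \<Phi> \<theta> \<partial>sphere_measure) = of_nat CARD('d) *
     (\<integral>\<^sup>+\<theta>. \<Phi> \<theta> \<partial>distr (restrict_space lborel (ball 0 1 - {0})) (restrict_space borel (sphere 0 1)) sgn)"
    unfolding sphere_measure_def by (rule nn_integral_scale_measure) (use \<Phi> in simp)
  also have "\<dots> = of_nat CARD('d) * (\<integral>\<^sup>+x. \<Phi> (sgn x) \<partial>restrict_space lborel (ball 0 1 - {0}))"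
    by (subst nn_integral_distr[OF m]) (use \<Phi> in simp_all)
  finally show ?thesis by (subst (asm) nn_integral_restrict_space) auto
qed

lemma sets_sphere_measure [measurable_cong]: "sets sphere_measure = sets (restrict_space borel (sphere 0 1))"
  by (simp add: sphere_measure_def)

lemma space_sphere_measure: "space sphere_measure = sphere 0 1"
  by (simp add: sphere_measure_def space_scale_measure space_restrict_space)

text \<open>\<open>nn_integral_polar\<close>, applied to indicators, says that Lebesgue measure is
  the image of sphere measure times z^(d-1) dz under multiplication. As an equality of measures it
  transfers to complex integrands, where Fubini needs the sigma-finiteness established
  first.\<close>

lemma integral_polar:
  fixes g :: "real ^ 'd::finite \<Rightarrow> complex"
  assumes g: "integrable lborel g"
  shows "(LINT \<theta>|sphere_measure. (LINT z:{0..}|lborel. g (z *\<^sub>R \<theta>) * of_real (z ^ (CARD('d) - 1)))) = (LINT x|lborel. g x)"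
proof -
  let ?w = "\<lambda>z::real. z ^ (CARD('d) - 1) * indicator {0<..} z"
  \<comment> \<open>The radial measure lives on z > 0, matching the polar formula, whereas the
    transform integrates over z \<ge> 0; the point 0 is discarded as a null set at the end.\<close>
  define N where "N = density lborel (\<lambda>z. ennreal (?w z))"
  let ?S = "sphere_measure :: (real ^ 'd) measure"
  let ?T = "\<lambda>p::(real ^ 'd) \<times> real. snd p *\<^sub>R fst p"
  have [measurable]: "g \<in> borel_measurable borel" using g by auto
  have sN [measurable_cong]: "sets N = sets borel" by (simp add: N_def)
  interpret S: sigma_finite_measure ?S
  proof (rule finite_measure.axioms(1), rule finite_measureI)
    have "emeasure ?S (space ?S) = (\<integral>\<^sup>+\<theta>. 1 \<partial>?S)" by simp
    also have "\<dots> = of_nat CARD('d) * (\<integral>\<^sup>+x. 1 * indicator (ball 0 1 - {0}) (x :: real ^ 'd) \<partial>lborel)"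
      by (rule nn_integral_sphere_measure) simp
    also have "\<dots> = of_nat CARD('d) * emeasure lborel (ball (0 :: real ^ 'd) 1 - {0})"
      by simp
    also have "\<dots> \<le> of_nat CARD('d) * emeasure lborel (ball (0 :: real ^ 'd) 1)"
      by (intro mult_left_mono emeasure_mono) auto
    also have "\<dots> < \<infinity>"
      using emeasure_lborel_ball_finite[of "0 :: real ^ 'd" 1] by (auto simp: ennreal_mult_less_top ennreal_of_nat_eq_real_of_nat)
    finally show "emeasure ?S (space ?S) \<noteq> \<infinity>" by simp
  qed
  interpret N: sigma_finite_measure N
    unfolding N_def by (subst sigma_finite_measure.sigma_finite_iff_density_finite[OF sigma_finite_lborel]) auto
  interpret P: pair_sigma_finite ?S N ..
  have fst_m: "fst \<in> measurable (?S \<Otimes>\<^sub>M N) borel"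
  proof -
    have "(\<lambda>\<theta>. \<theta>) \<in> measurable ?S borel"
      by (subst measurable_cong_sets[OF sets_sphere_measure refl]) (intro measurable_restrict_space1, simp)
    then show ?thesis by (rule measurable_compose[OF measurable_fst])
  qed
  have T [measurable]: "?T \<in> measurable (?S \<Otimes>\<^sub>M N) borel"
    using fst_m by measurable
  have distr: "distr (?S \<Otimes>\<^sub>M N) borel ?T = lborel"
  proof (rule measure_eqI)
    fix A assume "A \<in> sets (distr (?S \<Otimes>\<^sub>M N) borel ?T)"
    then have A [measurable]: "A \<in> sets borel" by simp
    let ?h = "\<lambda>\<theta> z. indicator A (z *\<^sub>R \<theta>) * ennreal (z ^ (CARD('d) - 1)) * indicator {0<..} z"
    have "emeasure (distr (?S \<Otimes>\<^sub>M N) borel ?T) A = (\<integral>\<^sup>+x. indicator A x \<partial>distr (?S \<Otimes>\<^sub>M N) borel ?T)"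
      by (rule nn_integral_indicator[symmetric]) simp
    also have "\<dots> = (\<integral>\<^sup>+p. indicator A (?T p) \<partial>(?S \<Otimes>\<^sub>M N))"
      by (rule nn_integral_distr[OF T]) measurable
    also have "\<dots> = (\<integral>\<^sup>+\<theta>. (\<integral>\<^sup>+z. indicator A (?T (\<theta>, z)) \<partial>N) \<partial>?S)"
      by (rule N.nn_integral_fst[symmetric]) (use T in measurable)
    also have "\<dots> = (\<integral>\<^sup>+\<theta>. (\<integral>\<^sup>+z. ?h \<theta> z \<partial>lborel) \<partial>?S)"
    proof (rule nn_integral_cong)
      fix \<theta> :: "real ^ 'd"
      have "(\<integral>\<^sup>+z. indicator A (?T (\<theta>, z)) \<partial>N) = (\<integral>\<^sup>+z. ennreal (?w z) * indicator A (z *\<^sub>R \<theta>) \<partial>lborel)"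
        unfolding N_def by (subst nn_integral_density) auto
      also have "\<dots> = (\<integral>\<^sup>+z. ?h \<theta> z \<partial>lborel)"
        by (intro nn_integral_cong) (simp add: indicator_def)
      finally show "(\<integral>\<^sup>+z. indicator A (?T (\<theta>, z)) \<partial>N) = (\<integral>\<^sup>+z. ?h \<theta> z \<partial>lborel)" .
    qed
    also have "\<dots> = of_nat CARD('d) * (\<integral>\<^sup>+x. (\<integral>\<^sup>+z. ?h (sgn x) z \<partial>lborel) * indicator (ball 0 1 - {0}) x \<partial>lborel)"
      by (rule nn_integral_sphere_measure) measurable
    also have "\<dots> = (\<integral>\<^sup>+y. indicator A y \<partial>lborel)"
      using nn_integral_polar[of "indicator A :: real ^ 'd \<Rightarrow> ennreal"] by simp
    finally show "emeasure (distr (?S \<Otimes>\<^sub>M N) borel ?T) A = emeasure lborel A" by simp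
  qed simp
  have i: "integrable (?S \<Otimes>\<^sub>M N) (\<lambda>p. g (?T p))"
    by (subst integrable_distr_eq[OF T, symmetric]) (use g distr in simp_all)
  have "(LINT x|lborel. g x) = (LINT x|distr (?S \<Otimes>\<^sub>M N) borel ?T. g x)" by (simp only: distr)
  also have "\<dots> = integral\<^sup>L (?S \<Otimes>\<^sub>M N) (\<lambda>p. g (?T p))"
    by (rule integral_distr[OF T]) measurable
  also have "\<dots> = (LINT \<theta>|?S. LINT z|N. g (?T (\<theta>, z)))"
    by (rule P.integral_fst'[OF i, symmetric])
  also have "\<dots> = (LINT \<theta>|?S. (LINT z:{0..}|lborel. g (z *\<^sub>R \<theta>) * of_real (z ^ (CARD('d) - 1))))"
  proof (intro Bochner_Integration.integral_cong refl)
    fix \<theta> :: "real ^ 'd"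
    have "(LINT z|N. g (?T (\<theta>, z))) = (LINT z|lborel. ?w z *\<^sub>R g (z *\<^sub>R \<theta>))"
      unfolding N_def by (subst integral_density) (auto simp: indicator_def)
    also have "\<dots> = (LINT z:{0..}|lborel. g (z *\<^sub>R \<theta>) * of_real (z ^ (CARD('d) - 1)))"
      unfolding set_lebesgue_integral_def
      by (intro integral_cong_AE, measurable, rule eventually_mono[OF AE_lborel_singleton[of 0]])
         (auto simp: indicator_def scaleR_conv_of_real)
    finally show "(LINT z|N. g (?T (\<theta>, z))) = (LINT z:{0..}|lborel. g (z *\<^sub>R \<theta>) * of_real (z ^ (CARD('d) - 1)))" .
  qed
  finally show ?thesis ..
qed

lemma distr_vec_lborel:
  assumes d: "CARD('d::finite) = 1"
  shows "distr lborel borel vec = (lborel :: (real ^ 'd) measure)"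
proof (rule lborel_eqI[symmetric])
  obtain i :: 'd where U: "UNIV = {i}" using d card_1_singletonE by blast
  have j: "j = i" for j :: 'd using U by blast
  have B: "Basis = {axis i 1 :: real ^ 'd}" by (simp add: Basis_vec_def U)
  have [measurable]: "(vec :: real \<Rightarrow> real ^ 'd) \<in> borel_measurable borel"
    by (intro borel_measurable_continuous_onI linear_continuous_on)
      (auto intro!: linear_conv_bounded_linear[THEN iffD1] linearI simp: vec_eq_iff)
  fix l u :: "real ^ 'd" assume le: "\<And>b. b \<in> Basis \<Longrightarrow> l \<bullet> b \<le> u \<bullet> b"
  then have "l $ i \<le> u $ i" by (auto simp: B inner_axis)
  have "vec -` box l u = {l $ i <..< u $ i}"
    by (auto simp: mem_box B inner_axis)
  then have "emeasure (distr lborel borel vec) (box l u) = emeasure lborel {l $ i <..< u $ i}"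
    by (subst emeasure_distr) auto
  also have "\<dots> = (\<Prod>b\<in>Basis. (u - l) \<bullet> b)"
    using \<open>l $ i \<le> u $ i\<close> by (simp add: B inner_axis)
  finally show "emeasure (distr lborel borel vec) (box l u) = (\<Prod>b\<in>Basis. (u - l) \<bullet> b)" .
qed simp

text \<open>The sphere of the line is the pair of signs: reflection turns the second summand into
  the integral over the negative half-line, up to the null point 0.\<close>

lemma integral_one_dimensional:
  fixes g :: "real ^ 'd::finite \<Rightarrow> complex"
  assumes d: "CARD('d) = 1" and g: "integrable lborel g"
  shows "(LINT z:{0..}|lborel. (g (vec z) + g (- vec z))) = (LINT x|lborel. g x)"
proof -
  have [measurable]: "g \<in> borel_measurable borel" using g by auto
  have vec [measurable]: "(vec :: real \<Rightarrow> real ^ 'd) \<in> borel_measurable borel"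
    by (intro borel_measurable_continuous_onI linear_continuous_on)
      (auto intro!: linear_conv_bounded_linear[THEN iffD1] linearI simp: vec_eq_iff)
  have vm: "vec (- z) = - (vec z :: real ^ 'd)" for z by (simp add: vec_eq_iff)
  have i: "integrable lborel (\<lambda>z. g (vec z))"
    using g integrable_distr_eq[of vec lborel borel g] by (simp add: distr_vec_lborel[OF d])
  have i2: "integrable lborel (\<lambda>z. g (- vec z))"
    using lborel_integrable_real_affine[OF i, of "-1" 0] by (simp add: vm)
  have si: "integrable lborel (\<lambda>z::real. indicator A z *\<^sub>R g (vec z))" if "A \<in> sets borel" for A
    using integrable_mult_indicator[OF _ i, of A] that by simp
  have "(LINT z|lborel. indicator {0..} z *\<^sub>R g (- vec z)) = (LINT z|lborel. indicator {..0} z *\<^sub>R g (vec z))"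
    using lborel_integral_real_affine[of "-1" "\<lambda>z. indicator {0..} z *\<^sub>R g (- vec z)" 0]
    by (simp add: vm indicator_def)
  also have "\<dots> = (LINT z|lborel. indicator {..<0} z *\<^sub>R g (vec z))"
    by (intro integral_cong_AE, measurable, rule eventually_mono[OF AE_lborel_singleton[of 0]])
       (auto simp: indicator_def)
  finally have neg: "(LINT z|lborel. indicator {0..} z *\<^sub>R g (- vec z)) = (LINT z|lborel. indicator {..<0} z *\<^sub>R g (vec z))" .
  have "(LINT x|lborel. g x) = (LINT z|lborel. g (vec z))"
    using integral_distr[of vec lborel borel g] by (simp add: distr_vec_lborel[OF d])
  also have "\<dots> = (LINT z|lborel. indicator {0..} z *\<^sub>R g (vec z) + indicator {..<0} z *\<^sub>R g (vec z))"
    by (intro Bochner_Integration.integral_cong) (auto simp: indicator_def)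
  also have "\<dots> = (LINT z|lborel. indicator {0..} z *\<^sub>R g (vec z)) + (LINT z|lborel. indicator {0..} z *\<^sub>R g (- vec z))"
    unfolding neg by (intro Bochner_Integration.integral_add si) auto
  also have "\<dots> = (LINT z:{0..}|lborel. (g (vec z) + g (- vec z)))"
    unfolding set_lebesgue_integral_def scaleR_right_distrib
    by (intro Bochner_Integration.integral_add[symmetric] si integrable_mult_indicator i2) auto
  finally show ?thesis ..
qed

text \<open>Only integrability of the slice along the cone is assumed, since the lemma has to apply
  to the filtered function as well as to the Schwartz function \<open>f\<close>.\<close>

lemma radial_cone_transform_eq:
  fixes f :: "(real ^ 'd::finite) \<times> (real ^ 'd) \<Rightarrow> complex"
  assumes int: "integrable lborel (\<lambda>y. f (u + norm v *\<^sub>R y, y))"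
    and fr: "\<And>x y. f (x, y) = fr (x, norm y)"
  shows "radial_cone_transform fr (u, norm v) = cone_transform f (u, v)"
proof (cases "CARD('d) = 1")
  case True
  then obtain i :: 'd where U: "UNIV = {i}" using card_1_singletonE by blast
  have j: "j = i" for j :: 'd using U by blast
  have n: "norm (vec z :: real ^ 'd) = \<bar>z\<bar>" for z :: real
    by (simp add: norm_vec_def L2_set_def U)
  have "radial_cone_transform fr (u, norm v) = (LINT z:{0..}|lborel. (f (u + norm v *\<^sub>R vec z, vec z) + f (u + norm v *\<^sub>R (- vec z), - vec z)))"
    unfolding radial_cone_transform_def set_lebesgue_integral_def prod.case if_P[OF True]
  proof (intro Bochner_Integration.integral_cong refl)
    fix z :: real
    have "vec (z * norm v) = norm v *\<^sub>R (vec z :: real ^ 'd)" by (simp add: vec_eq_iff)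
    then show "indicat_real {0..} z *\<^sub>R (fr (u + vec (z * norm v), z) + fr (u - vec (z * norm v), z)) =
      indicat_real {0..} z *\<^sub>R (f (u + norm v *\<^sub>R vec z, vec z) + f (u + norm v *\<^sub>R (- vec z), - vec z))"
      \<comment> \<open>For z < 0 the function \<open>fr\<close> is unconstrained; the indicator
        removes these values.\<close>
      by (cases "0 \<le> z") (simp_all add: fr n)
  qed
  also have "\<dots> = cone_transform f (u, v)"
    unfolding cone_transform_def prod.case by (rule integral_one_dimensional[OF True int])
  finally show ?thesis .
next
  case False
  have "radial_cone_transform fr (u, norm v) = (LINT \<theta>|sphere_measure. (LINT z:{0..}|lborel.
     f (u + norm v *\<^sub>R (z *\<^sub>R \<theta>), z *\<^sub>R \<theta>) * of_real (z ^ (CARD('d) - 1))))"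
    unfolding radial_cone_transform_def set_lebesgue_integral_def prod.case if_not_P[OF False]
  proof (intro Bochner_Integration.integral_cong refl)
    fix \<theta> :: "real ^ 'd" and z :: real assume "\<theta> \<in> space sphere_measure"
    then have "norm \<theta> = 1" by (simp add: space_sphere_measure)
    then show "indicat_real {0..} z *\<^sub>R (fr (u + (z * norm v) *\<^sub>R \<theta>, z) * of_real (z ^ (CARD('d) - 1))) =
      indicat_real {0..} z *\<^sub>R (f (u + norm v *\<^sub>R (z *\<^sub>R \<theta>), z *\<^sub>R \<theta>) * of_real (z ^ (CARD('d) - 1)))"
      by (cases "0 \<le> z") (simp_all add: fr mult.commute)
  qed
  also have "\<dots> = cone_transform f (u, v)"
    unfolding cone_transform_def prod.case by (rule integral_polar[OF int])
  finally show ?thesis .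
qed

subsection \<open>Cone transforms in terms of Fourier transforms\<close>

text \<open>A Fourier slice theorem. Inserting inversion in the first variable gives the phase exp
  (i (u + |v| y) . \<xi>); after Fubini its part |v| y . \<xi> acts as the Fourier kernel in
  \<open>y\<close> at frequency -|v| \<xi>.\<close>

lemma cone_transform_eq_inverse_fourier:
  fixes f :: "(real ^ 'd::finite) \<times> (real ^ 'd) \<Rightarrow> complex"
  assumes f: "f \<in> schwartz"
  shows "(\<lambda>u. cone_transform f (u, v)) = inverse_fourier (\<lambda>\<xi>. fourier f (\<xi>, - norm v *\<^sub>R \<xi>))"
proof
  fix u :: "real ^ 'd"
  let ?s = "norm v" and ?m = "2 * DIM(real ^ 'd)"
  define c where "c = complex_of_real ((2 * pi) ^ DIM(real ^ 'd))"
  let ?K = "\<lambda>(\<xi>, y). exp (\<i> * of_real ((u + ?s *\<^sub>R y) \<bullet> \<xi>)) * partial_fourier f \<xi> y"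
  note [measurable] = partial_fourier_measurable[OF f]
  obtain C where C: "\<And>\<xi> y. norm (partial_fourier f \<xi> y) \<le> C / ((1 + norm \<xi>) ^ ?m * (1 + norm y) ^ ?m)"
    using partial_fourier_decay[OF f] by metis
  have i1: "integrable lborel (\<lambda>x::real ^ 'd. complex_of_real (C * (1 / (1 + norm x) ^ ?m)))"
    and i2: "integrable lborel (\<lambda>x::real ^ 'd. complex_of_real (1 / (1 + norm x) ^ ?m))"
    by (intro integrable_of_real integrable_mult_right integrable_inverse_power_norm order_refl)+
  have C0: "0 \<le> C" using order.trans[OF norm_ge_zero C[of 0 0]] by simp
  have int: "integrable (lborel \<Otimes>\<^sub>M lborel) ?K"
  proof (rule integrable_tensor[OF i1 i2])
    show "?K \<in> borel_measurable (borel \<Otimes>\<^sub>M borel)"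
      unfolding case_prod_unfold by measurable
    show "norm (?K (\<xi>, y)) \<le> norm (complex_of_real (C * (1 / (1 + norm \<xi>) ^ ?m))) * norm (complex_of_real (1 / (1 + norm y) ^ ?m))" for \<xi> y
      unfolding norm_of_real using C[of \<xi> y] C0 by (simp add: norm_mult abs_mult)
  qed
  have "cone_transform f (u, v) = (LINT y|lborel. inverse_fourier (\<lambda>\<xi>. partial_fourier f \<xi> y) (u + ?s *\<^sub>R y))"
    by (simp add: cone_transform_def slice_inversion[OF f])
  also have "\<dots> = (LINT y|lborel. LINT \<xi>|lborel. ?K (\<xi>, y)) / c"
    unfolding inverse_fourier_eq c_def[symmetric] by simp
  also have "(LINT y|lborel. LINT \<xi>|lborel. ?K (\<xi>, y)) = (LINT \<xi>|lborel. LINT y|lborel. ?K (\<xi>, y))"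
    using lborel_pair.Fubini_integral[OF int] by simp
  also have "\<dots> = (LINT \<xi>|lborel. exp (\<i> * of_real (u \<bullet> \<xi>)) * fourier f (\<xi>, - ?s *\<^sub>R \<xi>))"
  proof (intro Bochner_Integration.integral_cong refl)
    fix \<xi> :: "real ^ 'd"
    have "?K (\<xi>, y) = exp (\<i> * of_real (u \<bullet> \<xi>)) * (exp (- \<i> * of_real (y \<bullet> (- ?s *\<^sub>R \<xi>))) * partial_fourier f \<xi> y)" for y
      by (simp add: inner_add_left distrib_left exp_add)
    then have "(LINT y|lborel. ?K (\<xi>, y)) = exp (\<i> * of_real (u \<bullet> \<xi>)) * fourier (partial_fourier f \<xi>) (- ?s *\<^sub>R \<xi>)"
      by (simp only: integral_mult_right_zero fourier_def)
    then show "(LINT y|lborel. ?K (\<xi>, y)) = exp (\<i> * of_real (u \<bullet> \<xi>)) * fourier f (\<xi>, - ?s *\<^sub>R \<xi>)"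
      by (simp only: fourier_eq_iterated[OF f])
  qed
  finally show "cone_transform f (u, v) = inverse_fourier (\<lambda>\<xi>. fourier f (\<xi>, - norm v *\<^sub>R \<xi>)) u"
    unfolding inverse_fourier_eq c_def .
qed

lemma integrable_cone_slice:
  fixes f :: "(real ^ 'd::finite) \<times> (real ^ 'd) \<Rightarrow> complex"
  assumes f: "f \<in> schwartz"
  shows "integrable lborel (\<lambda>y. f (u + s *\<^sub>R y, y))"
proof -
  let ?m = "2 * DIM(real ^ 'd)"
  obtain C where C: "\<And>x y. norm (f (x, y)) \<le> C / ((1 + norm x) ^ 0 * (1 + norm y) ^ ?m)"
    using slice_decay[OF f] by metis
  show ?thesis
  proof (rule integrable_of_decay[OF _ _ order_refl, of _ C])
    show "(\<lambda>y. f (u + s *\<^sub>R y, y)) \<in> borel_measurable borel"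
      by (intro borel_measurable_continuous_onI continuous_on_compose2[OF schwartz_continuous[OF f]] continuous_intros) auto
  qed (use C in simp)
qed

lemma partial_fourier_radial:
  assumes "f \<in> schwartz_r" "norm y = norm y'"
  shows "partial_fourier f \<xi> y = partial_fourier f \<xi> y'"
proof -
  obtain U where U: "orthogonal_transformation U" "U y = y'"
    using orthogonal_transformation_exists[OF assms(2)] by blast
  then have "f (x, y) = f (x, y')" for x using assms(1) unfolding schwartz_r_def by blast
  then show ?thesis by (simp add: partial_fourier_def)
qed

text \<open>An orthogonal map carrying \<eta> to \<eta>' preserves both Lebesgue measure and inner
  products, and it leaves the partial transform unchanged.\<close>

lemma fourier_radial:
  assumes f: "f \<in> schwartz_r" and n: "norm \<eta> = norm \<eta>'"
  shows "fourier f (\<xi>, \<eta>) = fourier f (\<xi>, \<eta>')"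
proof -
  have fs: "f \<in> schwartz" using f by (simp add: schwartz_r_def)
  obtain U where U: "orthogonal_transformation U" "U \<eta> = \<eta>'"
    using orthogonal_transformation_exists[OF n] by blast
  have [measurable]: "partial_fourier f \<xi> \<in> borel_measurable borel"
    by (rule borel_measurable_continuous_onI[OF continuous_partial_fourier2[OF fs]])
  have "fourier (partial_fourier f \<xi>) \<eta>' = (LINT y|lborel. exp (- \<i> * of_real (U y \<bullet> U \<eta>)) * partial_fourier f \<xi> (U y))"
    unfolding fourier_def U(2)
    by (rule integral_orthogonal_transformation[OF U(1), symmetric]) measurable
  also have "\<dots> = fourier (partial_fourier f \<xi>) \<eta>"
    unfolding fourier_def
    using U(1) partial_fourier_radial[OF f orthogonal_transformation_norm[OF U(1)]]
    by (simp add: orthogonal_transformation_def)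
  finally show ?thesis by (simp add: fourier_eq_iterated[OF fs])
qed

text \<open>Both claims rest on one Fubini argument for \<open>K\<close>, so they are proved
  together: integrability of the cone slices is the by-product that the radial version requires. In
  the theorem \<open>p\<close> is -k.\<close>

lemma
  fixes f :: "(real ^ 'd::finite) \<times> (real ^ 'd) \<Rightarrow> complex"
  assumes f: "f \<in> schwartz_r" and p: "p > - real CARD('d)"
  defines "H \<equiv> \<lambda>(u, v). inverse_fourier (\<lambda>\<xi>. of_real (norm \<xi> powr (real CARD('d) + p)) * fourier f (\<xi>, - norm v *\<^sub>R \<xi>)) u"
  shows integrable_cone_filtered: "integrable lborel (\<lambda>y. H (u + norm v *\<^sub>R y, y))"
    and cone_transform_filtered: "cone_transform H (u, v) =
      inverse_fourier (\<lambda>\<xi>. of_real ((2 * pi) ^ CARD('d)) * (of_real (norm \<xi> powr p) * partial_fourier f \<xi> v)) u"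
proof -
  have fs: "f \<in> schwartz" using f by (simp add: schwartz_r_def)
  let ?s = "norm v" and ?d = "CARD('d)" and ?m = "2 * DIM(real ^ 'd)"
  define c where "c = complex_of_real ((2 * pi) ^ ?d)"
  have c0: "c \<noteq> 0" by (simp add: c_def)
  define q where "q \<xi> = complex_of_real (norm \<xi> powr (real ?d + p))" for \<xi> :: "real ^ 'd"
  define K where "K \<xi> y = exp (\<i> * of_real ((u + ?s *\<^sub>R y) \<bullet> \<xi>)) * (q \<xi> * fourier f (\<xi>, norm \<xi> *\<^sub>R y))" for \<xi> y
  have F_meas [measurable]: "(\<lambda>p. fourier f (fst p, norm (fst p) *\<^sub>R snd p)) \<in> borel_measurable (borel \<Otimes>\<^sub>M borel)"
    unfolding borel_prod
    by (intro borel_measurable_continuous_onI fourier_continuous_compose[OF fs] continuous_intros)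
  have F_meas2 [measurable]: "(\<lambda>y. fourier f (\<xi>, norm \<xi> *\<^sub>R y)) \<in> borel_measurable borel" for \<xi>
    by (intro borel_measurable_continuous_onI fourier_continuous_compose[OF fs] continuous_intros)
  have K_meas: "(\<lambda>(\<xi>, y). K \<xi> y) \<in> borel_measurable (lborel \<Otimes>\<^sub>M lborel)"
    unfolding K_def q_def case_prod_unfold by measurable
  have K_meas2: "(\<lambda>y. K \<xi> y) \<in> borel_measurable borel" for \<xi>
    unfolding K_def by measurable
  \<comment> \<open>\<open>0 powr r\<close> is 0 for every \<open>r\<close>, so \<open>K\<close>
    vanishes at \<xi> = 0, where no rescaling of \<open>y\<close> is possible.\<close>
  have q0: "q 0 = 0" by (simp add: q_def)
  have qpow: "q \<xi> = of_real (norm \<xi> powr p) * of_real (norm \<xi> ^ ?d)" if "\<xi> \<noteq> 0" for \<xi>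
    using that by (simp add: q_def powr_add powr_realpow flip: of_real_mult of_real_power)
  have Kint: "integrable lborel (K \<xi>)" for \<xi>
  proof (cases "\<xi> = 0")
    case False
    then have "integrable lborel (\<lambda>y. fourier f (\<xi>, norm \<xi> *\<^sub>R y))"
      using integrable_lborel_affine[OF integrable_fourier_slice[OF fs], of "norm \<xi>" \<xi> 0] by simp
    then have "integrable lborel (\<lambda>y. q \<xi> * fourier f (\<xi>, norm \<xi> *\<^sub>R y))" by (rule integrable_mult_right)
    then show ?thesis
    proof (rule Bochner_Integration.integrable_bound)
      show "K \<xi> \<in> borel_measurable lborel" using K_meas2[of \<xi>] by simp
    qed (simp add: K_def norm_mult)
  next
    case True
    then have "K \<xi> = (\<lambda>_. 0)" by (simp add: fun_eq_iff K_def q0)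
    then show ?thesis by simp
  qed
  \<comment> \<open>The Jacobian of \<eta> = |\<xi>| y consumes |\<xi>|^d, so the remaining
    singularity is |\<xi>|^p, which the hypothesis p > -d makes integrable.\<close>
  have norm_K: "(LINT y|lborel. norm (K \<xi> y)) = norm \<xi> powr p * (LINT \<eta>|lborel. norm (fourier f (\<xi>, \<eta>)))" if "\<xi> \<noteq> 0" for \<xi>
  proof -
    have "(LINT \<eta>|lborel. norm (fourier f (\<xi>, \<eta>))) = norm \<xi> ^ ?d * (LINT y|lborel. norm (fourier f (\<xi>, norm \<xi> *\<^sub>R y)))"
      using integral_lborel_affine[OF integrable_norm[OF integrable_fourier_slice[OF fs]], of "norm \<xi>" \<xi> 0] that by simp
    then show ?thesis
      unfolding K_def using that by (simp add: norm_mult qpow norm_power)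
  qed
  obtain m where "max (2 * real DIM(real ^ 'd) + p) (2 * real DIM(real ^ 'd)) \<le> real m"
    using real_arch_simple by blast
  then have m: "2 * real DIM(real ^ 'd) + p \<le> real m" "2 * DIM(real ^ 'd) \<le> m" by linarith+
  have p': "p > - real DIM(real ^ 'd)" using p by simp
  obtain C where C: "\<And>\<xi> \<eta>. norm (fourier f (\<xi>, \<eta>)) \<le> C / ((1 + norm \<xi>) ^ m * (1 + norm \<eta>) ^ ?m)"
    using fourier_decay_Pair[OF fs] by metis
  have C0: "0 \<le> C" using order.trans[OF norm_ge_zero C[of 0 0]] by simp
  define I where "I = (LINT \<eta>|lborel. 1 / (1 + norm (\<eta> :: real ^ 'd)) ^ ?m)"
  have I0: "0 \<le> I" unfolding I_def by (intro Bochner_Integration.integral_nonneg) auto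
  have Fle: "(LINT \<eta>|lborel. norm (fourier f (\<xi>, \<eta>))) \<le> C / (1 + norm \<xi>) ^ m * I" for \<xi>
  proof -
    have "(LINT \<eta>|lborel. norm (fourier f (\<xi>, \<eta>))) \<le> (LINT \<eta>|lborel. C / (1 + norm \<xi>) ^ m * (1 / (1 + norm (\<eta> :: real ^ 'd)) ^ ?m))"
      using C[of \<xi>] by (intro integral_mono integrable_norm integrable_fourier_slice[OF fs] integrable_mult_right integrable_inverse_power_norm order_refl) simp
    then show ?thesis unfolding integral_mult_right_zero I_def .
  qed
  have int: "integrable (lborel \<Otimes>\<^sub>M lborel) (\<lambda>(\<xi>, y). K \<xi> y)"
  proof (rule lborel_pair.Fubini_integrable[OF K_meas])
    show "AE \<xi> in lborel. integrable lborel (\<lambda>y. case (\<xi>, y) of (\<xi>, y) \<Rightarrow> K \<xi> y)"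
      using Kint by simp
    show "integrable lborel (\<lambda>\<xi>. LINT y|lborel. norm (case (\<xi>, y) of (\<xi>, y) \<Rightarrow> K \<xi> y))"
    proof (rule Bochner_Integration.integrable_bound[OF integrable_mult_left[OF integrable_powr_norm_decay[OF p' m], of "C * I"]])
      show "(\<lambda>\<xi>. LINT y|lborel. norm (case (\<xi>, y) of (\<xi>, y) \<Rightarrow> K \<xi> y)) \<in> borel_measurable lborel"
        using K_meas by measurable
      show "AE \<xi> in lborel. norm (LINT y|lborel. norm (case (\<xi>, y) of (\<xi>, y) \<Rightarrow> K \<xi> y)) \<le> norm (norm \<xi> powr p / (1 + norm \<xi>) ^ m * (C * I))"
      proof (rule eventually_mono[OF AE_lborel_singleton[of 0]])
        fix \<xi> :: "real ^ 'd" assume "\<xi> \<noteq> 0"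
        then have "(LINT y|lborel. norm (K \<xi> y)) \<le> norm \<xi> powr p * (C / (1 + norm \<xi>) ^ m * I)"
          unfolding norm_K[OF \<open>\<xi> \<noteq> 0\<close>] by (intro mult_left_mono Fle) simp
        moreover have "0 \<le> (LINT y|lborel. norm (K \<xi> y))" by (intro Bochner_Integration.integral_nonneg) auto
        ultimately show "norm (LINT y|lborel. norm (case (\<xi>, y) of (\<xi>, y) \<Rightarrow> K \<xi> y)) \<le> norm (norm \<xi> powr p / (1 + norm \<xi>) ^ m * (C * I))"
          using C0 I0 by (simp add: abs_mult)
      qed
    qed
  qed
  have H_eq: "H (u + ?s *\<^sub>R y, y) = (LINT \<xi>|lborel. K \<xi> y) / c" for y
  proof -
    have "fourier f (\<xi>, - norm y *\<^sub>R \<xi>) = fourier f (\<xi>, norm \<xi> *\<^sub>R y)" for \<xi>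
      by (rule fourier_radial[OF f]) (simp add: mult.commute)
    then show ?thesis
      by (simp add: H_def inverse_fourier_eq K_def q_def c_def)
  qed
  have "integrable lborel (\<lambda>y. (LINT \<xi>|lborel. K \<xi> y) / c)"
    using lborel_pair.integrable_snd[OF int] by simp
  then show "integrable lborel (\<lambda>y. H (u + norm v *\<^sub>R y, y))" unfolding H_eq .
  have Ky: "(LINT y|lborel. K \<xi> y) = exp (\<i> * of_real (u \<bullet> \<xi>)) * (c * (of_real (norm \<xi> powr p) * partial_fourier f \<xi> v))" if "\<xi> \<noteq> 0" for \<xi>
  proof -
    \<comment> \<open>\<omega> is the vector of length |v| along \<xi>, so that \<omega> . (|\<xi>|
      y) = |v| (y . \<xi>): the phase of \<open>K\<close> becomes a Fourier kernel in \<eta> at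
      \<omega>. Inversion yields the partial transform at \<omega>, which by radiality equals that
      at \<open>v\<close>.\<close>
    define \<omega> where "\<omega> = (?s / norm \<xi>) *\<^sub>R \<xi>"
    let ?G = "\<lambda>\<eta>. exp (\<i> * of_real (\<omega> \<bullet> \<eta>)) * fourier f (\<xi>, \<eta>)"
    have G: "integrable lborel ?G"
    proof (rule Bochner_Integration.integrable_bound[OF integrable_fourier_slice[OF fs, of \<xi>]])
      show "?G \<in> borel_measurable lborel"
        using borel_measurable_integrable[OF integrable_fourier_slice[OF fs, of \<xi>]] by measurable
    qed (simp add: norm_mult)
    have "K \<xi> y = (exp (\<i> * of_real (u \<bullet> \<xi>)) * of_real (norm \<xi> powr p)) * (of_real (norm \<xi> ^ ?d) * ?G (0 + norm \<xi> *\<^sub>R y))" for y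
    proof -
      have "\<omega> \<bullet> (norm \<xi> *\<^sub>R y) = ?s * (y \<bullet> \<xi>)" using that by (simp add: \<omega>_def inner_commute)
      then show ?thesis unfolding K_def qpow[OF that]
        by (simp add: inner_add_left distrib_left exp_add mult_ac)
    qed
    then have "(LINT y|lborel. K \<xi> y) = (exp (\<i> * of_real (u \<bullet> \<xi>)) * of_real (norm \<xi> powr p)) * (of_real (norm \<xi> ^ ?d) * (LINT y|lborel. ?G (0 + norm \<xi> *\<^sub>R y)))"
      by (simp only: integral_mult_right_zero)
    also have "of_real (norm \<xi> ^ ?d) * (LINT y|lborel. ?G (0 + norm \<xi> *\<^sub>R y)) = (LINT \<eta>|lborel. ?G \<eta>)"
      using integral_lborel_affine[OF G, of "norm \<xi>" 0] that by (simp add: scaleR_conv_of_real)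
    also have "\<dots> = c * inverse_fourier (\<lambda>\<eta>. fourier f (\<xi>, \<eta>)) \<omega>"
      using c0 by (simp add: inverse_fourier_eq c_def)
    also have "\<dots> = c * partial_fourier f \<xi> v"
      using partial_fourier_radial[OF f, of \<omega> v] that by (simp add: partial_fourier_inversion[OF fs] \<omega>_def)
    finally show ?thesis by (simp add: mult_ac)
  qed
  have "cone_transform H (u, v) = (LINT y|lborel. LINT \<xi>|lborel. K \<xi> y) / c"
    by (simp add: cone_transform_def H_eq)
  also have "(LINT y|lborel. LINT \<xi>|lborel. K \<xi> y) = (LINT \<xi>|lborel. LINT y|lborel. K \<xi> y)"
    by (rule lborel_pair.Fubini_integral[OF int])
  also have "\<dots> = (LINT \<xi>|lborel. exp (\<i> * of_real (u \<bullet> \<xi>)) * (c * (of_real (norm \<xi> powr p) * partial_fourier f \<xi> v)))"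
  proof (rule integral_cong_AE)
    show "(\<lambda>\<xi>. LINT y|lborel. K \<xi> y) \<in> borel_measurable lborel" using K_meas by measurable
    have [measurable]: "(\<lambda>\<xi>. partial_fourier f \<xi> v) \<in> borel_measurable borel"
      by (rule borel_measurable_continuous_onI[OF continuous_partial_fourier1[OF fs]])
    show "(\<lambda>\<xi>. exp (\<i> * of_real (u \<bullet> \<xi>)) * (c * (of_real (norm \<xi> powr p) * partial_fourier f \<xi> v))) \<in> borel_measurable lborel"
      by measurable
    show "AE \<xi> in lborel. (LINT y|lborel. K \<xi> y) = exp (\<i> * of_real (u \<bullet> \<xi>)) * (c * (of_real (norm \<xi> powr p) * partial_fourier f \<xi> v))"
      by (rule eventually_mono[OF AE_lborel_singleton[of 0] Ky])
  qed
  finally show "cone_transform H (u, v) =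
      inverse_fourier (\<lambda>\<xi>. of_real ((2 * pi) ^ ?d) * (of_real (norm \<xi> powr p) * partial_fourier f \<xi> v)) u"
    by (simp add: inverse_fourier_eq c_def)
qed

theorem theorem2:
  fixes n :: nat and k :: real
    and f F :: "(real ^ 'd::finite) \<times> (real ^ 'd) \<Rightarrow> complex"
    and fr Fr :: "(real ^ 'd) \<times> real \<Rightarrow> complex"
  assumes "n \<ge> 2" and "CARD('d) = n - 1"
    and "f \<in> schwartz_r"
    and "\<And>x y. f (x, y) = fr (x, norm y)"
    and "k < real n - 1"
    and "F = cone_transform f"
    and "\<And>u s. s \<ge> 0 \<Longrightarrow> Fr (u, s) = radial_cone_transform fr (u, s)"
  shows "(\<forall>x y. f (x, y) = of_real ((2 * pi) powr (1 - real n)) *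
            riesz1 (- k) (cone_transform (riesz1 (k + 1 - real n) F)) (x, y)) \<and>
         (\<forall>x s. s \<ge> 0 \<longrightarrow> fr (x, s) = of_real ((2 * pi) powr (1 - real n)) *
            riesz1 (- k) (radial_cone_transform (riesz1 (k + 1 - real n) Fr)) (x, s))"
proof -
  note f = assms(3) and fr = assms(4)
  have fs: "f \<in> schwartz" using f by (simp add: schwartz_r_def)
  have d: "real CARD('d) = real n - 1" using assms(1,2) by simp
  have k: "- k > - real CARD('d)" using assms(5) d by simp
  define c where "c = complex_of_real ((2 * pi) ^ CARD('d))"
  have c: "of_real ((2 * pi) powr (1 - real n)) * c = 1"
  proof -
    have "(2 * pi) ^ CARD('d) = (2 * pi) powr (real n - 1)"
      using d by (subst powr_realpow[symmetric]) auto
    then have "(2 * pi) powr (1 - real n) * (2 * pi) ^ CARD('d) = 1"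
      by (simp flip: powr_add)
    then show ?thesis unfolding c_def by (simp only: of_real_mult[symmetric] of_real_1)
  qed
  define H where "H = (\<lambda>(u, v). inverse_fourier (\<lambda>\<xi>. of_real (norm \<xi> powr (real CARD('d) + - k)) * fourier f (\<xi>, - norm (v :: real ^ 'd) *\<^sub>R \<xi>)) u)"
  \<comment> \<open>\<open>riesz\<close> of order r multiplies by |\<xi>|^(-r); for r = k + 1 - n
    the exponent is d - k.\<close>
  have e: "- (k + 1 - real n) = real CARD('d) + - k" using d by simp
  have int: "integrable lborel (\<lambda>\<xi>. of_real (norm \<xi> powr r) * fourier f (\<xi>, - norm v *\<^sub>R \<xi>))"
    if "r > - real CARD('d)" for r and v :: "real ^ 'd"
    by (intro integrable_powr_fourier[OF fs] continuous_intros) (use that in simp)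
  have riesz_F: "riesz1 (k + 1 - real n) F = H"
  proof (rule ext, clarify)
    fix u v :: "real ^ 'd"
    have "integrable lborel (\<lambda>\<xi>. fourier f (\<xi>, - norm v *\<^sub>R \<xi>))"
    proof -
      \<comment> \<open>The exponent 0 does not give the multiplier 1 at the origin, because
        \<open>0 powr 0\<close> is 0; the unfiltered transform is recovered almost
        everywhere.\<close>
      have "integrable lborel (\<lambda>\<xi>. of_real (norm \<xi> powr 0) * fourier f (\<xi>, - norm v *\<^sub>R \<xi>))"
        by (rule int) simp
      moreover have "AE \<xi> in lborel. of_real (norm \<xi> powr 0) * fourier f (\<xi>, - norm v *\<^sub>R \<xi>) = fourier f (\<xi>, - norm v *\<^sub>R \<xi>)"
        by (rule eventually_mono[OF AE_lborel_singleton[of 0]]) simp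
      moreover have "(\<lambda>\<xi>. fourier f (\<xi>, - norm v *\<^sub>R \<xi>)) \<in> borel_measurable borel"
        by (intro borel_measurable_continuous_onI fourier_continuous_compose[OF fs] continuous_intros)
      ultimately show ?thesis by (subst integrable_cong_AE[symmetric]) auto
    qed
    moreover have "integrable lborel (\<lambda>\<xi>. of_real (norm \<xi> powr (- (k + 1 - real n))) * fourier f (\<xi>, - norm v *\<^sub>R \<xi>))"
      by (rule int) (use e k in linarith)
    ultimately have "riesz (k + 1 - real n) (inverse_fourier (\<lambda>\<xi>. fourier f (\<xi>, - norm v *\<^sub>R \<xi>))) =
      inverse_fourier (\<lambda>\<xi>. of_real (norm \<xi> powr (- (k + 1 - real n))) * fourier f (\<xi>, - norm v *\<^sub>R \<xi>))"
      by (rule riesz_inverse_fourier)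
    then show "riesz1 (k + 1 - real n) F (u, v) = H (u, v)"
      unfolding riesz1_def prod.case assms(6) cone_transform_eq_inverse_fourier[OF fs] H_def e by simp
  qed
  have cone_H: "(\<lambda>u. cone_transform H (u, v)) =
      inverse_fourier (\<lambda>\<xi>. c * (of_real (norm \<xi> powr (- k)) * partial_fourier f \<xi> v))" for v
    unfolding H_def c_def by (rule ext, rule cone_transform_filtered[OF f k])
  have main: "riesz1 (- k) (cone_transform H) (x, y) = c * f (x, y)" for x y
  proof -
    let ?g = "\<lambda>\<xi>. c * (of_real (norm \<xi> powr (- k)) * partial_fourier f \<xi> y)"
    have ig: "integrable lborel ?g"
      by (intro integrable_mult_right integrable_powr_partial_fourier[OF fs]) (use k in simp)
    have ip: "integrable lborel (\<lambda>\<xi>. c * partial_fourier f \<xi> y)"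
      by (intro integrable_mult_right integrable_partial_fourier1[OF fs])
    \<comment> \<open>The two opposite powers cancel off the origin only, so the product is
      identified up to a null set, which the inverse Fourier integral cannot see.\<close>
    have ae: "AE \<xi> in lborel. of_real (norm \<xi> powr (- (- k))) * ?g \<xi> = c * partial_fourier f \<xi> y"
    proof (rule eventually_mono[OF AE_lborel_singleton[of 0]])
      fix \<xi> :: "real ^ 'd" assume "\<xi> \<noteq> 0"
      then have "norm \<xi> powr (- (- k)) * norm \<xi> powr (- k) = 1"
        by (simp flip: powr_add)
      then have "complex_of_real (norm \<xi> powr (- (- k))) * of_real (norm \<xi> powr (- k)) = 1"
        by (simp only: of_real_mult[symmetric] of_real_1)
      moreover have "a * (c * (b * z)) = (a * b) * (c * z)" for a b z :: complex by simp
      ultimately show "of_real (norm \<xi> powr (- (- k))) * ?g \<xi> = c * partial_fourier f \<xi> y"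
        by (simp only: mult_1_left)
    qed
    have [measurable]: "?g \<in> borel_measurable borel" "(\<lambda>\<xi>. c * partial_fourier f \<xi> y) \<in> borel_measurable borel"
      using ig ip by auto
    have mg: "(\<lambda>\<xi>. of_real (norm \<xi> powr (- (- k))) * ?g \<xi>) \<in> borel_measurable borel"
      using \<open>?g \<in> borel_measurable borel\<close> by measurable
    have "integrable lborel (\<lambda>\<xi>. of_real (norm \<xi> powr (- (- k))) * ?g \<xi>)"
      using ip ae mg by (subst integrable_cong_AE[OF _ _ ae]) auto
    from riesz_inverse_fourier[OF ig this]
    have "riesz1 (- k) (cone_transform H) (x, y) = inverse_fourier (\<lambda>\<xi>. of_real (norm \<xi> powr (- (- k))) * ?g \<xi>) x"
      by (simp only: riesz1_def prod.case cone_H)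
    also have "\<dots> = inverse_fourier (\<lambda>\<xi>. c * partial_fourier f \<xi> y) x"
      unfolding inverse_fourier_def by (subst fourier_cong_AE[OF ae mg]) auto
    also have "\<dots> = c * inverse_fourier (\<lambda>\<xi>. partial_fourier f \<xi> y) x"
      by (simp add: inverse_fourier_def fourier_cmult)
    finally show ?thesis by (simp only: slice_inversion[OF fs])
  qed
  have one: "f (x, y) = of_real ((2 * pi) powr (1 - real n)) * riesz1 (- k) (cone_transform (riesz1 (k + 1 - real n) F)) (x, y)" for x y
    unfolding riesz_F main by (simp only: mult.assoc[symmetric] c mult_1_left)
  have Fr_eq: "Fr (u, norm v) = F (u, v)" for u v
    unfolding assms(6) assms(7)[OF norm_ge_zero]
    by (rule radial_cone_transform_eq[OF integrable_cone_slice[OF fs] fr])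
  \<comment> \<open>\<open>riesz1\<close> works on each slice separately, so it suffices that the
    slice of \<open>Fr\<close> at |v| coincides with that of \<open>F\<close> at
    \<open>v\<close>.\<close>
  have Hr: "H (u, v) = riesz1 (k + 1 - real n) Fr (u, norm v)" for u v
    unfolding riesz_F[symmetric] riesz1_def prod.case Fr_eq ..
  have Cr: "radial_cone_transform (riesz1 (k + 1 - real n) Fr) (u, norm v) = cone_transform H (u, v)" for u v
  proof (rule radial_cone_transform_eq)
    \<comment> \<open>\<open>H\<close> is known only as an inverse Fourier integral, so this comes
      from the Fubini argument rather than from Schwartz decay.\<close>
    show "integrable lborel (\<lambda>y. H (u + norm v *\<^sub>R y, y))"
      unfolding H_def by (rule integrable_cone_filtered[OF f k])
  qed (rule Hr)
  have two: "fr (x, norm y) = of_real ((2 * pi) powr (1 - real n)) * riesz1 (- k) (radial_cone_transform (riesz1 (k + 1 - real n) Fr)) (x, norm y)" for x and y :: "real ^ 'd"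
  proof -
    have "riesz1 (- k) (radial_cone_transform (riesz1 (k + 1 - real n) Fr)) (x, norm y) = riesz1 (- k) (cone_transform H) (x, y)"
      unfolding riesz1_def prod.case Cr[unfolded riesz1_def prod.case] ..
    then show ?thesis using one[of x y] unfolding riesz_F fr by simp
  qed
  \<comment> \<open>Every s \<ge> 0 is the norm of some vector, so the identity at
    \<open>norm y\<close> covers the whole half-line.\<close>
  have "\<exists>y :: real ^ 'd. norm y = s" if "s \<ge> 0" for s using vector_choose_size[OF that] by metis
  then show ?thesis using one two by metis
qed

end
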